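(* Let $s\in\{1,\ldots,d\}$, $\beta\in(0,1)$ and $\sigma>0$ be fixed numbers, and let $d=d_\varepsilon\to\infty$ and $\log\binom ds=o(\log\varepsilon^{-1})$ as $\varepsilon\to0$. Let the family of collections $r_\varepsilon=\{r_{\varepsilon,k},1\le k\le s\}$, $r_{\varepsilon,k}>0$, be such that $$\limsup_{\varepsilon\to0}\min_{1\le k\le s}\frac{a_{\varepsilon,u_k}(r_{\varepsilon,k})}{\sqrt{\log\binom dk}}<\sqrt2\,\bigl(1+\sqrt{1-\beta}\bigr),$$ where $u_k$ is an arbitrary element of $\mathcal U_{k,d}$. Then $$\liminf_{\varepsilon\to0}\ \inf_{\tilde{\boldsymbol\eta}}\ \sup_{\boldsymbol\eta\in\mathcal H^s_{\beta,d}}\ \sup_{\boldsymbol\theta\in\Theta^\sigma_{s,d}(r_\varepsilon)}\ \mathrm E_{\boldsymbol\theta,\boldsymbol\eta}\sum_{k=1}^s\sum_{u_k\in\mathcal U_{k,d}}|\tilde\eta_{u_k}-\eta_{u_k}|>0,$$ where the infimum is taken over all selectors $\tilde{\boldsymbol\eta}$ of $\boldsymbol\eta\in\mathcal H^s_{\beta,d}$ in the model below.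
   Context: Setting. $\varepsilon>0$ is a noise level tending to $0$. For $1\le k\le d$, $\mathcal U_{k,d}$ is the set of subsets $u_k\subseteq\{1,\ldots,d\}$ with $k$ elements, and $\mathring{\mathbb Z}_{u_k}=\{\boldsymbol\ell=(l_1,\ldots,l_d)\in\mathbb Z^d: l_j=0 \text{ for } j\notin u_k,\ l_j\neq0 \text{ for } j\in u_k\}$. For $\boldsymbol\ell\in\mathbb Z^d$ put $c_{\boldsymbol\ell}^2=\bigl(\sum_{j=1}^d(2\pi l_j)^2\bigr)^{\sigma}$. For $r>0$ let $$\mathring\Theta_{\mathbf c_{u_k}}(r)=\Bigl\{\boldsymbol\theta_{u_k}=(\theta_{\boldsymbol\ell}(u_k))_{\boldsymbol\ell\in\mathring{\mathbb Z}_{u_k}}: \sum_{\boldsymbol\ell\in\mathring{\mathbb Z}_{u_k}}\theta_{\boldsymbol\ell}^2(u_k)c_{\boldsymbol\ell}^2\le1,\ \sum_{\boldsymbol\ell\in\mathring{\mathbb Z}_{u_k}}\theta_{\boldsymbol\ell}^2(u_k)\ge r^2\Bigr\}.$$ Given $r_\varepsilon=\{r_{\varepsilon,k}\}$, $\Theta^\sigma_{s,d}(r_\varepsilon)$ is the set of all collections $\boldsymbol\theta=(\boldsymbol\theta_{u_k},u_k\in\mathcal U_{k,d},1\le k\le s)$ with $\boldsymbol\theta_{u_k}\in\mathring\Theta_{\mathbf c_{u_k}}(r_{\varepsilon,k})$ for every $u_k$ and $k$. For $1\le k\le s$, $H^k_{\beta,d}$ is the set of $\boldsymbol\eta_k=(\eta_{u_k})_{u_k\in\mathcal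 U_{k,d}}\in\{0,1\}^{\mathcal U_{k,d}}$ with $\sum_{u_k\in\mathcal U_{k,d}}\eta_{u_k}=\binom{d}{k}^{1-\beta}(1+o(1))$ as $\varepsilon\to0$, and $\mathcal H^s_{\beta,d}=\{\boldsymbol\eta=(\boldsymbol\eta_1,\ldots,\boldsymbol\eta_s):\boldsymbol\eta_k\in H^k_{\beta,d}\}$. Observations (sequence space model): $X_{\boldsymbol\ell}=\eta_{u_k}\theta_{\boldsymbol\ell}(u_k)+\varepsilon\xi_{\boldsymbol\ell}$, $\boldsymbol\ell\in\mathring{\mathbb Z}_{u_k}$, $u_k\in\mathcal U_{k,d}$, $1\le k\le s$, where the $\xi_{\boldsymbol\ell}$ are i.i.d. $N(0,1)$; $\mathrm E_{\boldsymbol\theta,\boldsymbol\eta}$ denotes expectation under this model. A selector is any estimator $\tilde{\boldsymbol\eta}=(\tilde\eta_{u_k},u_k\in\mathcal U_{k,d},1\le k\le s)$ with $\tilde\eta_{u_k}\in\{0,1\}$ measurable with respect to the observations. For $r>0$, $$a^2_{\varepsilon,u_k}(r)=\frac{1}{2\varepsilon^4}\inf_{\boldsymbol\theta_{u_k}\in\mathring\Theta_{\mathbf c_{u_k}}(r)}\sum_{\boldsymbol\ell\in\mathring{\mathbb Z}_{u_k}}\theta_{\boldsymbol\ell}^4(u_k),\qquad a_{\varepsilon,u_k}(r)\ge0.$$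
   Formalization: It is additionally assumed that Θ^σ_{s,d}(r_ε) is nonempty for all small ε; otherwise (e.g. s=2, r_{ε,2}=1, r_{ε,1} tiny) the hypothesis can hold while the supremum over θ runs over the empty set and the conclusion fails. *)

theory Defs
  imports "HOL-Probability.Probability" "HOL-Library.Landau_Symbols"
begin

text \<open>Multi-indices l in Z^d are represented as functions nat => int vanishing outside
  {1..d}; the support of l is the set u with l in the punctured lattice Z_u.\<close>

definition supp_idx :: "(nat \<Rightarrow> int) \<Rightarrow> nat set" where
  "supp_idx l = {j. l j \<noteq> 0}"

definition Ukd :: "nat \<Rightarrow> nat \<Rightarrow> nat set set" where
  "Ukd k d = {u. u \<subseteq> {1..d} \<and> card u = k}"

definition Uset :: "nat \<Rightarrow> nat \<Rightarrow> nat set set" where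
  "Uset d s = (\<Union>k\<in>{1..s}. Ukd k d)"

definition Zset :: "nat set \<Rightarrow> (nat \<Rightarrow> int) set" where
  "Zset u = {l. \<forall>j. (j \<in> u \<longrightarrow> l j \<noteq> 0) \<and> (j \<notin> u \<longrightarrow> l j = 0)}"

definition Lset :: "nat \<Rightarrow> nat \<Rightarrow> (nat \<Rightarrow> int) set" where
  "Lset d s = (\<Union>u\<in>Uset d s. Zset u)"

definition csq :: "real \<Rightarrow> nat \<Rightarrow> (nat \<Rightarrow> int) \<Rightarrow> real" where
  "csq \<sigma> d l = (\<Sum>j\<in>{1..d}. (2 * pi * real_of_int (l j))\<^sup>2) powr \<sigma>"

definition Theta_block :: "real \<Rightarrow> nat \<Rightarrow> nat set \<Rightarrow> real \<Rightarrow> ((nat \<Rightarrow> int) \<Rightarrow> real) set" where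
  "Theta_block \<sigma> d u r = {\<theta>.
     (\<lambda>l. (\<theta> l)\<^sup>2 * csq \<sigma> d l) summable_on Zset u \<and>
     (\<Sum>\<^sub>\<infinity>l\<in>Zset u. (\<theta> l)\<^sup>2 * csq \<sigma> d l) \<le> 1 \<and>
     (\<lambda>l. (\<theta> l)\<^sup>2) summable_on Zset u \<and>
     (\<Sum>\<^sub>\<infinity>l\<in>Zset u. (\<theta> l)\<^sup>2) \<ge> r\<^sup>2}"

definition Theta_total :: "real \<Rightarrow> nat \<Rightarrow> nat \<Rightarrow> (nat \<Rightarrow> real) \<Rightarrow> ((nat \<Rightarrow> int) \<Rightarrow> real) set" where
  "Theta_total \<sigma> d s r = {\<theta>. \<forall>k\<in>{1..s}. \<forall>u\<in>Ukd k d. \<theta> \<in> Theta_block \<sigma> d u (r k)}"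

definition a_eps :: "real \<Rightarrow> real \<Rightarrow> nat \<Rightarrow> nat set \<Rightarrow> real \<Rightarrow> real" where
  "a_eps \<epsilon> \<sigma> d u r = sqrt (1 / (2 * \<epsilon> ^ 4) *
      Inf {(\<Sum>\<^sub>\<infinity>l\<in>Zset u. (\<theta> l) ^ 4) | \<theta>. \<theta> \<in> Theta_block \<sigma> d u r})"

definition Hset :: "nat \<Rightarrow> nat \<Rightarrow> (nat \<Rightarrow> nat) \<Rightarrow> (nat set \<Rightarrow> real) set" where
  "Hset d s p = {\<eta>. (\<forall>u. \<eta> u \<in> {0, 1}) \<and>
      (\<forall>k\<in>{1..s}. card {u \<in> Ukd k d. \<eta> u = 1} = p k)}"

text \<open>Law of the observations X_l = eta_{u} theta_l + eps xi_l, l in Z_u, u in Uset d s.\<close>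
definition obs_measure :: "real \<Rightarrow> nat \<Rightarrow> nat \<Rightarrow> ((nat \<Rightarrow> int) \<Rightarrow> real) \<Rightarrow> (nat set \<Rightarrow> real)
    \<Rightarrow> ((nat \<Rightarrow> int) \<Rightarrow> real) measure" where
  "obs_measure \<epsilon> d s \<theta> \<eta> =
     PiM (Lset d s) (\<lambda>l. density lborel (normal_density (\<eta> (supp_idx l) * \<theta> l) \<epsilon>))"

definition selectors :: "nat \<Rightarrow> nat \<Rightarrow> (nat set \<Rightarrow> ((nat \<Rightarrow> int) \<Rightarrow> real) \<Rightarrow> real) set" where
  "selectors d s = {sel. \<forall>u\<in>Uset d s.
      sel u \<in> borel_measurable (PiM (Lset d s) (\<lambda>_. borel)) \<and> (\<forall>x. sel u x \<in> {0, 1})}"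

definition risk :: "real \<Rightarrow> nat \<Rightarrow> nat \<Rightarrow> (nat set \<Rightarrow> ((nat \<Rightarrow> int) \<Rightarrow> real) \<Rightarrow> real)
    \<Rightarrow> ((nat \<Rightarrow> int) \<Rightarrow> real) \<Rightarrow> (nat set \<Rightarrow> real) \<Rightarrow> real" where
  "risk \<epsilon> d s sel \<theta> \<eta> =
     (\<integral>x. (\<Sum>k\<in>{1..s}. \<Sum>u\<in>Ukd k d. \<bar>sel u x - \<eta> u\<bar>) \<partial>obs_measure \<epsilon> d s \<theta> \<eta>)"

definition minimax_risk :: "real \<Rightarrow> real \<Rightarrow> nat \<Rightarrow> nat \<Rightarrow> (nat \<Rightarrow> nat) \<Rightarrow> (nat \<Rightarrow> real) \<Rightarrow> ereal" where
  "minimax_risk \<epsilon> \<sigma> d s p r =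
     (INF sel\<in>selectors d s. SUP \<eta>\<in>Hset d s p. SUP \<theta>\<in>Theta_total \<sigma> d s r.
        ereal (risk \<epsilon> d s sel \<theta> \<eta>))"

end

theory Submission
  imports Defs "HOL-Real_Asymp.Real_Asymp"
begin

text \<open>Fix \<open>k\<close> with \<open>a = a_eps\<close> below the threshold, and put \<open>N = d choose k\<close>. Give \<open>\<theta>\<close> on every block of
  level \<open>k\<close> independent random signs, with moduli copied from a near-minimiser of \<open>\<Sum> \<theta>^4\<close> that has been made
  finitely supported and uniformly small relative to \<open>\<epsilon>\<close>, and let the active set \<open>S\<close> be a uniformly random
  \<open>p\<close>-subset. The likelihood of \<open>S\<close> is a product over \<open>u \<in> S\<close> of independent block likelihood ratios, so a
  selector errs, up to a factor 2, whenever some inactive block has ratio at least \<open>t\<close> and some active block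
  has ratio at most \<open>t\<close>. For small moduli the block ratio \<open>Y\<close> satisfies
  \<open>E (Y powr b) \<approx> exp (a\<^sup>2 * (b\<^sup>2 - b) / 2)\<close>, as for a Gaussian shift of size \<open>a\<close>. Exponential tilting
  with parameter \<open>1 / (1 + sqrt (1 - \<beta>))\<close> then gives a \<open>t\<close> for which the two events have
  probability at least \<open>1 / N\<close> and \<open>1 / p\<close> per block.\<close>

section \<open>Likelihood ratio of one coordinate\<close>

text \<open>The signs make the fourth powers appear. For a known \<open>\<theta>\<close> a block
  ratio is governed by the sum of \<open>v = \<theta>^2 / \<epsilon>^2\<close>; averaging over signs
  cancels the first order, and a coordinate contributes variance \<open>cosh v - 1\<close>, about
  \<open>v^2 / 2\<close>. Hence \<open>a_eps^2\<close>, the sum of \<open>v^2 / 2\<close>, acts as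
  the variance of the log ratio. The obstacle is that the extremal problem in \<open>a_eps\<close>
  is not solved explicitly: a near-minimiser may have infinite support, where shifted laws need not
  have a density, and a few large coordinates, where the expansion in \<open>v\<close> fails.
  Repairing it costs \<open>\<epsilon>^2\<close> times a power of \<open>T = ln N\<close>, which
  vanishes because \<open>ln (d choose s)\<close> is \<open>o(ln (1 / \<epsilon>))\<close>. With
  \<open>A = a_eps^2\<close> and tilt \<open>a\<close>, the two probabilities are
  \<open>exp (- a^2 * A / 2)\<close> and \<open>exp (- (1 - a)^2 * A / 2)\<close> up to
  \<open>exp (o(T))\<close>. They must exceed \<open>exp (- T)\<close> and
  \<open>exp (- (1 - \<beta>) * T)\<close>. Equality in both gives
  \<open>a = 1 / (1 + sqrt (1 - \<beta>))\<close> and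
  \<open>A = 2 * (1 + sqrt (1 - \<beta>))^2 * T\<close>, the stated threshold. Errors of size
  \<open>\<delta> * T\<close> in exponents are harmless, so Chernoff bounds and a median replace a
  central limit theorem.\<close>

lemma normal_exp_moment:
  fixes b e :: real assumes "e > 0"
  shows "integrable (density lborel (normal_density 0 e)) (\<lambda>x. exp (b * x))"
    and "(\<integral>x. exp (b * x) \<partial>density lborel (normal_density 0 e)) = exp (b\<^sup>2 * e\<^sup>2 / 2)"
proof -
  have eq: "normal_density 0 e x * exp (b * x) = exp (b\<^sup>2 * e\<^sup>2 / 2) * normal_density (b * e\<^sup>2) e x" for x
  proof -
    have "- (x\<^sup>2) / (2 * e\<^sup>2) + b * x = b\<^sup>2 * e\<^sup>2 / 2 + (- (x - b * e\<^sup>2)\<^sup>2 / (2 * e\<^sup>2))"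
      using assms by (simp add: field_simps power2_eq_square)
    then have "exp (- (x\<^sup>2) / (2 * e\<^sup>2)) * exp (b * x) = exp (b\<^sup>2 * e\<^sup>2 / 2) * exp (- (x - b * e\<^sup>2)\<^sup>2 / (2 * e\<^sup>2))"
      by (metis exp_add)
    then show ?thesis by (simp add: normal_density_def)
  qed
  show "integrable (density lborel (normal_density 0 e)) (\<lambda>x. exp (b * x))"
    using assms by (subst integrable_density) (auto simp: eq)
  show "(\<integral>x. exp (b * x) \<partial>density lborel (normal_density 0 e)) = exp (b\<^sup>2 * e\<^sup>2 / 2)"
    using assms by (subst integral_density) (auto simp: eq)
qed

text \<open>The likelihood ratio of the sign-symmetric mixture of \<open>N(m, e\<^sup>2)\<close> and \<open>N(-m, e\<^sup>2)\<close>
  with respect to \<open>N(0, e\<^sup>2)\<close>.\<close>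

definition lr1 :: "real \<Rightarrow> real \<Rightarrow> real \<Rightarrow> real" where
  "lr1 e m x = cosh (m * x / e\<^sup>2) * exp (- m\<^sup>2 / (2 * e\<^sup>2))"

lemma lr1_pos [simp]: "lr1 e m x > 0"
  by (simp add: lr1_def cosh_real_pos)

lemma lr1_measurable [measurable]: "lr1 e m \<in> borel_measurable borel"
proof -
  have "lr1 e m = (\<lambda>x. (exp (m * x / e\<^sup>2) + exp (- (m * x / e\<^sup>2))) / 2 * exp (- m\<^sup>2 / (2 * e\<^sup>2)))"
    by (simp add: lr1_def fun_eq_iff cosh_field_def)
  then show ?thesis by simp
qed

text \<open>Powers of \<open>cosh\<close> are combinations of exponentials, so all moments are
  explicit in \<open>v\<close>. Only the second and fourth centred moments are wanted: the former
  carries the main term \<open>v^2 / 2\<close>, the latter is \<open>o(v^2)\<close> and controls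
  Taylor remainders.\<close>

lemma lr1_moments:
  fixes e m :: real assumes e: "e > 0"
  defines "v \<equiv> m\<^sup>2 / e\<^sup>2" and "N \<equiv> density lborel (normal_density 0 e)"
  shows "integrable N (lr1 e m)" "integral\<^sup>L N (lr1 e m) = 1"
    "integrable N (\<lambda>x. (lr1 e m x - 1)\<^sup>2)"
    "(\<integral>x. (lr1 e m x - 1)\<^sup>2 \<partial>N) = cosh v - 1"
    "integrable N (\<lambda>x. (lr1 e m x - 1) ^ 4)"
    "(\<integral>x. (lr1 e m x - 1) ^ 4 \<partial>N)
      = (exp (6 * v) + 4 + 3 * exp (- 2 * v)) / 8 - (exp (3 * v) + 3 * exp (- v)) + 6 * cosh v - 3"
proof -
  interpret prob_space N unfolding N_def using e by (rule prob_space_normal_density)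
  \<comment> \<open>The family is closed under products, \<open>E i * E j = E (i + j)\<close>, with
    mean \<open>exp (j^2 * v / 2)\<close>; expanding a power of \<open>lr1\<close> becomes
    bookkeeping of indices.\<close>
  define E where "E j x = exp (j * (m / e\<^sup>2) * x)" for j x
  have Ei: "integrable N (E j)" and Ev: "integral\<^sup>L N (E j) = exp (j\<^sup>2 * v / 2)" for j
  proof -
    show "integrable N (E j)" unfolding E_def N_def by (rule normal_exp_moment[OF e])
    have "(j * (m / e\<^sup>2))\<^sup>2 * e\<^sup>2 / 2 = j\<^sup>2 * v / 2"
      using e by (simp add: v_def field_simps power2_eq_square)
    then show "integral\<^sup>L N (E j) = exp (j\<^sup>2 * v / 2)"
      unfolding E_def N_def using normal_exp_moment(2)[OF e, of "j * (m / e\<^sup>2)"] by simp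
  qed
  define c where "c = exp (- v / 2)"
  have EE: "E i x * E j x = E (i + j) x" for i j x
    by (simp add: E_def exp_add[symmetric] algebra_simps add_divide_distrib)
  have L: "lr1 e m x = c * (E 1 x + E (-1) x) / 2" for x
    by (simp add: lr1_def E_def cosh_field_def c_def v_def)
  have E0: "E 0 x = 1" for x by (simp add: E_def)
  have cc: "c * c = exp (- v)" "c^3 = exp (- 3 * v / 2)" "c^4 = exp (- 2 * v)"
    by (simp_all add: c_def exp_add[symmetric] exp_of_nat_mult[symmetric])
  have s2: "(lr1 e m x)\<^sup>2 = c\<^sup>2 * (E 2 x + E (-2) x + 2) / 4" for x
    unfolding L by (simp add: power2_eq_square algebra_simps EE E0 flip: mult.assoc)
  have s3: "(lr1 e m x)^3 = c^3 * (E 3 x + E (-3) x + 3 * E 1 x + 3 * E (-1) x) / 8" for x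
  proof -
    have "(lr1 e m x)^3 = (lr1 e m x)\<^sup>2 * lr1 e m x" by (simp add: power2_eq_square power3_eq_cube)
    also have "\<dots> = c^3 * ((E 2 x + E (-2) x + 2) * (E 1 x + E (-1) x)) / 8"
      unfolding s2 unfolding L by (simp add: power2_eq_square power3_eq_cube)
    also have "(E 2 x + E (-2) x + 2) * (E 1 x + E (-1) x) = E 3 x + E (-3) x + 3 * E 1 x + 3 * E (-1) x"
      by (simp add: algebra_simps EE)
    finally show ?thesis .
  qed
  have s4: "(lr1 e m x)^4 = c^4 * (E 4 x + E (-4) x + 4 * E 2 x + 4 * E (-2) x + 6) / 16" for x
  proof -
    have "(lr1 e m x)^4 = (lr1 e m x)\<^sup>2 * (lr1 e m x)\<^sup>2" by (simp add: power2_eq_square power4_eq_xxxx)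
    also have "\<dots> = c^4 * ((E 2 x + E (-2) x + 2) * (E 2 x + E (-2) x + 2)) / 16"
      unfolding s2 by (simp add: power2_eq_square power4_eq_xxxx)
    also have "(E 2 x + E (-2) x + 2) * (E 2 x + E (-2) x + 2) = E 4 x + E (-4) x + 4 * E 2 x + 4 * E (-2) x + 6"
      by (simp add: algebra_simps EE E0)
    finally show ?thesis .
  qed
  note [simp] = Ei Ev prob_space
  have i1: "integrable N (lr1 e m)" unfolding L by simp
  have v1: "integral\<^sup>L N (lr1 e m) = 1" unfolding L
    by (simp add: c_def exp_add[symmetric])
  have i2: "integrable N (\<lambda>x. (lr1 e m x)\<^sup>2)" unfolding s2 by simp
  have v2: "(\<integral>x. (lr1 e m x)\<^sup>2 \<partial>N) = cosh v" unfolding s2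
    by (simp add: power2_eq_square cc cosh_field_def algebra_simps exp_add[symmetric])
  have i3: "integrable N (\<lambda>x. (lr1 e m x)^3)" unfolding s3 by simp
  have v3: "(\<integral>x. (lr1 e m x)^3 \<partial>N) = (exp (3 * v) + 3 * exp (- v)) / 4" unfolding s3
    by (simp add: cc algebra_simps exp_add[symmetric])
  have i4: "integrable N (\<lambda>x. (lr1 e m x)^4)" unfolding s4 by simp
  have v4: "(\<integral>x. (lr1 e m x)^4 \<partial>N) = (exp (6 * v) + 4 + 3 * exp (- 2 * v)) / 8" unfolding s4
    by (simp add: cc algebra_simps exp_add[symmetric])
  have p2: "(y - 1)\<^sup>2 = y\<^sup>2 - 2 * y + 1" and p4: "(y - 1)^4 = y^4 - 4 * y^3 + 6 * y\<^sup>2 - 4 * y + 1" for y :: real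
    by algebra+
  show "integrable N (lr1 e m)" "integral\<^sup>L N (lr1 e m) = 1" by (fact i1 v1)+
  show "integrable N (\<lambda>x. (lr1 e m x - 1)\<^sup>2)" "integrable N (\<lambda>x. (lr1 e m x - 1)^4)"
    unfolding p2 p4 using i1 i2 i3 i4 by auto
  show "(\<integral>x. (lr1 e m x - 1)\<^sup>2 \<partial>N) = cosh v - 1" 
    unfolding p2 using i1 i2 by (simp add: v1 v2)
  show "(\<integral>x. (lr1 e m x - 1) ^ 4 \<partial>N)
      = (exp (6 * v) + 4 + 3 * exp (- 2 * v)) / 8 - (exp (3 * v) + 3 * exp (- v)) + 6 * cosh v - 3"
    unfolding p4 using i1 i2 i3 i4 by (simp add: v1 v2 v3 v4 field_simps)
qed

lemma powr_le_one_plus: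
  fixes x a :: real
  assumes "x > 0" "0 \<le> a" "a \<le> 1"
  shows "x powr a \<le> 1 + x"
proof (cases "x \<ge> 1")
  case True then have "x powr a \<le> x powr 1" using assms by (intro powr_mono) auto
  then show ?thesis using assms by simp
next
  case False then have "x powr a \<le> 1 powr a" using assms by (intro powr_mono2) auto
  then show ?thesis using assms by simp
qed

text \<open>Near 1 this is Taylor's formula with remainder \<open>o((x - 1)^2)\<close>. Away from 1
  a crude quadratic bound is absorbed by the quartic term, which is affordable because the fourth
  centred moment of \<open>lr1\<close> is of smaller order than \<open>v^2\<close>.\<close>

lemma powr_second_order:
  fixes a \<eta> :: real
  assumes a: "0 < a" "a < 1" and \<eta>: "\<eta> > 0"
  obtains K where "K \<ge> 0" "\<And>x. x > 0 \<Longrightarrow>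
    \<bar>x powr a - 1 - a * (x - 1) + a * (1 - a) / 2 * (x - 1)\<^sup>2\<bar> \<le> \<eta> * (x - 1)\<^sup>2 + K * (x - 1) ^ 4"
proof -
  define R where "R x = x powr a - 1 - a * (x - 1) + a * (1 - a) / 2 * (x - 1)\<^sup>2" for x
  have "((\<lambda>h. ((1 + h) powr a - 1 - a * h + a * (1 - a) / 2 * h\<^sup>2) / h\<^sup>2) \<longlongrightarrow> 0) (at_right 0)"
    "((\<lambda>h. ((1 + h) powr a - 1 - a * h + a * (1 - a) / 2 * h\<^sup>2) / h\<^sup>2) \<longlongrightarrow> 0) (at_left 0)"
    using a by (real_asymp simp: field_simps)+
  then have "((\<lambda>h. R (1 + h) / h\<^sup>2) \<longlongrightarrow> 0) (at 0)"
    unfolding filterlim_at_split R_def by simp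
  then have "eventually (\<lambda>h. \<bar>R (1 + h) / h\<^sup>2\<bar> < \<eta>) (at 0)"
    using \<eta> unfolding tendsto_iff dist_real_def by simp
  then obtain \<rho> where \<rho>: "\<rho> > 0" "\<And>h. h \<noteq> 0 \<Longrightarrow> \<bar>h\<bar> < \<rho> \<Longrightarrow> \<bar>R (1 + h) / h\<^sup>2\<bar> < \<eta>"
    unfolding eventually_at dist_real_def by auto
  \<comment> \<open>The three summands absorb \<open>3\<close>, \<open>2 * y\<close> and
    \<open>y^2\<close> for \<open>y \<ge> \<rho>\<close>; that quadratic bounds the remainder
    through \<open>x powr a \<le> 2 + y\<close>.\<close>
  define K where "K = 3 / \<rho>^4 + 2 / \<rho>^3 + 1 / \<rho>\<^sup>2"
  have "\<bar>R x\<bar> \<le> \<eta> * (x - 1)\<^sup>2 + K * (x - 1) ^ 4" if x: "x > 0" for x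
  proof (cases "\<bar>x - 1\<bar> < \<rho>")
    case True
    have "\<bar>R x\<bar> \<le> \<eta> * (x - 1)\<^sup>2"
    proof (cases "x = 1")
      case False
      with \<rho>(2)[of "x - 1"] True have "\<bar>R x\<bar> / (x - 1)\<^sup>2 < \<eta>" by (simp add: abs_divide)
      then show ?thesis using False by (simp add: divide_simps split: if_splits)
    qed (simp add: R_def)
    moreover have "K * (x - 1)^4 \<ge> 0" using \<rho> by (simp add: K_def)
    ultimately show ?thesis by linarith
  next
    case False
    define y where "y = \<bar>x - 1\<bar>"
    have y: "y \<ge> \<rho>" "y > 0" using False \<rho> by (auto simp: y_def)
    have "x powr a \<le> 2 + y" using powr_le_one_plus[of x a] a x by (simp add: y_def)
    then have 1: "x powr a \<le> 2 + y" "0 \<le> x powr a" by simp_all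
    have 2: "\<bar>a * (x - 1)\<bar> \<le> y" using a by (simp add: abs_mult y_def mult_left_le_one_le)
    have "a * (1 - a) / 2 \<le> 1" using a mult_left_le_one_le[of "1-a" a] by (simp; linarith)
    then have "a * (1 - a) / 2 * (x - 1)\<^sup>2 \<le> 1 * (x - 1)\<^sup>2" by (rule mult_right_mono) simp
    then have 3: "a * (1 - a) / 2 * (x - 1)\<^sup>2 \<le> y\<^sup>2" "0 \<le> a * (1 - a) / 2 * (x - 1)\<^sup>2" 
      using a by (auto simp: y_def)
    have "\<bar>R x\<bar> \<le> 3 + 2 * y + y\<^sup>2" unfolding R_def using 1 2 3 by linarith
    also have "\<dots> \<le> K * y^4"
    proof -
      have "\<rho>^4 \<le> y^4" "\<rho>^3 \<le> y^3" "\<rho>^2 \<le> y^2" using \<rho> y by (auto intro!: power_mono)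
      then have "3 \<le> 3 / \<rho>^4 * y^4" "2 \<le> 2 / \<rho>^3 * y^3" "1 \<le> 1 / \<rho>^2 * y^2"
        using \<rho> by (auto simp: field_simps)
      moreover have "2 * y \<le> 2 / \<rho>^3 * y^3 * y" using mult_right_mono[OF calculation(2), of y] y by simp
      moreover have "1 * y^2 \<le> 1 / \<rho>^2 * y^2 * y^2" using mult_right_mono[OF calculation(3), of "y^2"] y by simp
      moreover have "K * y^4 = 3 / \<rho>^4 * y^4 + 2 / \<rho>^3 * y^3 * y + 1 / \<rho>^2 * y^2 * y^2"
        unfolding K_def by (simp add: ring_distribs power2_eq_square power3_eq_cube power4_eq_xxxx)
      ultimately show ?thesis by linarith
    qed
    also have "y^4 = (x - 1)^4" by (simp add: y_def)
    finally show ?thesis using \<eta> by (simp add: add_increasing)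
  qed
  moreover have "K \<ge> 0" using \<rho> by (simp add: K_def)
  ultimately show ?thesis using that unfolding R_def by blast
qed


text \<open>In the second-order expansion at 1 the linear term has mean zero, and the quadratic term
  contributes \<open>- a * (1 - a) / 2 * (cosh v - 1)\<close>, that is
  \<open>(a^2 - a) / 4 * v^2\<close> to leading order. The error is put into the exponent so that it
  adds up over the coordinates of a block, and \<open>v0\<close> serves all \<open>e\<close> and
  \<open>m\<close> at once.\<close>

lemma lr1_powr_moment:
  fixes a \<eta> :: real
  assumes a: "0 < a" "a < 1" and \<eta>: "\<eta> > 0"
  obtains v0 where "v0 > 0"
    "\<And>e m. e > 0 \<Longrightarrow> m\<^sup>2 / e\<^sup>2 \<le> v0 \<Longrightarrow> 
      integrable (density lborel (normal_density 0 e)) (\<lambda>x. lr1 e m x powr a)"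
    "\<And>e m. e > 0 \<Longrightarrow> m\<^sup>2 / e\<^sup>2 \<le> v0 \<Longrightarrow>
      exp (((a\<^sup>2 - a) / 4 - \<eta>) * (m\<^sup>2 / e\<^sup>2)\<^sup>2) \<le> (\<integral>x. lr1 e m x powr a \<partial>density lborel (normal_density 0 e))"
    "\<And>e m. e > 0 \<Longrightarrow> m\<^sup>2 / e\<^sup>2 \<le> v0 \<Longrightarrow>
      (\<integral>x. lr1 e m x powr a \<partial>density lborel (normal_density 0 e)) \<le> exp (((a\<^sup>2 - a) / 4 + \<eta>) * (m\<^sup>2 / e\<^sup>2)\<^sup>2)"
proof -
  define m4 where "m4 v = (exp (6 * v) + 4 + 3 * exp (- 2 * v)) / 8 - (exp (3 * v) + 3 * exp (- v)) + 6 * cosh v - 3"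
    for v :: real
  define b where "b = a * (1 - a) / 2"
  have b: "b > 0" using a by (simp add: b_def)
  \<comment> \<open>One \<open>\<zeta>\<close> pays for the Taylor remainder and the limits in
    \<open>v\<close>; the other three are left for passing from \<open>1 + y\<close> to
    \<open>exp y\<close>.\<close>
  define \<zeta> where "\<zeta> = \<eta> / 4"
  obtain K where K: "K \<ge> 0" "\<And>x. x > 0 \<Longrightarrow>
    \<bar>x powr a - 1 - a * (x - 1) + b * (x - 1)\<^sup>2\<bar> \<le> \<zeta> * (x - 1)\<^sup>2 + K * (x - 1) ^ 4"
    using powr_second_order[OF a, of \<zeta>] \<eta> unfolding \<zeta>_def b_def by (metis divide_pos_pos zero_less_numeral)
  have c2: "((\<lambda>v::real. (cosh v - 1) / v\<^sup>2) \<longlongrightarrow> 1 / 2) (at_right 0)"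
    by (real_asymp simp: cosh_field_def)
  have c4: "((\<lambda>v. m4 v / v\<^sup>2) \<longlongrightarrow> 0) (at_right 0)"
    unfolding m4_def by (real_asymp simp: cosh_field_def)
  have l2: "((\<lambda>v. (\<zeta> - b) * (cosh v - 1) / v\<^sup>2 + K * m4 v / v\<^sup>2) \<longlongrightarrow> (\<zeta> - b) / 2) (at_right 0)"
    using tendsto_add[OF tendsto_mult_left[OF c2, of "\<zeta> - b"] tendsto_mult_left[OF c4, of K]] by simp
  have l1': "((\<lambda>v. (- b - \<zeta>) * (cosh v - 1) / v\<^sup>2 - K * m4 v / v\<^sup>2) \<longlongrightarrow> (- b - \<zeta>) / 2) (at_right 0)"
    using tendsto_diff[OF tendsto_mult_left[OF c2, of "- b - \<zeta>"] tendsto_mult_left[OF c4, of K]] by simp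
  \<comment> \<open>\<open>1 + y \<le> exp y\<close> suffices for the upper estimate but points the
    wrong way for the lower one; there the reserve \<open>3 * \<zeta>\<close> makes the reversed
    inequality true for small \<open>v\<close>.\<close>
  have "((\<lambda>v. (1 + x * v\<^sup>2 - exp (y * v\<^sup>2)) / v\<^sup>2) \<longlongrightarrow> x - y) (at_right 0)" for x y :: real
    by real_asymp
  from this[of "- b / 2 - \<zeta>" "- b / 2 - \<eta>"]
  have l3: "((\<lambda>v. (1 + (- b / 2 - \<zeta>) * v\<^sup>2 - exp ((- b / 2 - \<eta>) * v\<^sup>2)) / v\<^sup>2) \<longlongrightarrow> 3 * \<zeta>) (at_right 0)"
    by (simp add: \<zeta>_def)
  have "eventually (\<lambda>v. (\<zeta> - b) * (cosh v - 1) / v\<^sup>2 + K * m4 v / v\<^sup>2 < - b / 2 + \<zeta> \<and>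
      (- b - \<zeta>) * (cosh v - 1) / v\<^sup>2 - K * m4 v / v\<^sup>2 > - b / 2 - \<zeta> \<and>
      (1 + (- b / 2 - \<zeta>) * v\<^sup>2 - exp ((- b / 2 - \<eta>) * v\<^sup>2)) / v\<^sup>2 > 0) (at_right 0)"
    using \<eta> by (intro eventually_conj order_tendstoD(2)[OF l2] order_tendstoD(1)[OF l1'] order_tendstoD(1)[OF l3])
      (auto simp: \<zeta>_def field_simps)
  then obtain w where w: "w > 0" "\<And>v. 0 < v \<Longrightarrow> v < w \<Longrightarrow> (\<zeta> - b) * (cosh v - 1) / v\<^sup>2 + K * m4 v / v\<^sup>2 < - b / 2 + \<zeta>"
     "\<And>v. 0 < v \<Longrightarrow> v < w \<Longrightarrow> (- b - \<zeta>) * (cosh v - 1) / v\<^sup>2 - K * m4 v / v\<^sup>2 > - b / 2 - \<zeta>"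
     "\<And>v. 0 < v \<Longrightarrow> v < w \<Longrightarrow> (1 + (- b / 2 - \<zeta>) * v\<^sup>2 - exp ((- b / 2 - \<eta>) * v\<^sup>2)) / v\<^sup>2 > 0"
    unfolding eventually_at_right_field by auto
  have main: "integrable (density lborel (normal_density 0 e)) (\<lambda>x. lr1 e m x powr a) \<and>
     exp (((a\<^sup>2 - a) / 4 - \<eta>) * (m\<^sup>2 / e\<^sup>2)\<^sup>2) \<le> (\<integral>x. lr1 e m x powr a \<partial>density lborel (normal_density 0 e)) \<and>
     (\<integral>x. lr1 e m x powr a \<partial>density lborel (normal_density 0 e)) \<le> exp (((a\<^sup>2 - a) / 4 + \<eta>) * (m\<^sup>2 / e\<^sup>2)\<^sup>2)"
    if e: "e > 0" and mv: "m\<^sup>2 / e\<^sup>2 \<le> w / 2" for e m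
  proof -
    define v where "v = m\<^sup>2 / e\<^sup>2"
    define N where "N = density lborel (normal_density 0 e)"
    interpret N: prob_space N unfolding N_def using e by (rule prob_space_normal_density)
    note mom = lr1_moments[OF e, of m, folded N_def v_def, folded m4_def]
    define Y where "Y = lr1 e m"
    note mom = mom[folded Y_def]
    have Ypos: "Y x > 0" for x by (simp add: Y_def)
    have [measurable]: "Y \<in> borel_measurable N" unfolding Y_def N_def by simp
    have int: "integrable N (\<lambda>x. Y x powr a)"
    proof (rule Bochner_Integration.integrable_bound)
      show "integrable N (\<lambda>x. 1 + Y x)" using mom by simp
      show "AE x in N. norm (Y x powr a) \<le> norm (1 + Y x)"
        using powr_le_one_plus[OF Ypos] Ypos a by (auto intro!: AE_I2 simp: less_imp_le add_nonneg_nonneg)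
    qed simp
    define Z where "Z = (\<integral>x. Y x powr a \<partial>N)"
    have "Z \<le> (\<integral>x. 1 + a * (Y x - 1) + (\<zeta> - b) * (Y x - 1)\<^sup>2 + K * (Y x - 1)^4 \<partial>N)"
      unfolding Z_def
    proof (rule integral_mono[OF int])
      show "integrable N (\<lambda>x. 1 + a * (Y x - 1) + (\<zeta> - b) * (Y x - 1)\<^sup>2 + K * (Y x - 1)^4)"
        using mom by simp
      show "Y x powr a \<le> 1 + a * (Y x - 1) + (\<zeta> - b) * (Y x - 1)\<^sup>2 + K * (Y x - 1)^4" for x
        using K(2)[OF Ypos[of x]] by (simp add: algebra_simps abs_le_iff)
    qed
    also have "\<dots> = 1 + (\<zeta> - b) * (cosh v - 1) + K * m4 v"
      using mom by (simp add: N.prob_space)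
    finally have up: "Z \<le> 1 + (\<zeta> - b) * (cosh v - 1) + K * m4 v" .
    have "(\<integral>x. 1 + a * (Y x - 1) + (- \<zeta> - b) * (Y x - 1)\<^sup>2 - K * (Y x - 1)^4 \<partial>N) \<le> Z"
      unfolding Z_def
    proof (rule integral_mono[OF _ int])
      show "integrable N (\<lambda>x. 1 + a * (Y x - 1) + (- \<zeta> - b) * (Y x - 1)\<^sup>2 - K * (Y x - 1)^4)"
        using mom by simp
      show "1 + a * (Y x - 1) + (- \<zeta> - b) * (Y x - 1)\<^sup>2 - K * (Y x - 1)^4 \<le> Y x powr a" for x
        using K(2)[OF Ypos[of x]] by (simp add: algebra_simps abs_le_iff)
    qed
    moreover have "(\<integral>x. 1 + a * (Y x - 1) + (- \<zeta> - b) * (Y x - 1)\<^sup>2 - K * (Y x - 1)^4 \<partial>N)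
       = 1 + (- \<zeta> - b) * (cosh v - 1) - K * m4 v"
      using mom by (simp add: N.prob_space)
    ultimately have lo: "1 + (- b - \<zeta>) * (cosh v - 1) - K * m4 v \<le> Z" by (simp add: algebra_simps)
    have "exp ((- b / 2 - \<eta>) * v\<^sup>2) \<le> Z \<and> Z \<le> exp ((- b / 2 + \<eta>) * v\<^sup>2)"
    proof (cases "v = 0")
      case True
      then show ?thesis using up lo by (simp add: m4_def)
    next
      case False
      moreover have "0 \<le> v" "v \<le> w / 2" using mv by (simp_all add: v_def)
      ultimately have v: "0 < v" "v < w" using w(1) by linarith+
      have "(\<zeta> - b) * (cosh v - 1) + K * m4 v < (- b / 2 + \<zeta>) * v\<^sup>2"
        using w(2)[OF v] v by (simp add: pos_divide_less_eq flip: add_divide_distrib)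
      then have "Z \<le> 1 + (- b / 2 + \<zeta>) * v\<^sup>2" using up by linarith
      also have "\<dots> \<le> exp ((- b / 2 + \<zeta>) * v\<^sup>2)" by (rule exp_ge_add_one_self)
      also have "\<dots> \<le> exp ((- b / 2 + \<eta>) * v\<^sup>2)" using \<eta> by (auto simp: \<zeta>_def intro!: mult_right_mono)
      finally have 1: "Z \<le> exp ((- b / 2 + \<eta>) * v\<^sup>2)" .
      have "(- b - \<zeta>) * (cosh v - 1) - K * m4 v > (- b / 2 - \<zeta>) * v\<^sup>2"
        using w(3)[OF v] v by (simp add: pos_less_divide_eq flip: diff_divide_distrib)
      moreover have "1 + (- b / 2 - \<zeta>) * v\<^sup>2 > exp ((- b / 2 - \<eta>) * v\<^sup>2)"
        using w(4)[OF v] v by (simp add: zero_less_divide_iff)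
      ultimately show ?thesis using lo 1 by linarith
    qed
    moreover have ab: "(a\<^sup>2 - a) / 4 = - b / 2" by (simp add: b_def field_simps power2_eq_square)
    ultimately show ?thesis using int unfolding ab Z_def Y_def N_def v_def by blast
  qed
  show ?thesis by (rule that[of "w / 2"]) (use main w in auto)
qed

section \<open>Tails of the block likelihood ratio\<close>

text \<open>The infimum of the levels at which the distribution function reaches 1/2 works: right
  continuity gives one inequality and the left limit the other, so atoms cause no trouble.\<close>

lemma (in prob_space) median_exists:
  fixes X :: "'a \<Rightarrow> real"
  assumes [measurable]: "random_variable borel X"
  obtains t where "prob {x\<in>space M. X x \<ge> t} \<ge> 1 / 2" "prob {x\<in>space M. X x \<le> t} \<ge> 1 / 2"
proof -
  define D where "D = distr M borel X"
  interpret D: real_distribution D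
    unfolding D_def by (rule real_distribution_distr) fact
  define S where "S = {t. cdf D t \<ge> 1 / 2}"
  have "eventually (\<lambda>t. cdf D t > 1 / 2) at_top"
    by (rule order_tendstoD(1)[OF D.cdf_lim_at_top_prob]) simp
  then obtain t1 where "cdf D t1 > 1 / 2" unfolding eventually_at_top_linorder by blast
  then have t1: "t1 \<in> S" by (simp add: S_def)
  have "eventually (\<lambda>t. cdf D t < 1 / 2) at_bot"
    by (rule order_tendstoD(2)[OF D.cdf_lim_at_bot]) simp
  then obtain t0 where t0: "\<And>t. t \<le> t0 \<Longrightarrow> cdf D t < 1 / 2" unfolding eventually_at_bot_linorder by blast
  have bdd: "bdd_below S"
  proof (rule bdd_belowI)
    fix u assume "u \<in> S"
    then have "\<not> cdf D u < 1 / 2" by (simp add: S_def)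
    then show "t0 \<le> u" using t0[of u] by linarith
  qed
  define t where "t = Inf S"
  have up: "cdf D u \<ge> 1 / 2" if ut: "u > t" for u
  proof -
    obtain y where "y \<in> S" "y < u" using cInf_lessD[of S u] ut t1 unfolding t_def by auto
    then show ?thesis using D.cdf_nondecreasing[of y u] by (auto simp: S_def)
  qed
  have "cdf D t \<ge> 1 / 2"
  proof (rule tendsto_lowerbound)
    show "(cdf D \<longlongrightarrow> cdf D t) (at_right t)" using D.cdf_is_right_cont[of t] by (simp add: continuous_within)
    show "eventually (\<lambda>u. 1 / 2 \<le> cdf D u) (at_right t)"
      using up by (auto simp: eventually_at_right_field intro!: exI[of _ "t + 1"])
  qed simp
  moreover have "measure D {..<t} \<le> 1 / 2"
  proof (rule tendsto_upperbound)
    show "(cdf D \<longlongrightarrow> measure D {..<t}) (at_left t)" by (rule D.cdf_at_left)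
    have "cdf D u \<le> 1 / 2" if "u < t" for u
      using that cInf_lower[OF _ bdd, of u] unfolding t_def S_def by fastforce
    then show "eventually (\<lambda>u. cdf D u \<le> 1 / 2) (at_left t)"
      by (auto simp: eventually_at_left_field intro!: exI[of _ "t - 1"])
  qed simp
  moreover have "prob {x\<in>space M. X x \<ge> t} = 1 - measure D {..<t}"
  proof -
    have "{x\<in>space M. X x \<ge> t} = space M - {x\<in>space M. X x < t}" by auto
    then have "prob {x\<in>space M. X x \<ge> t} = 1 - prob {x\<in>space M. X x < t}"
      by (simp add: prob_compl)
    also have "prob {x\<in>space M. X x < t} = measure D {..<t}"
      unfolding D_def by (subst measure_distr) (auto intro!: arg_cong[where f=prob])
    finally show ?thesis .
  qed
  moreover have "prob {x\<in>space M. X x \<le> t} = cdf D t"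
    unfolding D_def cdf_def by (subst measure_distr) (auto intro!: arg_cong[where f=prob])
  ultimately show ?thesis by (intro that[of t]) auto
qed

text \<open>The threshold \<open>t\<close> is a median of \<open>Y\<close> under the tilted law with density proportional to \<open>Y powr a\<close>;
  the two moment hypotheses confine that law to \<open>exp (m - w) \<le> Y \<le> exp (m + w)\<close> up to mass 1/4 on each side.\<close>

lemma (in prob_space) tilted_tails:
  fixes Y :: "'a \<Rightarrow> real" and a h m w :: real
  assumes Y[measurable]: "random_variable borel Y" and pos: "\<And>x. Y x > 0" and int: "integrable M Y"
    and a: "0 < h" "0 < a - h" "a + h < 1"
    and up: "(\<integral>x. Y x powr (a + h) \<partial>M) \<le> exp (h * (m + w)) * (\<integral>x. Y x powr a \<partial>M) / 4"
    and lo: "(\<integral>x. Y x powr (a - h) \<partial>M) \<le> exp (- (h * (m - w))) * (\<integral>x. Y x powr a \<partial>M) / 4"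
  obtains t where "prob {x\<in>space M. Y x \<ge> t} \<ge> (\<integral>x. Y x powr a \<partial>M) * exp (- (a * (m + w))) / 4"
    "(\<integral>x. Y x * indicator {..t} (Y x) \<partial>M) \<ge> (\<integral>x. Y x powr a \<partial>M) * exp ((1 - a) * (m - w)) / 4"
proof -
  define z where "z = (\<integral>x. Y x powr a \<partial>M)"
  have ip: "integrable M (\<lambda>x. Y x powr b)" if "0 \<le> b" "b \<le> 1" for b
  proof (rule Bochner_Integration.integrable_bound)
    show "integrable M (\<lambda>x. 1 + Y x)" using int by simp
    show "AE x in M. norm (Y x powr b) \<le> norm (1 + Y x)"
      using powr_le_one_plus[OF pos that] pos by (auto intro!: AE_I2 simp: less_imp_le add_nonneg_nonneg)
  qed simp
  have ia: "integrable M (\<lambda>x. Y x powr a)" using a by (intro ip) auto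
  have ind: "integrable M (\<lambda>x. f x * indicator B (Y x))" if "integrable M f" "B \<in> sets borel" for f :: "'a \<Rightarrow> real" and B
    using integrable_real_mult_indicator[OF _ that(1), of "{x\<in>space M. Y x \<in> B}"] that(2)
    by (auto simp: indicator_def mult.commute cong: Bochner_Integration.integrable_cong)
  have zpos: "z > 0"
  proof -
    have "z \<noteq> 0"
    proof
      assume "z = 0"
      then have "AE x in M. Y x powr a = 0"
        unfolding z_def using integral_nonneg_eq_0_iff_AE[OF ia] by auto
      then have "AE x in M. False" using pos by (auto simp: powr_def less_le)
      then show False by simp
    qed
    moreover have "z \<ge> 0" unfolding z_def by simp
    ultimately show ?thesis by simp
  qed
  define Q where "Q = density M (\<lambda>x. ennreal (Y x powr a / z))"
  have Qm: "measure Q {x\<in>space M. Y x \<in> B} = (\<integral>x. Y x powr a * indicator B (Y x) \<partial>M) / z" 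
    if B[measurable]: "B \<in> sets borel" for B
  proof -
    have "emeasure Q {x\<in>space M. Y x \<in> B} = (\<integral>\<^sup>+x. ennreal (Y x powr a * indicator B (Y x) / z) \<partial>M)"
      unfolding Q_def using zpos by (subst emeasure_density)
        (auto intro!: nn_integral_cong simp: indicator_def split: if_splits)
    also have "\<dots> = ennreal (\<integral>x. Y x powr a * indicator B (Y x) / z \<partial>M)"
      using zpos ind[OF ia B] by (intro nn_integral_eq_integral) auto
    finally show ?thesis using zpos by (simp add: measure_def)
  qed
  have "prob_space Q"
  proof
    have "emeasure Q (space Q) = (\<integral>\<^sup>+x. ennreal (Y x powr a / z) \<partial>M)"
      unfolding Q_def by (subst emeasure_density) (auto intro!: nn_integral_cong)
    also have "\<dots> = ennreal (\<integral>x. Y x powr a / z \<partial>M)"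
      using zpos ia by (intro nn_integral_eq_integral) auto
    finally show "emeasure Q (space Q) = 1" using zpos by (simp add: z_def[symmetric])
  qed
  then interpret Q: prob_space Q .
  have [simp]: "space Q = space M" by (simp add: Q_def)
  have "Y \<in> borel_measurable Q" by (simp add: Q_def)
  then obtain t where t: "Q.prob {x\<in>space M. Y x \<in> {t..}} \<ge> 1 / 2" "Q.prob {x\<in>space M. Y x \<in> {..t}} \<ge> 1 / 2"
    using Q.median_exists[of Y] by auto
  have t1: "(\<integral>x. Y x powr a * indicator {t..} (Y x) \<partial>M) \<ge> z / 2"
    using t(1) zpos by (subst (asm) Qm) (auto simp: field_simps)
  have t2: "(\<integral>x. Y x powr a * indicator {..t} (Y x) \<partial>M) \<ge> z / 2"
    using t(2) zpos by (subst (asm) Qm) (auto simp: field_simps)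
  \<comment> \<open>Markov's inequality for \<open>Y powr h\<close> under the tilted law; the lower
    tail below uses \<open>Y powr (- h)\<close> in the same way.\<close>
  have u: "(\<integral>x. Y x powr a * indicator {exp (m + w)<..} (Y x) \<partial>M) \<le> z / 4"
  proof -
    have "(\<integral>x. Y x powr a * indicator {exp (m + w)<..} (Y x) \<partial>M) \<le> (\<integral>x. exp (- (h * (m + w))) * Y x powr (a + h) \<partial>M)"
    proof (rule integral_mono[OF ind[OF ia]])
      show "integrable M (\<lambda>x. exp (- (h * (m + w))) * Y x powr (a + h))" using a by (intro integrable_mult_right ip) auto
      show "Y x powr a * indicator {exp (m + w)<..} (Y x) \<le> exp (- (h * (m + w))) * Y x powr (a + h)" for x
      proof (cases "Y x > exp (m + w)")
        case True
        then have "exp (m + w) powr h \<le> Y x powr h" using a by (intro powr_mono2) auto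
        then have "exp (h * (m + w)) \<le> Y x powr h" by (simp add: powr_def[of "exp (m + w)"])
        then have "exp (- (h * (m + w))) * exp (h * (m + w)) \<le> exp (- (h * (m + w))) * Y x powr h"
          by (rule mult_left_mono) simp
        then have "1 \<le> exp (- (h * (m + w))) * Y x powr h" by (simp add: exp_add[symmetric])
        then have "Y x powr a * 1 \<le> Y x powr a * (exp (- (h * (m + w))) * Y x powr h)"
          by (rule mult_left_mono) simp
        then show ?thesis using True by (simp add: powr_add mult_ac)
      qed simp
    qed simp
    also have "\<dots> = exp (- (h * (m + w))) * (\<integral>x. Y x powr (a + h) \<partial>M)" by simp
    also have "\<dots> \<le> exp (- (h * (m + w))) * (exp (h * (m + w)) * z / 4)"
      using up unfolding z_def by (intro mult_left_mono) auto
    also have "\<dots> = z / 4" by (simp add: mult.assoc[symmetric] exp_add[symmetric])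
    finally show ?thesis .
  qed
  have l: "(\<integral>x. Y x powr a * indicator {..<exp (m - w)} (Y x) \<partial>M) \<le> z / 4"
  proof -
    have "(\<integral>x. Y x powr a * indicator {..<exp (m - w)} (Y x) \<partial>M) \<le> (\<integral>x. exp (h * (m - w)) * Y x powr (a - h) \<partial>M)"
    proof (rule integral_mono[OF ind[OF ia]])
      show "integrable M (\<lambda>x. exp (h * (m - w)) * Y x powr (a - h))" using a by (intro integrable_mult_right ip) auto
      show "Y x powr a * indicator {..<exp (m - w)} (Y x) \<le> exp (h * (m - w)) * Y x powr (a - h)" for x
      proof (cases "Y x < exp (m - w)")
        case True
        then have "Y x powr h \<le> exp (m - w) powr h" using a pos[of x] by (intro powr_mono2) auto
        then have "Y x powr h \<le> exp (h * (m - w))" by (simp add: powr_def)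
        then have "Y x powr (a - h) * Y x powr h \<le> Y x powr (a - h) * exp (h * (m - w))"
          by (rule mult_left_mono) simp
        then show ?thesis using True by (simp add: powr_add[symmetric] mult_ac)
      qed simp
    qed simp
    also have "\<dots> = exp (h * (m - w)) * (\<integral>x. Y x powr (a - h) \<partial>M)" by simp
    also have "\<dots> \<le> exp (h * (m - w)) * (exp (- (h * (m - w))) * z / 4)"
      using lo unfolding z_def by (intro mult_left_mono) auto
    also have "\<dots> = z / 4" by (simp add: mult.assoc[symmetric] exp_add[symmetric])
    finally show ?thesis .
  qed
  \<comment> \<open>The event \<open>t \<le> Y \<le> exp (m + w)\<close> keeps tilted mass at least
    1/2 - 1/4. On it the unnormalised density \<open>Y powr a\<close> is at most
    \<open>exp (a * (m + w))\<close>, so dividing it out bounds the probability under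
    \<open>M\<close> from below.\<close>
  have "z / 4 \<le> (\<integral>x. Y x powr a * indicator {t..} (Y x) - Y x powr a * indicator {exp (m + w)<..} (Y x) \<partial>M)"
    using t1 u by (subst Bochner_Integration.integral_diff) (auto intro!: ind ia)
  also have "\<dots> \<le> (\<integral>x. exp (a * (m + w)) * indicator {t..} (Y x) \<partial>M)"
  proof (rule integral_mono)
    show "integrable M (\<lambda>x. Y x powr a * indicator {t..} (Y x) - Y x powr a * indicator {exp (m + w)<..} (Y x))"
      by (intro Bochner_Integration.integrable_diff ind ia) auto
    show "integrable M (\<lambda>x. exp (a * (m + w)) * indicator {t..} (Y x))" by (intro ind) auto
    fix x
    show "Y x powr a * indicator {t..} (Y x) - Y x powr a * indicator {exp (m + w)<..} (Y x)
      \<le> exp (a * (m + w)) * indicator {t..} (Y x)"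
    proof (cases "Y x > exp (m + w)")
      case False
      then have "Y x powr a \<le> exp (m + w) powr a" using a pos[of x] by (intro powr_mono2) auto
      then show ?thesis using False by (auto simp: powr_def indicator_def)
    qed (auto simp: indicator_def)
  qed
  also have "\<dots> = exp (a * (m + w)) * (\<integral>x. indicator {x\<in>space M. Y x \<ge> t} x \<partial>M)"
    by (subst integral_mult_right_zero, intro arg_cong2[where f="(*)"] refl Bochner_Integration.integral_cong)
       (auto simp: indicator_def)
  also have "\<dots> = exp (a * (m + w)) * prob {x\<in>space M. Y x \<ge> t}" by simp
  finally have "z / 4 * exp (- (a * (m + w))) \<le> exp (a * (m + w)) * prob {x\<in>space M. Y x \<ge> t} * exp (- (a * (m + w)))"
    by (rule mult_right_mono) simp
  also have "\<dots> = prob {x\<in>space M. Y x \<ge> t}" by (simp add: exp_minus)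
  finally have r1: "z * exp (- (a * (m + w))) / 4 \<le> prob {x\<in>space M. Y x \<ge> t}" by simp
  have iYt: "integrable M (\<lambda>x. Y x * indicator {..t} (Y x))" by (intro ind int) auto
  \<comment> \<open>The same exchange towards the law with density \<open>Y\<close>: the conversion
    factor \<open>Y powr (a - 1)\<close> is decreasing, hence largest at the lower end
    \<open>exp (m - w)\<close>.\<close>
  have "z / 4 \<le> (\<integral>x. Y x powr a * indicator {..t} (Y x) - Y x powr a * indicator {..<exp (m - w)} (Y x) \<partial>M)"
    using t2 l by (subst Bochner_Integration.integral_diff) (auto intro!: ind ia)
  also have "\<dots> \<le> (\<integral>x. exp ((a - 1) * (m - w)) * (Y x * indicator {..t} (Y x)) \<partial>M)"
  proof (rule integral_mono)
    show "integrable M (\<lambda>x. Y x powr a * indicator {..t} (Y x) - Y x powr a * indicator {..<exp (m - w)} (Y x))"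
      by (intro Bochner_Integration.integrable_diff ind ia) auto
    show "integrable M (\<lambda>x. exp ((a - 1) * (m - w)) * (Y x * indicator {..t} (Y x)))" using iYt by simp
    fix x
    show "Y x powr a * indicator {..t} (Y x) - Y x powr a * indicator {..<exp (m - w)} (Y x)
      \<le> exp ((a - 1) * (m - w)) * (Y x * indicator {..t} (Y x))"
    proof (cases "Y x < exp (m - w)")
      case False
      then have "Y x powr (a - 1) \<le> exp (m - w) powr (a - 1)" using a by (intro powr_mono2') auto
      then have "Y x * Y x powr (a - 1) \<le> Y x * exp ((a - 1) * (m - w))" 
        using pos[of x] by (intro mult_left_mono) (auto simp: powr_def)
      then have "Y x powr a \<le> exp ((a - 1) * (m - w)) * Y x" 
        using pos[of x] by (simp add: powr_diff mult_ac)
      then show ?thesis using False by (auto simp: indicator_def)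
    qed (use pos[of x] in \<open>auto simp: indicator_def less_imp_le\<close>)
  qed
  also have "\<dots> = exp ((a - 1) * (m - w)) * (\<integral>x. Y x * indicator {..t} (Y x) \<partial>M)" by simp
  finally have "z / 4 * exp ((1 - a) * (m - w)) \<le> 
      exp ((a - 1) * (m - w)) * (\<integral>x. Y x * indicator {..t} (Y x) \<partial>M) * exp ((1 - a) * (m - w))"
    by (rule mult_right_mono) simp
  also have "\<dots> = (\<integral>x. Y x * indicator {..t} (Y x) \<partial>M) * (exp ((a - 1) * (m - w)) * exp ((1 - a) * (m - w)))" by simp
  also have "exp ((a - 1) * (m - w)) * exp ((1 - a) * (m - w)) = 1"
    by (simp add: exp_add[symmetric] ring_distribs[symmetric])
  finally have r2: "z * exp ((1 - a) * (m - w)) / 4 \<le> (\<integral>x. Y x * indicator {..t} (Y x) \<partial>M)" by simp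
  show ?thesis using that r1 r2 unfolding z_def by blast
qed

lemma lr_product_density:
  fixes m :: "'i \<Rightarrow> real"
  assumes "\<epsilon> > 0" "finite F"
  defines "B \<equiv> PiM F (\<lambda>_. density lborel (normal_density 0 \<epsilon>))"
  shows "prob_space B" "integrable B (\<lambda>y. \<Prod>l\<in>F. lr1 \<epsilon> (m l) (y l))" "(\<integral>y. (\<Prod>l\<in>F. lr1 \<epsilon> (m l) (y l)) \<partial>B) = 1"
proof -
  interpret N: prob_space "density lborel (normal_density 0 \<epsilon>)" using assms(1) by (rule prob_space_normal_density)
  interpret PP: product_sigma_finite "\<lambda>_::'i. density lborel (normal_density 0 \<epsilon>)" by unfold_locales
  show "prob_space B" unfolding B_def by (rule prob_space_PiM) (rule N.prob_space_axioms)
  note i = lr1_moments(1)[OF assms(1)]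
  show "integrable B (\<lambda>y. \<Prod>l\<in>F. lr1 \<epsilon> (m l) (y l))" unfolding B_def by (rule PP.product_integrable_prod[OF assms(2) i])
  have "(\<integral>y. (\<Prod>l\<in>F. lr1 \<epsilon> (m l) (y l)) \<partial>B) = (\<Prod>l\<in>F. integral\<^sup>L (density lborel (normal_density 0 \<epsilon>)) (lr1 \<epsilon> (m l)))"
    unfolding B_def by (rule PP.product_integral_prod[OF assms(2) i])
  then show "(\<integral>y. (\<Prod>l\<in>F. lr1 \<epsilon> (m l) (y l)) \<partial>B) = 1" using lr1_moments(2)[OF assms(1)] by simp
qed

text \<open>Over independent coordinates the log-moments add up to \<open>(b^2 - b) / 2 * A\<close>,
  those of a normal variable with mean \<open>- A / 2\<close> and variance \<open>A\<close>. The
  tilted law is therefore centred at \<open>(a - 1 / 2) * A\<close>, and completing the square gives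
  the two exponents. \<open>T\<close> will be the logarithm of the number of blocks, the scale on
  which errors are measured.\<close>

lemma lr_product_tails:
  fixes a C \<delta> :: real
  assumes a: "0 < a" "a < 1" and C: "C > 0" and \<delta>: "\<delta> > 0"
  obtains v0 T0 where "v0 > 0"
    "\<And>e F (m :: 'i \<Rightarrow> real) A T. e > 0 \<Longrightarrow> finite F \<Longrightarrow> (\<And>l. l \<in> F \<Longrightarrow> (m l)\<^sup>2 / e\<^sup>2 \<le> v0) \<Longrightarrow>
      A = (\<Sum>l\<in>F. ((m l)\<^sup>2 / e\<^sup>2)\<^sup>2) / 2 \<Longrightarrow> A \<le> C * T \<Longrightarrow> T \<ge> T0 \<Longrightarrow>
      \<exists>t. measure (PiM F (\<lambda>_. density lborel (normal_density 0 e)))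
            {x\<in>space (PiM F (\<lambda>_. density lborel (normal_density 0 e))). t \<le> (\<Prod>l\<in>F. lr1 e (m l) (x l))}
          \<ge> exp (- (a\<^sup>2 * A / 2) - 2 * \<delta> * T) / 4 \<and>
        (\<integral>x. (\<Prod>l\<in>F. lr1 e (m l) (x l)) * indicator {..t} (\<Prod>l\<in>F. lr1 e (m l) (x l)) 
            \<partial>PiM F (\<lambda>_. density lborel (normal_density 0 e)))
          \<ge> exp (- ((1 - a)\<^sup>2 * A / 2) - 2 * \<delta> * T) / 4"
proof -
  \<comment> \<open>The first bound gives \<open>A * h^2 / 2 \<le> h * \<delta> * T / 4\<close>, the
    second-order cost of a Chernoff step; the other two keep \<open>a - h\<close> and
    \<open>a + h\<close> inside (0, 1).\<close>
  define h where "h = Min {\<delta> / (2 * C), a / 2, (1 - a) / 2}"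
  have h: "h > 0" "h \<le> \<delta> / (2 * C)" "a - h > 0" "a + h < 1" "h < 1"
  proof -
    have "h \<le> \<delta> / (2 * C)" "h \<le> a / 2" "h \<le> (1 - a) / 2" unfolding h_def by (intro Min_le; simp)+
    moreover show "h > 0" using a C \<delta> unfolding h_def by simp
    ultimately show "h \<le> \<delta> / (2 * C)" "a - h > 0" "a + h < 1" "h < 1" using a by auto
  qed
  \<comment> \<open>Chosen so that the moment errors, at most \<open>4 * \<eta> * A\<close>, also
    stay below \<open>h * \<delta> * T / 4\<close>.\<close>
  define \<eta> where "\<eta> = h * \<delta> / (16 * C)"
  have \<eta>: "\<eta> > 0" using h C \<delta> by (simp add: \<eta>_def)
  define G where "G b v0 = (\<forall>e m. e > 0 \<longrightarrow> m\<^sup>2 / e\<^sup>2 \<le> v0 \<longrightarrow>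
      integrable (density lborel (normal_density 0 e)) (\<lambda>x. lr1 e m x powr b) \<and>
      exp (((b\<^sup>2 - b) / 4 - \<eta>) * (m\<^sup>2 / e\<^sup>2)\<^sup>2) \<le> (\<integral>x. lr1 e m x powr b \<partial>density lborel (normal_density 0 e)) \<and>
      (\<integral>x. lr1 e m x powr b \<partial>density lborel (normal_density 0 e)) \<le> exp (((b\<^sup>2 - b) / 4 + \<eta>) * (m\<^sup>2 / e\<^sup>2)\<^sup>2))"
    for b v0
  have ex: "\<exists>v0>0. G b v0" if "0 < b" "b < 1" for b
    using lr1_powr_moment[OF that \<eta>] unfolding G_def by metis
  obtain v1 v2 v3 where v: "v1 > 0" "G a v1" "v2 > 0" "G (a + h) v2" "v3 > 0" "G (a - h) v3"
    using ex[of a] ex[of "a + h"] ex[of "a - h"] a h by auto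
  define v0 where "v0 = Min {v1, v2, v3}"
  have v0: "v0 > 0" "v0 \<le> v1" "v0 \<le> v2" "v0 \<le> v3" using v by (auto simp: v0_def)
  \<comment> \<open>The window \<open>w = \<delta> * T\<close> gains \<open>h * \<delta> * T\<close>
    in the exponent and the two errors spend at most half of it; for \<open>T \<ge> T0\<close> the
    rest exceeds \<open>ln 4\<close>, the factor 1/4 required by
    \<open>tilted_tails\<close>.\<close>
  define T0 where "T0 = 2 * ln 4 / (h * \<delta>)"
  have T0: "exp (- (T * (h * \<delta> / 2))) \<le> 1 / 4" if "T \<ge> T0" for T
  proof -
    have "T * (h * \<delta> / 2) \<ge> ln 4" using that h \<delta> by (simp add: T0_def field_simps)
    then have "exp (- (T * (h * \<delta> / 2))) \<le> exp (- ln 4)" by simp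
    then show ?thesis by (simp add: exp_minus)
  qed
  have T0_pos: "T0 > 0" using h \<delta> by (simp add: T0_def)
  have main: "\<exists>t. measure (PiM F (\<lambda>_. density lborel (normal_density 0 e)))
            {x\<in>space (PiM F (\<lambda>_. density lborel (normal_density 0 e))). t \<le> (\<Prod>l\<in>F. lr1 e (m l) (x l))}
          \<ge> exp (- (a\<^sup>2 * A / 2) - 2 * \<delta> * T) / 4 \<and>
        (\<integral>x. (\<Prod>l\<in>F. lr1 e (m l) (x l)) * indicator {..t} (\<Prod>l\<in>F. lr1 e (m l) (x l)) 
            \<partial>PiM F (\<lambda>_. density lborel (normal_density 0 e)))
          \<ge> exp (- ((1 - a)\<^sup>2 * A / 2) - 2 * \<delta> * T) / 4"
    if e: "e > 0" and F: "finite F" and mv: "\<And>l. l \<in> F \<Longrightarrow> (m l)\<^sup>2 / e\<^sup>2 \<le> v0"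
      and A: "A = (\<Sum>l\<in>F. ((m l)\<^sup>2 / e\<^sup>2)\<^sup>2) / 2" "A \<le> C * T" and T: "T \<ge> T0" for e F A T and m :: "'i \<Rightarrow> real"
  proof -
    define N where "N = density lborel (normal_density 0 e)"
    interpret N: prob_space N unfolding N_def using e by (rule prob_space_normal_density)
    define P where "P = PiM F (\<lambda>_::'i. N)"
    interpret PP: product_sigma_finite "\<lambda>_::'i. N" by unfold_locales
    interpret P: prob_space P unfolding P_def by (rule prob_space_PiM) (rule N.prob_space_axioms)
    define Y where "Y x = (\<Prod>l\<in>F. lr1 e (m l) (x l))" for x
    have [measurable]: "Y \<in> borel_measurable P" unfolding Y_def P_def N_def by measurable
    have Ypos: "Y x > 0" for x unfolding Y_def by (simp add: prod_pos)
    have iY: "integrable P Y" unfolding Y_def P_def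
      using lr1_moments[OF e] by (intro PP.product_integrable_prod F) (auto simp: N_def)
    have A0: "A \<ge> 0" unfolding A by (simp add: sum_nonneg)
    have Tpos: "T > 0" using T T0_pos by simp
    have Z: "exp ((b\<^sup>2 - b) / 2 * A - 2 * \<eta> * A) \<le> (\<integral>x. Y x powr b \<partial>P) \<and>
        (\<integral>x. Y x powr b \<partial>P) \<le> exp ((b\<^sup>2 - b) / 2 * A + 2 * \<eta> * A)"
      if g: "G b v'" and v': "v0 \<le> v'" for b v'
    proof -
      have g': "integrable N (\<lambda>x. lr1 e (m l) x powr b)"
        "exp (((b\<^sup>2 - b) / 4 - \<eta>) * ((m l)\<^sup>2 / e\<^sup>2)\<^sup>2) \<le> (\<integral>x. lr1 e (m l) x powr b \<partial>N)"
        "(\<integral>x. lr1 e (m l) x powr b \<partial>N) \<le> exp (((b\<^sup>2 - b) / 4 + \<eta>) * ((m l)\<^sup>2 / e\<^sup>2)\<^sup>2)"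
        if "l \<in> F" for l using g e mv[OF that] v' unfolding G_def N_def by force+
      have "(\<integral>x. Y x powr b \<partial>P) = (\<integral>x. (\<Prod>l\<in>F. lr1 e (m l) (x l) powr b) \<partial>P)"
        unfolding Y_def by (simp add: prod_powr_distrib)
      also have "\<dots> = (\<Prod>l\<in>F. (\<integral>x. lr1 e (m l) x powr b \<partial>N))"
        unfolding P_def by (rule PP.product_integral_prod[OF F g'(1)])
      finally have eq: "(\<integral>x. Y x powr b \<partial>P) = (\<Prod>l\<in>F. (\<integral>x. lr1 e (m l) x powr b \<partial>N))" .
      have ex: "(\<Prod>l\<in>F. exp (c * ((m l)\<^sup>2 / e\<^sup>2)\<^sup>2)) = exp (c * 2 * A)" for c
        unfolding A(1) by (simp add: exp_sum[OF F, symmetric] sum_distrib_left[symmetric])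
      have "(\<Prod>l\<in>F. exp (((b\<^sup>2 - b) / 4 - \<eta>) * ((m l)\<^sup>2 / e\<^sup>2)\<^sup>2)) \<le> (\<integral>x. Y x powr b \<partial>P)"
        unfolding eq by (intro prod_mono conjI g') auto
      moreover have "(\<integral>x. Y x powr b \<partial>P) \<le> (\<Prod>l\<in>F. exp (((b\<^sup>2 - b) / 4 + \<eta>) * ((m l)\<^sup>2 / e\<^sup>2)\<^sup>2))"
        unfolding eq by (intro prod_mono conjI g') auto
      moreover have eqs: "((b\<^sup>2 - b) / 4 - \<eta>) * 2 * A = (b\<^sup>2 - b) / 2 * A - 2 * \<eta> * A"
        "((b\<^sup>2 - b) / 4 + \<eta>) * 2 * A = (b\<^sup>2 - b) / 2 * A + 2 * \<eta> * A"
        by (simp_all add: ring_distribs)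
      ultimately show ?thesis unfolding ex eqs by blast
    qed
    define z where "z = (\<integral>x. Y x powr a \<partial>P)"
    define mm w where "mm = A * (a - 1 / 2)" and "w = \<delta> * T"
    have \<eta>A: "4 * \<eta> * A \<le> h * \<delta> / 4 * T" 
    proof -
      have "4 * \<eta> * A \<le> 4 * \<eta> * (C * T)" using A(2) \<eta> by (intro mult_left_mono) auto
      also have "\<dots> = h * \<delta> / 4 * T" using C by (simp add: \<eta>_def field_simps)
      finally show ?thesis .
    qed
    have hA: "A * h\<^sup>2 / 2 \<le> h * \<delta> / 4 * T"
    proof -
      have "A * h\<^sup>2 / 2 \<le> (C * T) * h\<^sup>2 / 2" using A(2) by (intro divide_right_mono mult_right_mono) auto
      also have "\<dots> = (C * T * h / 2) * h" by (simp add: power2_eq_square)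
      also have "\<dots> \<le> (C * T * h / 2) * (\<delta> / (2 * C))" using h C Tpos by (intro mult_left_mono) auto
      also have "\<dots> = h * \<delta> / 4 * T" using C by (simp add: field_simps)
      finally show ?thesis .
    qed
    have Zs: "(\<integral>x. Y x powr (a + s * h) \<partial>P) \<le> exp (s * h * mm + h * w) * z / 4"
      if s: "s = 1 \<or> s = - 1" and g: "G (a + s * h) v'" "v0 \<le> v'" for s v' :: real
    proof -
      have s2: "s * s = 1" using s by auto
      have expand: "((a + s * h)\<^sup>2 - (a + s * h)) / 2 * A = (a\<^sup>2 - a) / 2 * A + s * h * mm + (s * s) * (A * h\<^sup>2 / 2)"
        unfolding mm_def by (simp add: field_simps power2_eq_square)
      have "((a + s * h)\<^sup>2 - (a + s * h)) / 2 * A + 2 * \<eta> * A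
        \<le> (s * h * mm + h * w) + ((a\<^sup>2 - a) / 2 * A - 2 * \<eta> * A) + (- (T * (h * \<delta> / 2)))"
      proof -
        define K where "K = h * \<delta> / 4 * T"
        have "h * w = 4 * K" "T * (h * \<delta> / 2) = 2 * K" "(s * s) * (A * h\<^sup>2 / 2) \<le> K" "2 * (2 * \<eta> * A) \<le> K"
          using \<eta>A hA s2 by (simp_all add: K_def w_def)
        with expand show ?thesis by linarith
      qed
      then have "exp (((a + s * h)\<^sup>2 - (a + s * h)) / 2 * A + 2 * \<eta> * A)
        \<le> exp ((s * h * mm + h * w) + ((a\<^sup>2 - a) / 2 * A - 2 * \<eta> * A) + (- (T * (h * \<delta> / 2))))" by simp
      also have "\<dots> = exp (s * h * mm + h * w) * exp ((a\<^sup>2 - a) / 2 * A - 2 * \<eta> * A) * exp (- (T * (h * \<delta> / 2)))"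
        by (simp only: exp_add)
      also have "\<dots> \<le> exp (s * h * mm + h * w) * z * (1 / 4)"
        using Z[OF v(2) v0(2)] T0[OF T] by (intro mult_mono mult_left_mono) (auto simp: z_def)
      finally show ?thesis using Z[OF g] by simp
    qed
    have up: "(\<integral>x. Y x powr (a + h) \<partial>P) \<le> exp (h * (mm + w)) * z / 4"
      using Zs[of 1 v2] v v0 by (simp add: ring_distribs)
    have lo: "(\<integral>x. Y x powr (a - h) \<partial>P) \<le> exp (- (h * (mm - w))) * z / 4"
      using Zs[of "-1" v3] v v0 by (simp add: ring_distribs)
    obtain t where t: "P.prob {x\<in>space P. Y x \<ge> t} \<ge> z * exp (- (a * (mm + w))) / 4"
      "(\<integral>x. Y x * indicator {..t} (Y x) \<partial>P) \<ge> z * exp ((1 - a) * (mm - w)) / 4"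
      using P.tilted_tails[of Y h a mm w] Ypos iY h up lo unfolding z_def by auto
    have zl: "exp ((a\<^sup>2 - a) / 2 * A - 2 * \<eta> * A) \<le> z" using Z[OF v(2) v0(2)] by (simp add: z_def)
    have aw: "a * w \<le> \<delta> * T" "(1 - a) * w \<le> \<delta> * T" "2 * \<eta> * A \<le> \<delta> * T"
    proof -
      have "w \<ge> 0" using \<delta> Tpos by (simp add: w_def)
      then show "a * w \<le> \<delta> * T" "(1 - a) * w \<le> \<delta> * T" 
        using a unfolding w_def by (auto intro!: mult_left_le_one_le)
      have "2 * \<eta> * A \<le> h * (\<delta> * T)" 
      proof -
        have "0 \<le> \<eta> * A" "0 \<le> h * (\<delta> * T)" using A0 \<eta> h \<delta> Tpos by simp_all
        moreover have "4 * (\<eta> * A) \<le> h * (\<delta> * T) / 4" using \<eta>A by simp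
        ultimately show ?thesis by linarith
      qed
      also have "\<dots> \<le> \<delta> * T" using h \<delta> Tpos by (intro mult_left_le_one_le) auto
      finally show "2 * \<eta> * A \<le> \<delta> * T" .
    qed
    have "- (a\<^sup>2 * A / 2) - 2 * \<delta> * T \<le> ((a\<^sup>2 - a) / 2 * A - 2 * \<eta> * A) + (- (a * (mm + w)))"
      using aw unfolding mm_def by (simp add: field_simps power2_eq_square)
    then have "exp (- (a\<^sup>2 * A / 2) - 2 * \<delta> * T) \<le> exp ((a\<^sup>2 - a) / 2 * A - 2 * \<eta> * A) * exp (- (a * (mm + w)))"
      by (simp only: exp_add[symmetric] exp_le_cancel_iff)
    also have "\<dots> \<le> z * exp (- (a * (mm + w)))" using zl by (intro mult_right_mono) auto
    finally have r1: "exp (- (a\<^sup>2 * A / 2) - 2 * \<delta> * T) / 4 \<le> P.prob {x\<in>space P. Y x \<ge> t}" using t(1) by simp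
    have "- ((1 - a)\<^sup>2 * A / 2) - 2 * \<delta> * T \<le> ((a\<^sup>2 - a) / 2 * A - 2 * \<eta> * A) + ((1 - a) * (mm - w))"
      using aw unfolding mm_def by (simp add: field_simps power2_eq_square)
    then have "exp (- ((1 - a)\<^sup>2 * A / 2) - 2 * \<delta> * T) \<le> exp ((a\<^sup>2 - a) / 2 * A - 2 * \<eta> * A) * exp ((1 - a) * (mm - w))"
      by (simp only: exp_add[symmetric] exp_le_cancel_iff)
    also have "\<dots> \<le> z * exp ((1 - a) * (mm - w))" using zl by (intro mult_right_mono) auto
    finally have r2: "exp (- ((1 - a)\<^sup>2 * A / 2) - 2 * \<delta> * T) / 4 \<le> (\<integral>x. Y x * indicator {..t} (Y x) \<partial>P)" using t(2) by simp
    show ?thesis using r1 r2 unfolding Y_def P_def N_def by blast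
  qed
  show ?thesis by (rule that[of v0 T0]) (use v0 main in blast)+
qed

section \<open>Flat near-minimisers\<close>

text \<open>Here \<open>e\<close> stands for the squares of a near-minimiser, which may have a few large entries. They are capped
  at \<open>\<tau> * x\<close>, and the removed energy is spread evenly over the low-frequency set \<open>P\<close>. The slack in the
  constraint \<open>\<Sum> c l * e l \<le> 1\<close> needed for this is gained by moving the fraction \<open>\<kappa>\<close> of the energy above
  level \<open>8 * c0\<close> to \<open>P\<close> as well: by Cauchy-Schwarz, at most half of the constraint is spent below that level.\<close>

lemma flatten_energy:
  fixes e c :: "'i \<Rightarrow> real" and x V \<tau> \<delta> c0 :: real
  assumes e: "\<And>l. e l \<ge> 0" and c: "\<And>l. c l \<ge> 0"
    and sce: "(\<lambda>l. c l * e l) summable_on Z" "(\<Sum>\<^sub>\<infinity>l\<in>Z. c l * e l) \<le> 1"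
    and se: "e summable_on Z"
    and se2: "(\<lambda>l. (e l)\<^sup>2) summable_on Z" "(\<Sum>\<^sub>\<infinity>l\<in>Z. (e l)\<^sup>2) \<le> V * x\<^sup>2"
    and P: "P \<subseteq> Z" "finite P" "P \<noteq> {}" "\<And>l. l \<in> P \<Longrightarrow> c l \<le> c0"
    and pos: "c0 > 0" "x > 0" "V > 0" "\<tau> > 0" "\<delta> > 0"
    and fin: "finite {l\<in>Z. c l \<le> 8 * c0}"
    and cond: "8 * c0 * x * sqrt (real (card {l\<in>Z. c l \<le> 8 * c0}) * V) \<le> 1 / 2"
      "8 * c0 * x * V / \<tau> \<le> 1"
  obtains F e' where "finite F" "F \<subseteq> Z" "\<And>l. e' l \<ge> 0" "\<And>l. l \<notin> F \<Longrightarrow> e' l = 0"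
    "(\<Sum>l\<in>F. e' l) \<ge> (\<Sum>\<^sub>\<infinity>l\<in>Z. e l)" "(\<Sum>l\<in>F. c l * e' l) \<le> 1"
    "\<And>l. e' l \<le> (\<tau> + 3 * V / (\<tau> * real (card P))) * x"
    "(\<Sum>l\<in>F. (e' l)\<^sup>2) \<le> (1 + \<delta>) * (\<Sum>\<^sub>\<infinity>l\<in>Z. (e l)\<^sup>2) + (1 + 1 / \<delta>) * (9 * V\<^sup>2 / (\<tau>\<^sup>2 * real (card P))) * x\<^sup>2"
proof -
  define A where "A = {l\<in>Z. c l \<le> 8 * c0}"
  \<comment> \<open>Frequencies above level \<open>8 * c0\<close> carry energy at most
    \<open>1 / (8 * c0)\<close>. This \<open>\<kappa>\<close> makes the fraction taken from them
    cost at most \<open>V * x / \<tau>\<close>, the same bound as for the energy lost by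
    capping.\<close>
  define \<kappa> where "\<kappa> = 8 * c0 * x * V / \<tau>"
  define M where "M = real (card P)"
  have \<kappa>: "0 < \<kappa>" "\<kappa> \<le> 1" using pos cond by (auto simp: \<kappa>_def)
  have \<kappa>x: "\<kappa> / (8 * c0) = V * x / \<tau>" using pos by (simp add: \<kappa>_def field_simps)
  have M: "M > 0" using P by (simp add: M_def card_gt_0_iff)
  \<comment> \<open>Truncation to a finite set may lose another \<open>V * x / \<tau>\<close>.
    Capping, thinning and truncation together explain the factor 3 in the bound on the moved energy
    \<open>D\<close>.\<close>
  have "eventually (\<lambda>F. \<bar>sum e F - (\<Sum>\<^sub>\<infinity>l\<in>Z. e l)\<bar> < \<kappa> / (8 * c0)) (finite_subsets_at_top Z)"
    using infsum_tendsto[OF se] \<kappa> pos unfolding tendsto_iff dist_real_def by simp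
  then have "\<exists>X. finite X \<and> X \<subseteq> Z \<and>
      (\<forall>F. finite F \<and> X \<subseteq> F \<and> F \<subseteq> Z \<longrightarrow> \<bar>sum e F - infsum e Z\<bar> < \<kappa> / (8 * c0))"
    by (rule eventually_finite_subsets_at_top[THEN iffD1])
  then obtain F0 where F0: "finite F0" "F0 \<subseteq> Z"
    "\<And>F. finite F \<Longrightarrow> F0 \<subseteq> F \<Longrightarrow> F \<subseteq> Z \<Longrightarrow> \<bar>sum e F - infsum e Z\<bar> < \<kappa> / (8 * c0)"
    by (elim exE conjE) (rule that, auto)
  define F where "F = F0 \<union> A \<union> P"
  have F: "finite F" "F \<subseteq> Z" "A \<subseteq> F" "P \<subseteq> F" using F0 P fin by (auto simp: F_def A_def)
  have tail: "(\<Sum>\<^sub>\<infinity>l\<in>Z. e l) - sum e F \<le> V * x / \<tau>"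
  proof -
    have "F0 \<subseteq> F" by (auto simp: F_def)
    then have "\<bar>sum e F - infsum e Z\<bar> < V * x / \<tau>" using F0(3)[of F] F \<kappa>x by simp
    then show ?thesis by linarith
  qed
  define g where "g l = (if l \<in> A then 1 else 1 - \<kappa>) * min (e l) (\<tau> * x)" for l
  have g: "0 \<le> g l" "g l \<le> e l" "g l \<le> \<tau> * x" for l
  proof -
    have m: "0 \<le> min (e l) (\<tau> * x)" using e[of l] pos by simp
    show "0 \<le> g l" using m \<kappa> by (simp add: g_def)
    have "g l \<le> min (e l) (\<tau> * x)" unfolding g_def using m \<kappa> by (intro mult_left_le_one_le) auto
    then show "g l \<le> e l" "g l \<le> \<tau> * x" by auto
  qed
  have le_inf: "sum f F \<le> infsum f Z" if "f summable_on Z" "\<And>l. f l \<ge> 0" for f :: "'i \<Rightarrow> real"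
    using that F by (intro finite_sum_le_infsum) auto
  define D where "D = (\<Sum>\<^sub>\<infinity>l\<in>Z. e l) - sum g F"
  have D0: "D \<ge> 0" using le_inf[OF se e] sum_mono[of F g e] g by (auto simp: D_def)
  have eg: "e l - g l \<le> (e l)\<^sup>2 / (\<tau> * x) + \<kappa> / (8 * c0) * (c l * e l)" if "l \<in> F" for l
  proof -
    have 1: "e l - min (e l) (\<tau> * x) \<le> (e l)\<^sup>2 / (\<tau> * x)"
    proof (cases "e l \<le> \<tau> * x")
      case False
      then have "e l * (\<tau> * x) \<le> e l * e l" using e[of l] by (intro mult_left_mono) auto
      then have "e l \<le> (e l)\<^sup>2 / (\<tau> * x)" using pos by (simp add: field_simps power2_eq_square)
      moreover have "0 \<le> min (e l) (\<tau> * x)" using e[of l] pos by simp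
      ultimately show ?thesis by linarith
    qed (use pos in simp)
    show ?thesis
    proof (cases "l \<in> A")
      case True
      then show ?thesis using 1 \<kappa> pos c[of l] e[of l] by (simp add: g_def add_increasing2)
    next
      case False
      then have "8 * c0 \<le> c l" using that F by (auto simp: A_def)
      then have "8 * c0 * e l \<le> c l * e l" using e[of l] by (intro mult_right_mono) auto
      then have "e l \<le> c l * e l / (8 * c0)" using pos by (simp add: field_simps)
      then have "min (e l) (\<tau> * x) \<le> c l * e l / (8 * c0)" by simp
      then have "\<kappa> * min (e l) (\<tau> * x) \<le> \<kappa> * (c l * e l / (8 * c0))" using \<kappa> by (intro mult_left_mono) auto
      then show ?thesis using 1 False by (simp add: g_def algebra_simps)
    qed
  qed
  have "(\<Sum>l\<in>F. e l - g l) \<le> (\<Sum>l\<in>F. (e l)\<^sup>2 / (\<tau> * x) + \<kappa> / (8 * c0) * (c l * e l))"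
    by (rule sum_mono) (rule eg)
  also have "\<dots> = (\<Sum>l\<in>F. (e l)\<^sup>2) / (\<tau> * x) + \<kappa> / (8 * c0) * (\<Sum>l\<in>F. c l * e l)"
    by (simp add: sum.distrib sum_divide_distrib sum_distrib_left)
  also have "\<dots> \<le> V * x\<^sup>2 / (\<tau> * x) + \<kappa> / (8 * c0) * 1"
  proof (intro add_mono divide_right_mono mult_left_mono)
    show "(\<Sum>l\<in>F. (e l)\<^sup>2) \<le> V * x\<^sup>2" using le_inf[OF se2(1)] se2(2) by simp
    have "(\<Sum>l\<in>F. c l * e l) \<le> (\<Sum>\<^sub>\<infinity>l\<in>Z. c l * e l)" using c e by (intro le_inf sce) simp
    then show "(\<Sum>l\<in>F. c l * e l) \<le> 1" using sce(2) by linarith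
  qed (use \<kappa> pos in auto)
  also have "\<dots> = 2 * (V * x / \<tau>)" using pos unfolding \<kappa>x by (simp add: power2_eq_square)
  finally have D1: "D \<le> 3 * (V * x / \<tau>)" using tail unfolding D_def by (simp add: sum_subtractf)
  define e' where "e' l = g l + (if l \<in> P then D / M else 0)" for l
  have e'P: "(\<Sum>l\<in>F. f l * (if l \<in> P then D / M else 0)) = D / M * sum f P" for f
    using F by (simp add: if_distrib sum.If_cases Int_absorb1 sum_distrib_left sum_divide_distrib mult.commute cong: if_cong)
  define E where "E l = (if l \<in> F then e' l else 0)" for l
  show ?thesis
  proof (rule that[of F E])
    show "0 \<le> E l" for l using g(1)[of l] D0 M by (simp add: E_def e'_def)
    have "(\<Sum>l\<in>F. e' l) = sum g F + D / M * sum (\<lambda>_. 1) P"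
      using e'P[of "\<lambda>_. 1"] by (simp add: e'_def sum.distrib)
    also have "\<dots> = (\<Sum>\<^sub>\<infinity>l\<in>Z. e l)" using M by (simp add: M_def D_def)
    finally show "(\<Sum>l\<in>F. E l) \<ge> (\<Sum>\<^sub>\<infinity>l\<in>Z. e l)" by (simp add: E_def)
    have D2: "D \<le> 3 * V / \<tau> * x" using D1 by simp
    show "E l \<le> (\<tau> + 3 * V / (\<tau> * real (card P))) * x" for l
    proof -
      have "D / M \<le> 3 * V / \<tau> * x / M" using D2 M by (intro divide_right_mono) auto
      moreover have "0 \<le> D / M" using D0 M by simp
      ultimately have "e' l \<le> \<tau> * x + 3 * V / \<tau> * x / M" using g(3)[of l] by (auto simp: e'_def)
      moreover have "0 \<le> (\<tau> + 3 * V / (\<tau> * real (card P))) * x" using pos by simp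
      ultimately show ?thesis by (auto simp: E_def M_def algebra_simps)
    qed
    define WA WB where "WA = (\<Sum>l\<in>A. c l * e l)" and "WB = (\<Sum>l\<in>F - A. c l * e l)"
    have W: "WA + WB \<le> 1"
    proof -
      have "WA + WB = (\<Sum>l\<in>F. c l * e l)" unfolding WA_def WB_def
        using sum.subset_diff[OF F(3,1), of "\<lambda>l. c l * e l"] by simp
      moreover have "(\<Sum>l\<in>F. c l * e l) \<le> (\<Sum>\<^sub>\<infinity>l\<in>Z. c l * e l)" using c e by (intro le_inf sce) simp
      ultimately show ?thesis using sce(2) by linarith
    qed
    have "WA \<le> (\<Sum>l\<in>A. 8 * c0 * e l)" unfolding WA_def using e by (intro sum_mono mult_right_mono) (auto simp: A_def)
    also have "\<dots> = 8 * c0 * (\<Sum>l\<in>A. e l)" by (simp add: sum_distrib_left)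
    also have "(\<Sum>l\<in>A. e l) \<le> sqrt (real (card A) * V) * x"
    proof -
      have "(\<Sum>l\<in>A. e l)\<^sup>2 \<le> (\<Sum>l\<in>A. (1::real)\<^sup>2) * (\<Sum>l\<in>A. (e l)\<^sup>2)"
        using Cauchy_Schwarz_ineq_sum[of "\<lambda>_. 1" e A] by simp
      also have "\<dots> \<le> real (card A) * (V * x\<^sup>2)"
      proof -
        have "(\<Sum>l\<in>A. (e l)\<^sup>2) \<le> (\<Sum>l\<in>F. (e l)\<^sup>2)" using F by (intro sum_mono2) auto
        then have "(\<Sum>l\<in>A. (e l)\<^sup>2) \<le> V * x\<^sup>2" using le_inf[OF se2(1)] se2(2) by simp
        then show ?thesis by (simp add: mult_left_mono)
      qed
      also have "\<dots> = (sqrt (real (card A) * V) * x)\<^sup>2" using pos by (simp add: power_mult_distrib)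
      finally show ?thesis using pos by (simp add: power2_le_iff_abs_le abs_le_iff)
    qed
    finally have WA: "WA \<le> 1 / 2" using cond(1) pos unfolding A_def by (simp add: mult_ac)
    have "(\<Sum>l\<in>F. c l * e' l) = (\<Sum>l\<in>F. c l * g l) + D / M * sum c P"
      using e'P[of c] by (simp add: e'_def sum.distrib ring_distribs)
    also have "(\<Sum>l\<in>F. c l * g l) = (\<Sum>l\<in>A. c l * g l) + (\<Sum>l\<in>F - A. c l * g l)"
      using sum.subset_diff[OF F(3,1), of "\<lambda>l. c l * g l"] by simp
    also have "(\<Sum>l\<in>A. c l * g l) \<le> WA" unfolding WA_def using g c by (intro sum_mono mult_left_mono) auto
    also have "(\<Sum>l\<in>F - A. c l * g l) \<le> (\<Sum>l\<in>F - A. (1 - \<kappa>) * (c l * e l))"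
    proof (rule sum_mono)
      fix l assume "l \<in> F - A"
      then have "g l \<le> (1 - \<kappa>) * e l" using \<kappa> by (auto simp: g_def intro!: mult_left_mono)
      then have "c l * g l \<le> c l * ((1 - \<kappa>) * e l)" using c by (intro mult_left_mono) auto
      then show "c l * g l \<le> (1 - \<kappa>) * (c l * e l)" by (simp add: mult_ac)
    qed
    also have "\<dots> = (1 - \<kappa>) * WB" by (simp add: WB_def sum_distrib_left)
    also have "D / M * sum c P \<le> D / M * (M * c0)"
      using D0 M P(4) sum_mono[of P c "\<lambda>_. c0"] by (intro mult_left_mono) (auto simp: M_def)
    also have "D / M * (M * c0) = D * c0" using M by simp
    also have "D * c0 \<le> 3 * (V * x / \<tau>) * c0" using D1 pos by (intro mult_right_mono) auto
    also have "\<dots> = 3 / 8 * \<kappa>" by (simp add: \<kappa>_def)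
    \<comment> \<open>The role of the 8: spreading \<open>D\<close> over \<open>P\<close> costs
      \<open>3 / 8 * \<kappa>\<close> in the constraint, whereas thinning the high frequencies saves
      at least \<open>\<kappa> / 2\<close> since \<open>WA \<le> 1 / 2\<close>.\<close>
    finally have "(\<Sum>l\<in>F. c l * e' l) \<le> WA + (1 - \<kappa>) * WB + 3 / 8 * \<kappa>" by simp
    also have "\<dots> \<le> WA + (1 - \<kappa>) * (1 - WA) + 3 / 8 * \<kappa>" using W \<kappa> by (auto intro!: mult_left_mono)
    also have "\<dots> = 1 - \<kappa> * (1 - WA) + 3 / 8 * \<kappa>" by (simp add: algebra_simps)
    also have "\<dots> \<le> 1"
    proof -
      have "\<kappa> * (1 / 2) \<le> \<kappa> * (1 - WA)" using \<kappa> WA by (intro mult_left_mono) auto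
      then show ?thesis using \<kappa> by simp
    qed
    finally show "(\<Sum>l\<in>F. c l * E l) \<le> 1" by (simp add: E_def)
    \<comment> \<open>Weighting the cross term by \<open>\<delta>\<close> keeps the factor of the
      original quartic sum at \<open>1 + \<delta>\<close>, as a sharp threshold requires.\<close>
    have sq: "(a + b)\<^sup>2 \<le> (1 + \<delta>) * a\<^sup>2 + (1 + 1 / \<delta>) * b\<^sup>2" for a b
    proof -
      have "0 \<le> (\<delta> * a - b)\<^sup>2 / \<delta>" using pos by simp
      also have "\<dots> = (1 + \<delta>) * a\<^sup>2 + (1 + 1 / \<delta>) * b\<^sup>2 - (a + b)\<^sup>2"
        using pos by (simp add: field_simps power2_eq_square)
      finally show ?thesis by simp
    qed
    have "(\<Sum>l\<in>F. (e' l)\<^sup>2) \<le> (\<Sum>l\<in>F. (1 + \<delta>) * (g l)\<^sup>2 + (1 + 1 / \<delta>) * (if l \<in> P then D / M else 0)\<^sup>2)"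
      unfolding e'_def by (intro sum_mono sq)
    also have "\<dots> = (1 + \<delta>) * (\<Sum>l\<in>F. (g l)\<^sup>2) + (1 + 1 / \<delta>) * (\<Sum>l\<in>F. (if l \<in> P then D / M else 0)\<^sup>2)"
      by (simp add: sum.distrib sum_distrib_left)
    also have "(\<Sum>l\<in>F. (if l \<in> P then D / M else 0)\<^sup>2) = D\<^sup>2 / M"
    proof -
      have "(\<Sum>l\<in>F. (if l \<in> P then D / M else 0)\<^sup>2) = (\<Sum>l\<in>F. if l \<in> P then (D / M)\<^sup>2 else 0)"
        by (intro sum.cong) auto
      also have "\<dots> = M * (D / M)\<^sup>2" using F by (simp add: sum.If_cases Int_absorb1 M_def)
      also have "\<dots> = D\<^sup>2 / M" using M by (simp add: power2_eq_square)
      finally show ?thesis .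
    qed
    also have "(1 + 1 / \<delta>) * (D\<^sup>2 / M) \<le> (1 + 1 / \<delta>) * ((3 * (V * x / \<tau>))\<^sup>2 / M)"
      using pos M D0 D1 by (intro mult_left_mono divide_right_mono power_mono) auto
    also have "\<dots> = (1 + 1 / \<delta>) * (9 * V\<^sup>2 / (\<tau>\<^sup>2 * real (card P))) * x\<^sup>2"
      by (simp add: M_def power_mult_distrib power_divide)
    also have "(1 + \<delta>) * (\<Sum>l\<in>F. (g l)\<^sup>2) \<le> (1 + \<delta>) * (\<Sum>\<^sub>\<infinity>l\<in>Z. (e l)\<^sup>2)"
    proof (intro mult_left_mono)
      have "(\<Sum>l\<in>F. (g l)\<^sup>2) \<le> (\<Sum>l\<in>F. (e l)\<^sup>2)" using g by (intro sum_mono power_mono) auto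
      then show "(\<Sum>l\<in>F. (g l)\<^sup>2) \<le> (\<Sum>\<^sub>\<infinity>l\<in>Z. (e l)\<^sup>2)" using le_inf[OF se2(1)] by simp
    qed (use pos in simp)
    finally show "(\<Sum>l\<in>F. (E l)\<^sup>2) \<le> (1 + \<delta>) * (\<Sum>\<^sub>\<infinity>l\<in>Z. (e l)\<^sup>2) + (1 + 1 / \<delta>) * (9 * V\<^sup>2 / (\<tau>\<^sup>2 * real (card P))) * x\<^sup>2"
      by (simp add: E_def)
  qed (use F in \<open>auto simp: E_def\<close>)
qed

section \<open>Counting lattice frequencies and flattening near-minimisers\<close>

lemma csq_nonneg: "csq \<sigma> d l \<ge> 0"
  by (simp add: csq_def)

text \<open>A frequency bound confines every coordinate to \<open>[- b, b]\<close>, so the indices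
  embed into a box with \<open>k\<close> sides. The resulting count does not involve
  \<open>d\<close>, which is essential because \<open>d\<close> tends to infinity.\<close>

lemma card_csq_le:
  fixes R :: real
  assumes \<sigma>: "\<sigma> > 0" and kd: "k \<le> d" and R: "R > 0" and b: "R powr (1 / \<sigma>) \<le> (2 * pi * b)\<^sup>2" "b \<ge> 0"
  shows "finite {l\<in>Zset {1..k}. csq \<sigma> d l \<le> R}"
    and "real (card {l\<in>Zset {1..k}. csq \<sigma> d l \<le> R}) \<le> (2 * b + 1) ^ k"
proof -
  define A where "A = {l\<in>Zset {1..k}. csq \<sigma> d l \<le> R}"
  define J where "J = {- \<lfloor>b\<rfloor>..\<lfloor>b\<rfloor>}"
  have inj: "inj_on (\<lambda>l. restrict l {1..k}) A"
  proof (rule inj_onI)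
    fix l l' assume *: "l \<in> A" "l' \<in> A" "restrict l {1..k} = restrict l' {1..k}"
    show "l = l'"
    proof
      fix j
      show "l j = l' j"
      proof (cases "j \<in> {1..k}")
        case True
        then show ?thesis using fun_cong[OF *(3), of j] by (simp only: restrict_apply if_True)
      next
        case False
        then have "l j = 0" "l' j = 0" using *(1,2) unfolding A_def Zset_def by blast+
        then show ?thesis by simp
      qed
    qed
  qed
  have img: "(\<lambda>l. restrict l {1..k}) ` A \<subseteq> PiE {1..k} (\<lambda>_. J)"
  proof (clarify, rule restrict_PiE_iff[THEN iffD2], rule ballI)
    fix l j assume l: "l \<in> A" and j: "j \<in> {1..k}"
    define S where "S = (\<Sum>j\<in>{1..d}. (2 * pi * real_of_int (l j))\<^sup>2)"
    have "S powr \<sigma> \<le> R" using l by (simp add: A_def csq_def S_def)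
    then have "(S powr \<sigma>) powr (1 / \<sigma>) \<le> R powr (1 / \<sigma>)" using \<sigma> by (intro powr_mono2) auto
    then have "S \<le> R powr (1 / \<sigma>)" using \<sigma> by (simp add: powr_powr S_def sum_nonneg)
    moreover have "(2 * pi * real_of_int (l j))\<^sup>2 \<le> S"
      unfolding S_def using j kd by (intro member_le_sum) auto
    ultimately have "(2 * pi * real_of_int (l j))\<^sup>2 \<le> (2 * pi * b)\<^sup>2" using b by linarith
    then have "\<bar>2 * pi * real_of_int (l j)\<bar> \<le> \<bar>2 * pi * b\<bar>" by (simp add: abs_le_square_iff)
    then have "\<bar>real_of_int (l j)\<bar> \<le> b" using b by (simp add: abs_mult)
    then have "l j \<le> \<lfloor>b\<rfloor>" "- l j \<le> \<lfloor>b\<rfloor>" by (simp_all add: le_floor_iff abs_le_iff)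
    then show "l j \<in> J" by (simp add: J_def)
  qed
  have fin: "finite (PiE {1..k} (\<lambda>_. J))" by (intro finite_PiE) (auto simp: J_def)
  show "finite {l\<in>Zset {1..k}. csq \<sigma> d l \<le> R}"
    using finite_imageD[OF finite_subset[OF img fin] inj] by (simp only: A_def)
  have "card A \<le> card (PiE {1..k} (\<lambda>_. J))" by (rule card_inj_on_le[OF inj img fin])
  also have "\<dots> = card J ^ k" by (simp add: card_PiE)
  finally have "real (card A) \<le> real (card J) ^ k" by (simp flip: of_nat_power)
  also have "\<dots> \<le> (2 * b + 1) ^ k"
  proof (rule power_mono)
    have "real (card J) = 2 * of_int \<lfloor>b\<rfloor> + 1" using b by (simp add: J_def)
    then show "real (card J) \<le> 2 * b + 1" by simp
  qed simp
  finally show "real (card {l\<in>Zset {1..k}. csq \<sigma> d l \<le> R}) \<le> (2 * b + 1) ^ k" by (simp add: A_def)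
qed

text \<open>The indices \<open>(i, 1, ..., 1)\<close> with \<open>i \<le> M\<close> suffice. A line
  in the lattice wastes low frequencies, but only a polynomial dependence on \<open>M\<close>
  matters.\<close>

lemma low_frequencies:
  assumes \<sigma>: "\<sigma> > 0" and k: "1 \<le> k" "k \<le> d" and M: "M \<ge> 1"
  obtains P where "P \<subseteq> Zset {1..k}" "finite P" "card P = M"
    "\<And>l. l \<in> P \<Longrightarrow> csq \<sigma> d l \<le> (4 * pi\<^sup>2 * real k * (real M)\<^sup>2) powr \<sigma>"
proof -
  define f where "f i = (\<lambda>j::nat. if j \<in> {1..k} then (if j = 1 then int i else 1) else 0)" for i :: nat
  have f: "f i \<in> Zset {1..k}" "csq \<sigma> d (f i) \<le> (4 * pi\<^sup>2 * real k * (real M)\<^sup>2) powr \<sigma>" if i: "i \<in> {1..M}" for i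
  proof -
    show "f i \<in> Zset {1..k}" using i by (auto simp: f_def Zset_def)
    have "(\<Sum>j\<in>{1..d}. (2 * pi * real_of_int (f i j))\<^sup>2) = (\<Sum>j\<in>{1..k}. (2 * pi * real_of_int (f i j))\<^sup>2)"
      using k by (intro sum.mono_neutral_right) (auto simp: f_def)
    also have "\<dots> \<le> (\<Sum>j\<in>{1..k}. (2 * pi * real M)\<^sup>2)"
      using i M by (intro sum_mono power_mono mult_left_mono) (auto simp: f_def)
    also have "\<dots> = 4 * pi\<^sup>2 * real k * (real M)\<^sup>2" by (simp add: power_mult_distrib)
    finally show "csq \<sigma> d (f i) \<le> (4 * pi\<^sup>2 * real k * (real M)\<^sup>2) powr \<sigma>"
      unfolding csq_def using \<sigma> by (intro powr_mono2) (auto intro: sum_nonneg)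
  qed
  have "inj_on f {1..M}"
  proof (rule inj_onI)
    fix i i' assume "f i = f i'"
    from fun_cong[OF this, of 1] show "i = i'" using k by (simp add: f_def)
  qed
  then have "card (f ` {1..M}) = M" by (simp add: card_image)
  then show ?thesis by (intro that[of "f ` {1..M}"]) (use f in auto)
qed

lemma summable_on_square:
  fixes f :: "'i \<Rightarrow> real"
  assumes f: "f summable_on Z" "\<And>l. f l \<ge> 0"
  shows "(\<lambda>l. (f l)\<^sup>2) summable_on Z"
proof (rule summable_on_comparison_test)
  show "(\<lambda>l. infsum f Z * f l) summable_on Z" using f(1) by (rule summable_on_cmult_right)
  fix l assume "l \<in> Z"
  then have "sum f {l} \<le> infsum f Z" by (intro finite_sum_le_infsum f) auto
  then have "f l * f l \<le> infsum f Z * f l" by (intro mult_right_mono f(2)) simp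
  then show "(f l)\<^sup>2 \<le> infsum f Z * f l" by (simp only: power2_eq_square)
qed (rule zero_le_power2)

text \<open>Approaching the infimum within \<open>\<xi>\<close> avoids asking whether it is
  attained. Nonemptiness is what gives the real-valued \<open>Inf\<close> its meaning.\<close>

lemma a_eps_near_minimiser:
  assumes \<epsilon>: "\<epsilon> > 0" and ne: "Theta_block \<sigma> d u r \<noteq> {}" and \<xi>: "\<xi> > 0"
  obtains \<theta> where "\<theta> \<in> Theta_block \<sigma> d u r" "(\<Sum>\<^sub>\<infinity>l\<in>Zset u. (\<theta> l) ^ 4) < 2 * \<epsilon> ^ 4 * ((a_eps \<epsilon> \<sigma> d u r)\<^sup>2 + \<xi>)"
proof -
  define S where "S = {(\<Sum>\<^sub>\<infinity>l\<in>Zset u. (\<theta> l) ^ 4) | \<theta>. \<theta> \<in> Theta_block \<sigma> d u r}"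
  have ne: "S \<noteq> {}" using ne unfolding S_def by blast
  have "Inf S \<ge> 0" using ne by (intro cInf_greatest) (auto simp: S_def intro!: infsum_nonneg)
  then have "(a_eps \<epsilon> \<sigma> d u r)\<^sup>2 = 1 / (2 * \<epsilon> ^ 4) * Inf S"
    unfolding a_eps_def S_def[symmetric] using \<epsilon> by (intro real_sqrt_pow2) auto
  then have "Inf S = 2 * \<epsilon> ^ 4 * (a_eps \<epsilon> \<sigma> d u r)\<^sup>2" using \<epsilon> by (simp only:) simp
  also have "\<dots> < 2 * \<epsilon> ^ 4 * ((a_eps \<epsilon> \<sigma> d u r)\<^sup>2 + \<xi>)" using \<epsilon> \<xi> by (intro mult_strict_left_mono) auto
  finally obtain y where "y \<in> S" "y < 2 * \<epsilon> ^ 4 * ((a_eps \<epsilon> \<sigma> d u r)\<^sup>2 + \<xi>)"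
    using cInf_lessD[OF ne, of "2 * \<epsilon> ^ 4 * ((a_eps \<epsilon> \<sigma> d u r)\<^sup>2 + \<xi>)"] by blast
  then show ?thesis using that unfolding S_def by blast
qed

text \<open>With \<open>V\<close> and \<open>card P\<close> of order \<open>T\<close>, the smallness
  conditions of \<open>flatten_energy\<close> become a power of \<open>T\<close> times
  \<open>\<epsilon>^2\<close>, and \<open>T \<le> ln (1 / \<epsilon>)\<close> makes them true for
  small \<open>\<epsilon>\<close>. The threshold \<open>\<epsilon>0\<close> is chosen before
  \<open>d\<close> and \<open>r\<close>, both of which vary with \<open>\<epsilon>\<close>
  later.\<close>

lemma flat_block_element:
  fixes \<sigma> C \<tau> \<delta> :: real and k :: nat
  assumes k: "1 \<le> k" and pos: "\<sigma> > 0" "C > 0" "\<tau> > 0" "\<delta> > 0"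
  obtains \<epsilon>0 where "\<epsilon>0 > 0"
    "\<And>\<epsilon> T d r. 0 < \<epsilon> \<Longrightarrow> \<epsilon> < \<epsilon>0 \<Longrightarrow> 1 \<le> T \<Longrightarrow> T \<le> ln (1 / \<epsilon>) \<Longrightarrow> k \<le> d \<Longrightarrow>
      Theta_block \<sigma> d {1..k} r \<noteq> {} \<Longrightarrow> (a_eps \<epsilon> \<sigma> d {1..k} r)\<^sup>2 \<le> C * T \<Longrightarrow>
      \<exists>F e. finite F \<and> F \<subseteq> Zset {1..k} \<and> (\<forall>l. e l \<ge> 0) \<and> (\<forall>l. l \<notin> F \<longrightarrow> e l = 0) \<and>
        (\<Sum>l\<in>F. e l) \<ge> r\<^sup>2 \<and> (\<Sum>l\<in>F. csq \<sigma> d l * e l) \<le> 1 \<and> (\<forall>l. e l / \<epsilon>\<^sup>2 \<le> 2 * \<tau>) \<and>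
        (\<Sum>l\<in>F. (e l / \<epsilon>\<^sup>2)\<^sup>2) / 2 \<le> (1 + \<delta>) * ((a_eps \<epsilon> \<sigma> d {1..k} r)\<^sup>2 + \<delta> * T) + \<delta> * T"
proof -
  \<comment> \<open>The near-minimiser is taken within \<open>\<delta> * T\<close> of the infimum,
    and the 2 undoes the normalisation \<open>1 / (2 * \<epsilon>^4)\<close> in
    \<open>a_eps\<close>.\<close>
  define C' where "C' = 2 * (C + \<delta>)"
  have C': "C' > 0" using pos by (simp add: C'_def)
  \<comment> \<open>\<open>P\<close> will have about \<open>K * T\<close> points. The first summand
    keeps the energy added per point below \<open>\<tau>\<close> in units of
    \<open>\<epsilon>^2\<close>; the second keeps its quartic cost below
    \<open>2 * \<delta> * T\<close>.\<close>
  define K where "K = 3 * C' / \<tau>\<^sup>2 + (1 + 1 / \<delta>) * (9 * C'\<^sup>2) / (2 * \<tau>\<^sup>2 * \<delta>)"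
  have K: "K > 0" "3 * C' / \<tau>\<^sup>2 \<le> K" "(1 + 1 / \<delta>) * (9 * C'\<^sup>2) / (2 * \<tau>\<^sup>2 * \<delta>) \<le> K"
    using pos C' by (auto simp: K_def add_pos_pos)
  define c1 where "c1 = (4 * pi\<^sup>2 * real k * (K + 1)\<^sup>2) powr \<sigma>"
  have c1: "c1 > 0" using k K by (simp add: c1_def)
  define b1 where "b1 = sqrt (8 powr (1 / \<sigma>) * real k)"
  have b1: "b1 > 0" using k by (simp add: b1_def)
  define c2 where "c2 = ((2 * b1 + 1) * (K + 1)) ^ k"
  have c2: "c2 > 0" using b1 K by (simp add: c2_def)
  \<comment> \<open>The powers of \<open>T\<close> in the smallness conditions:
    \<open>2 * \<sigma>\<close> from the level \<open>c0\<close>, \<open>k\<close> from the number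
    of frequencies below \<open>8 * c0\<close>, and 1 from \<open>V\<close>.\<close>
  define \<gamma> where "\<gamma> = 2 * \<sigma> + real k + 1"
  define G where "G = 16 * c1 * (1 + c2 * C') + 8 * c1 * C' / \<tau>"
  have G: "G > 0" using c1 c2 C' pos by (simp add: G_def add_pos_pos)
  have "((\<lambda>\<epsilon>::real. \<epsilon>\<^sup>2 * ln (1 / \<epsilon>) powr \<gamma>) \<longlongrightarrow> 0) (at_right 0)" by real_asymp
  then have "eventually (\<lambda>\<epsilon>::real. \<epsilon>\<^sup>2 * ln (1 / \<epsilon>) powr \<gamma> < 1 / G) (at_right 0)"
    by (rule order_tendstoD(2)) (use G in simp)
  then obtain \<epsilon>0 where \<epsilon>0: "\<epsilon>0 > 0" "\<And>\<epsilon>. 0 < \<epsilon> \<Longrightarrow> \<epsilon> < \<epsilon>0 \<Longrightarrow> \<epsilon>\<^sup>2 * ln (1 / \<epsilon>) powr \<gamma> < 1 / G"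
    unfolding eventually_at_right_field by blast
  show ?thesis
  proof (rule that[OF \<epsilon>0(1)])
    fix \<epsilon> T :: real and d :: nat and r :: real
    assume \<epsilon>: "0 < \<epsilon>" "\<epsilon> < \<epsilon>0" and T: "1 \<le> T" "T \<le> ln (1 / \<epsilon>)" and kd: "k \<le> d"
      and ne: "Theta_block \<sigma> d {1..k} r \<noteq> {}" and a: "(a_eps \<epsilon> \<sigma> d {1..k} r)\<^sup>2 \<le> C * T"
    define a2 where "a2 = (a_eps \<epsilon> \<sigma> d {1..k} r)\<^sup>2"
    define x where "x = \<epsilon>\<^sup>2"
    have x: "x > 0" using \<epsilon> by (simp add: x_def)
    have x2: "\<epsilon> ^ 4 = x\<^sup>2" by (simp add: x_def flip: power_mult)
    have small: "G * x * T powr \<gamma> \<le> 1"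
    proof -
      have "T powr \<gamma> \<le> ln (1 / \<epsilon>) powr \<gamma>" using T pos by (intro powr_mono2) (auto simp: \<gamma>_def)
      then have "x * T powr \<gamma> \<le> x * ln (1 / \<epsilon>) powr \<gamma>" using x by simp
      also have "\<dots> \<le> 1 / G" using \<epsilon>0(2)[OF \<epsilon>] by (simp add: x_def)
      finally have "x * T powr \<gamma> \<le> 1 / G" .
      then have "G * (x * T powr \<gamma>) \<le> G * (1 / G)" using G by (intro mult_left_mono) auto
      then show ?thesis using G by (simp add: mult_ac)
    qed
    obtain \<theta> where \<theta>: "\<theta> \<in> Theta_block \<sigma> d {1..k} r"
      and \<theta>4: "(\<Sum>\<^sub>\<infinity>l\<in>Zset {1..k}. (\<theta> l) ^ 4) < 2 * \<epsilon> ^ 4 * (a2 + \<delta> * T)"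
      using a_eps_near_minimiser[OF \<epsilon>(1) ne, of "\<delta> * T"] pos T unfolding a2_def by auto
    define V where "V = C' * T"
    have V: "V > 0" using C' T by (simp add: V_def)
    define M where "M = nat \<lceil>K * T\<rceil>"
    have KT: "K * T > 0" using K T by simp
    have M: "M \<ge> 1" "K * T \<le> real M" "real M \<le> (K + 1) * T"
    proof -
      show "K * T \<le> real M" unfolding M_def by linarith
      show "M \<ge> 1" using KT unfolding M_def by linarith
      have "real M \<le> K * T + 1" using KT unfolding M_def by linarith
      then show "real M \<le> (K + 1) * T" using T by (simp add: algebra_simps)
    qed
    define c0 where "c0 = (4 * pi\<^sup>2 * real k * (real M)\<^sup>2) powr \<sigma>"
    have c0: "c0 > 0" using k M by (simp add: c0_def)
    have c0T: "c0 \<le> c1 * T powr (2 * \<sigma>)"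
    proof -
      have "c0 \<le> (4 * pi\<^sup>2 * real k * ((K + 1) * T)\<^sup>2) powr \<sigma>"
        unfolding c0_def using pos M K T by (intro powr_mono2 mult_left_mono power_mono) auto
      also have "\<dots> = (4 * pi\<^sup>2 * real k * (K + 1)\<^sup>2 * T\<^sup>2) powr \<sigma>" by (simp add: power_mult_distrib mult.assoc)
      also have "\<dots> = c1 * (T\<^sup>2) powr \<sigma>" unfolding c1_def using T by (simp add: powr_mult)
      also have "(T\<^sup>2) powr \<sigma> = T powr (2 * \<sigma>)" using T by (simp add: powr_powr flip: powr_numeral)
      finally show ?thesis .
    qed
    obtain P where P: "P \<subseteq> Zset {1..k}" "finite P" "card P = M" "\<And>l. l \<in> P \<Longrightarrow> csq \<sigma> d l \<le> c0"
      using low_frequencies[OF pos(1) k kd M(1)] unfolding c0_def by blast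
    define b where "b = b1 * real M"
    have b: "(8 * c0) powr (1 / \<sigma>) \<le> (2 * pi * b)\<^sup>2" "b \<ge> 0"
    proof -
      have "(8 * c0) powr (1 / \<sigma>) = 8 powr (1 / \<sigma>) * (4 * pi\<^sup>2 * real k * (real M)\<^sup>2)"
        unfolding c0_def using pos by (simp add: powr_mult powr_powr)
      also have "\<dots> = (2 * pi * b)\<^sup>2" by (simp add: b_def b1_def power_mult_distrib)
      finally show "(8 * c0) powr (1 / \<sigma>) \<le> (2 * pi * b)\<^sup>2" by simp
      show "b \<ge> 0" using b1 by (simp add: b_def)
    qed
    have c0': "8 * c0 > 0" using c0 by simp
    note low = card_csq_le[OF pos(1) kd c0' b]
    define A where "A = {l\<in>Zset {1..k}. csq \<sigma> d l \<le> 8 * c0}"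
    have nA: "real (card A) \<le> c2 * T ^ k"
    proof -
      have "real (card A) \<le> (2 * b + 1) ^ k" using low(2) by (simp add: A_def)
      also have "2 * b + 1 \<le> (2 * b1 + 1) * ((K + 1) * T)"
      proof -
        have "2 * b + 1 \<le> (2 * b1 + 1) * real M" using M(1) by (simp add: b_def algebra_simps)
        also have "\<dots> \<le> (2 * b1 + 1) * ((K + 1) * T)" using M(3) b1 by (intro mult_left_mono) auto
        finally show ?thesis .
      qed
      then have "(2 * b + 1) ^ k \<le> ((2 * b1 + 1) * ((K + 1) * T)) ^ k" using b by (intro power_mono) auto
      also have "\<dots> = c2 * T ^ k" by (simp add: c2_def power_mult_distrib)
      finally show ?thesis .
    qed
    have T\<gamma>: "T powr \<gamma> = T powr (2 * \<sigma>) * (T ^ k * T)"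
      using T by (simp add: \<gamma>_def powr_add powr_realpow)
    have T1: "1 \<le> T ^ k" using T by (simp add: one_le_power)
    have cond1: "8 * c0 * x * sqrt (real (card A) * V) \<le> 1 / 2"
    proof -
      have "sqrt (real (card A) * V) \<le> 1 + real (card A) * V"
        using V by (intro real_le_lsqrt) (auto simp: power2_eq_square algebra_simps)
      also have "\<dots> \<le> T ^ k * T + c2 * T ^ k * (C' * T)"
      proof (intro add_mono)
        show "1 \<le> T ^ k * T" using T T1 mult_mono[of 1 "T ^ k" 1 T] by simp
        show "real (card A) * V \<le> c2 * T ^ k * (C' * T)" using nA C' c2 T unfolding V_def by (intro mult_mono) auto
      qed
      also have "\<dots> = (1 + c2 * C') * (T ^ k * T)" by (simp add: algebra_simps)
      finally have "8 * c0 * x * sqrt (real (card A) * V) \<le> 8 * (c1 * T powr (2 * \<sigma>)) * x * ((1 + c2 * C') * (T ^ k * T))"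
        using c0T c0 x V c1 T by (intro mult_mono) auto
      also have "\<dots> = (16 * c1 * (1 + c2 * C')) * x * T powr \<gamma> / 2" unfolding T\<gamma> by simp
      also have "\<dots> \<le> G * x * T powr \<gamma> / 2"
        using x c1 C' pos unfolding G_def by (intro divide_right_mono mult_right_mono) auto
      also have "\<dots> \<le> 1 / 2" using small by simp
      finally show ?thesis .
    qed
    have cond2: "8 * c0 * x * V / \<tau> \<le> 1"
    proof -
      have "8 * c0 * x * V / \<tau> \<le> 8 * (c1 * T powr (2 * \<sigma>)) * x * (C' * (T ^ k * T)) / \<tau>"
        using c0T c0 x V c1 T T1 C' pos unfolding V_def by (intro mult_mono divide_right_mono) auto
      also have "\<dots> = 8 * c1 * C' / \<tau> * x * T powr \<gamma>" unfolding T\<gamma> by simp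
      also have "\<dots> \<le> G * x * T powr \<gamma>"
        using x c1 c2 C' pos unfolding G_def by (intro mult_right_mono) auto
      finally show ?thesis using small by simp
    qed
    define e where "e l = (\<theta> l)\<^sup>2" for l
    have e4: "(e l)\<^sup>2 = (\<theta> l) ^ 4" for l by (simp add: e_def flip: power_mult)
    have se: "e summable_on Zset {1..k}" and e1: "(\<Sum>\<^sub>\<infinity>l\<in>Zset {1..k}. e l) \<ge> r\<^sup>2"
      and sce: "(\<lambda>l. csq \<sigma> d l * e l) summable_on Zset {1..k}" "(\<Sum>\<^sub>\<infinity>l\<in>Zset {1..k}. csq \<sigma> d l * e l) \<le> 1"
      using \<theta> by (simp_all add: Theta_block_def e_def[abs_def] mult.commute)
    have se2: "(\<lambda>l. (e l)\<^sup>2) summable_on Zset {1..k}" 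
      by (rule summable_on_square[OF se]) (simp add: e_def)
    have e2: "(\<Sum>\<^sub>\<infinity>l\<in>Zset {1..k}. (e l)\<^sup>2) \<le> 2 * (a2 + \<delta> * T) * x\<^sup>2"
      using \<theta>4 unfolding e4 x2 by (simp only: mult.assoc mult.commute[of "x\<^sup>2"] less_imp_le)
    have e2V: "(\<Sum>\<^sub>\<infinity>l\<in>Zset {1..k}. (e l)\<^sup>2) \<le> V * x\<^sup>2"
    proof -
      have "2 * (a2 + \<delta> * T) \<le> V" using a by (simp add: V_def C'_def a2_def algebra_simps)
      then have "2 * (a2 + \<delta> * T) * x\<^sup>2 \<le> V * x\<^sup>2" by (rule mult_right_mono) simp
      then show ?thesis using e2 by linarith
    qed
    have Pne: "P \<noteq> {}" using P(3) M(1) by auto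
    have e0: "\<And>l. e l \<ge> 0" by (simp add: e_def)
    obtain F e' where F: "finite F" "F \<subseteq> Zset {1..k}" "\<And>l. e' l \<ge> 0" "\<And>l. l \<notin> F \<Longrightarrow> e' l = 0"
      "(\<Sum>l\<in>F. e' l) \<ge> (\<Sum>\<^sub>\<infinity>l\<in>Zset {1..k}. e l)" "(\<Sum>l\<in>F. csq \<sigma> d l * e' l) \<le> 1"
      "\<And>l. e' l \<le> (\<tau> + 3 * V / (\<tau> * real M)) * x"
      "(\<Sum>l\<in>F. (e' l)\<^sup>2) \<le> (1 + \<delta>) * (\<Sum>\<^sub>\<infinity>l\<in>Zset {1..k}. (e l)\<^sup>2) + (1 + 1 / \<delta>) * (9 * V\<^sup>2 / (\<tau>\<^sup>2 * real M)) * x\<^sup>2"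
      using flatten_energy[OF e0 csq_nonneg sce se se2 e2V P(1,2) Pne P(4) c0 x V pos(3,4) low(1) cond1[unfolded A_def] cond2,
        unfolded P(3)] by blast
    have Mpos: "real M > 0" using M(1) by simp
    have "3 * V / (\<tau> * real M) \<le> \<tau>"
    proof -
      have "3 * C' \<le> K * \<tau>\<^sup>2" using K(2) pos by (simp add: field_simps)
      then have "3 * C' * T \<le> K * \<tau>\<^sup>2 * T" using T by (intro mult_right_mono) auto
      also have "\<dots> = \<tau>\<^sup>2 * (K * T)" by simp
      also have "\<dots> \<le> \<tau>\<^sup>2 * real M" using M by (intro mult_left_mono) auto
      finally show ?thesis using Mpos pos by (simp add: V_def field_simps power2_eq_square)
    qed
    then have f1: "e' l / \<epsilon>\<^sup>2 \<le> 2 * \<tau>" for l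
    proof -
      have "e' l \<le> (2 * \<tau>) * x"
        using F(7)[of l] mult_right_mono[of "\<tau> + 3 * V / (\<tau> * real M)" "2 * \<tau>" x] x 
          \<open>3 * V / (\<tau> * real M) \<le> \<tau>\<close> by linarith
      then show ?thesis using x by (simp add: x_def pos_divide_le_eq)
    qed
    have f2: "(1 + 1 / \<delta>) * (9 * V\<^sup>2 / (\<tau>\<^sup>2 * real M)) \<le> 2 * \<delta> * T"
    proof -
      have "(1 + 1 / \<delta>) * (9 * V\<^sup>2 / (\<tau>\<^sup>2 * real M)) \<le> (1 + 1 / \<delta>) * (9 * V\<^sup>2 / (\<tau>\<^sup>2 * (K * T)))"
        using M KT pos by (intro mult_left_mono divide_left_mono) auto
      also have "\<dots> = ((1 + 1 / \<delta>) * (9 * C'\<^sup>2) / (2 * \<tau>\<^sup>2 * \<delta>)) * (2 * \<delta> * T / K)"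
        using pos T K(1) by (simp add: V_def divide_simps) (simp add: power2_eq_square)
      also have "\<dots> \<le> K * (2 * \<delta> * T / K)" using K pos T by (intro mult_right_mono) auto
      finally show ?thesis using K(1) by simp
    qed
    have "(\<Sum>l\<in>F. (e' l / \<epsilon>\<^sup>2)\<^sup>2) = (\<Sum>l\<in>F. (e' l)\<^sup>2) / x\<^sup>2"
      by (simp add: x_def power_divide sum_divide_distrib)
    also have "\<dots> \<le> ((1 + \<delta>) * (2 * (a2 + \<delta> * T) * x\<^sup>2) + (2 * \<delta> * T) * x\<^sup>2) / x\<^sup>2"
    proof (rule divide_right_mono)
      have "(1 + \<delta>) * (\<Sum>\<^sub>\<infinity>l\<in>Zset {1..k}. (e l)\<^sup>2) \<le> (1 + \<delta>) * (2 * (a2 + \<delta> * T) * x\<^sup>2)"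
        using e2 pos by (intro mult_left_mono) auto
      moreover have "(1 + 1 / \<delta>) * (9 * V\<^sup>2 / (\<tau>\<^sup>2 * real M)) * x\<^sup>2 \<le> (2 * \<delta> * T) * x\<^sup>2"
        using f2 by (intro mult_right_mono) auto
      ultimately show "(\<Sum>l\<in>F. (e' l)\<^sup>2) \<le> (1 + \<delta>) * (2 * (a2 + \<delta> * T) * x\<^sup>2) + (2 * \<delta> * T) * x\<^sup>2"
        using F(8) by linarith
    qed simp
    also have "\<dots> = 2 * ((1 + \<delta>) * (a2 + \<delta> * T) + \<delta> * T)"
      using x by (simp add: add_divide_distrib)
    finally have f3: "(\<Sum>l\<in>F. (e' l / \<epsilon>\<^sup>2)\<^sup>2) / 2 \<le> (1 + \<delta>) * (a2 + \<delta> * T) + \<delta> * T" by simp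
    have f4: "(\<Sum>l\<in>F. e' l) \<ge> r\<^sup>2" using F(5) e1 by linarith
    show "\<exists>F e. finite F \<and> F \<subseteq> Zset {1..k} \<and> (\<forall>l. e l \<ge> 0) \<and> (\<forall>l. l \<notin> F \<longrightarrow> e l = 0) \<and>
        (\<Sum>l\<in>F. e l) \<ge> r\<^sup>2 \<and> (\<Sum>l\<in>F. csq \<sigma> d l * e l) \<le> 1 \<and> (\<forall>l. e l / \<epsilon>\<^sup>2 \<le> 2 * \<tau>) \<and>
        (\<Sum>l\<in>F. (e l / \<epsilon>\<^sup>2)\<^sup>2) / 2 \<le> (1 + \<delta>) * ((a_eps \<epsilon> \<sigma> d {1..k} r)\<^sup>2 + \<delta> * T) + \<delta> * T"
      by (rule exI[of _ F], rule exI[of _ e']) (use F f1 f3 f4 in \<open>simp add: a2_def\<close>)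
  qed
qed

section \<open>Product measures and subset selection\<close>

lemma (in product_prob_space) indep_vars_components: "P.indep_vars M (\<lambda>i x. x i) I"
proof (cases "I = {}")
  case True
  show ?thesis unfolding P.indep_vars_def P.indep_sets_def using True by auto
next
  case False
  have "distr (PiM I M) (PiM I M) (\<lambda>x. \<lambda>i\<in>I. x i) = distr (PiM I M) (PiM I M) (\<lambda>x. x)"
    by (intro distr_cong) (auto simp: space_PiM)
  also have "\<dots> = PiM I (\<lambda>i. distr (PiM I M) (M i) (\<lambda>x. x i))"
    by (auto simp: distr_id PiM_component intro!: PiM_cong)
  finally show ?thesis
    by (subst P.indep_vars_iff_distr_eq_PiM'[OF False]) auto
qed

text \<open>Independence of the coordinates replaces Fubini's theorem, since \<open>I\<close> may be
  infinite while only the finite set \<open>K\<close> is integrated.\<close>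

lemma (in product_prob_space) nn_integral_prod_components:
  fixes h :: "'i \<Rightarrow> 'a \<Rightarrow> ennreal"
  assumes K: "finite K" "K \<subseteq> I" and h: "\<And>i. i \<in> K \<Longrightarrow> h i \<in> borel_measurable (M i)"
  shows "(\<integral>\<^sup>+x. (\<Prod>i\<in>K. h i (x i)) \<partial>PiM I M) = (\<Prod>i\<in>K. \<integral>\<^sup>+y. h i y \<partial>M i)"
proof -
  have "P.indep_vars (\<lambda>_. borel) (\<lambda>i x. h i (x i)) K"
    by (rule P.indep_vars_compose2[OF P.indep_vars_subset[OF indep_vars_components K(2)] h])
  then have "(\<integral>\<^sup>+x. (\<Prod>i\<in>K. h i (x i)) \<partial>PiM I M) = (\<Prod>i\<in>K. \<integral>\<^sup>+x. h i (x i) \<partial>PiM I M)"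
    by (intro P.indep_vars_nn_integral K) auto
  also have "\<dots> = (\<Prod>i\<in>K. \<integral>\<^sup>+y. h i y \<partial>M i)"
  proof (rule prod.cong[OF refl])
    fix i assume i: "i \<in> K"
    then have "(\<integral>\<^sup>+y. h i y \<partial>M i) = (\<integral>\<^sup>+y. h i y \<partial>distr (PiM I M) (M i) (\<lambda>\<omega>. \<omega> i))"
      using K by (subst PiM_component) auto
    also have "\<dots> = (\<integral>\<^sup>+x. h i (x i) \<partial>PiM I M)"
      using i K by (subst nn_integral_distr) (auto intro: h)
    finally show "(\<integral>\<^sup>+x. h i (x i) \<partial>PiM I M) = (\<integral>\<^sup>+y. h i y \<partial>M i)" by simp
  qed
  finally show ?thesis .
qed

text \<open>Changing finitely many factors of a possibly infinite product is absolutely continuous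
  with a product density, checked on cylinders. This is what the finite support of the flattened
  signal is for: all experiments then have densities with respect to one reference law.\<close>

lemma PiM_density_finite:
  fixes M :: "'i \<Rightarrow> 'a measure"
  assumes M: "\<And>i. prob_space (M i)" and J: "finite J" "J \<subseteq> I"
    and f: "\<And>i. i \<in> J \<Longrightarrow> f i \<in> borel_measurable (M i)" "\<And>i. i \<in> J \<Longrightarrow> prob_space (density (M i) (f i))"
  shows "PiM I (\<lambda>i. if i \<in> J then density (M i) (f i) else M i) = density (PiM I M) (\<lambda>x. \<Prod>i\<in>J. f i (x i))"
    (is "PiM I ?N = ?D")
proof -
  interpret M: product_prob_space M I by (intro product_prob_spaceI M)
  interpret N: product_prob_space ?N I by (intro product_prob_spaceI) (simp add: M f)
  have meas: "(\<lambda>x. \<Prod>i\<in>J. f i (x i)) \<in> borel_measurable (PiM I M)"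
  proof (rule borel_measurable_prod_ennreal)
    fix i assume "i \<in> J"
    then show "(\<lambda>x. f i (x i)) \<in> borel_measurable (PiM I M)"
      using measurable_compose[OF measurable_component_singleton[of i I M] f(1)[of i]] J by auto
  qed
  have "?D = PiM I ?N"
  proof (rule N.PiM_eq)
    show "sets ?D = sets (PiM I ?N)" unfolding sets_density by (rule sets_PiM_cong) auto
    fix K F assume K: "finite K" "K \<subseteq> I" and F: "\<And>j. j \<in> K \<Longrightarrow> F j \<in> sets (?N j)"
    have F': "F j \<in> sets (M j)" if "j \<in> K" for j using F[OF that] by (simp split: if_splits)
    \<comment> \<open>Merges the density factor and the cylinder factor of a coordinate, with 1 as
      default, so that a single product over \<open>J \<union> K\<close> has to be
      integrated.\<close>
    define h where "h i y = (if i \<in> J then f i y else 1) * (if i \<in> K then indicator (F i) y else 1)" for i y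
    have h: "h i \<in> borel_measurable (M i)" for i
      unfolding h_def using f(1) F' by (cases "i \<in> J"; cases "i \<in> K") auto
    have emb: "prod_emb I ?N K (Pi\<^sub>E K F) = prod_emb I M K (Pi\<^sub>E K F)"
    proof -
      have "(\<lambda>i. space (?N i)) = (\<lambda>i. space (M i))" by (rule ext) simp
      then show ?thesis unfolding prod_emb_def by simp
    qed
    have emb_sets: "prod_emb I M K (Pi\<^sub>E K F) \<in> sets (PiM I M)"
      using K F' by (intro sets_PiM_I) auto
    have "emeasure ?D (prod_emb I ?N K (Pi\<^sub>E K F)) 
      = (\<integral>\<^sup>+x. (\<Prod>i\<in>J. f i (x i)) * indicator (prod_emb I M K (Pi\<^sub>E K F)) x \<partial>PiM I M)"
      unfolding emb by (rule emeasure_density[OF meas emb_sets])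
    also have "\<dots> = (\<integral>\<^sup>+x. (\<Prod>i\<in>J \<union> K. h i (x i)) \<partial>PiM I M)"
    proof (rule nn_integral_cong)
      fix x assume x: "x \<in> space (PiM I M)"
      have "(\<Prod>i\<in>J \<union> K. h i (x i)) = (\<Prod>i\<in>J \<union> K. if i \<in> J then f i (x i) else 1) * 
          (\<Prod>i\<in>J \<union> K. if i \<in> K then indicator (F i) (x i) else 1)"
        by (simp add: h_def prod.distrib)
      also have "(\<Prod>i\<in>J \<union> K. if i \<in> J then f i (x i) else 1) = (\<Prod>i\<in>J. f i (x i))"
        using J K by (simp add: prod.If_cases Int_absorb1)
      also have "(\<Prod>i\<in>J \<union> K. if i \<in> K then indicator (F i) (x i) else 1) = (\<Prod>i\<in>K. indicator (F i) (x i) :: ennreal)"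
        using J K by (simp add: prod.If_cases Int_absorb1)
      also have "\<dots> = indicator (prod_emb I M K (Pi\<^sub>E K F)) x"
      proof (cases "\<forall>i\<in>K. x i \<in> F i")
        case True
        then have "x \<in> prod_emb I M K (Pi\<^sub>E K F)"
          using x K by (auto simp: prod_emb_def space_PiM)
        then show ?thesis using True by simp
      next
        case False
        then have "x \<notin> prod_emb I M K (Pi\<^sub>E K F)" by (auto simp: prod_emb_def)
        moreover have "(\<Prod>i\<in>K. indicator (F i) (x i) :: ennreal) = 0"
          using False K by (intro prod_zero) (auto simp: indicator_def)
        ultimately show ?thesis by simp
      qed
      finally show "(\<Prod>i\<in>J. f i (x i)) * indicator (prod_emb I M K (Pi\<^sub>E K F)) x = (\<Prod>i\<in>J \<union> K. h i (x i))" by simp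
    qed
    also have "\<dots> = (\<Prod>i\<in>J \<union> K. \<integral>\<^sup>+y. h i y \<partial>M i)"
      using J K h by (intro M.nn_integral_prod_components) auto
    \<comment> \<open>Coordinates of \<open>J\<close> outside the cylinder contribute the total mass
      of their density, which is 1.\<close>
    also have "\<dots> = (\<Prod>i\<in>K. \<integral>\<^sup>+y. h i y \<partial>M i)"
    proof (rule prod.mono_neutral_right)
      show "\<forall>i\<in>J \<union> K - K. (\<integral>\<^sup>+y. h i y \<partial>M i) = 1"
      proof
        fix i assume i: "i \<in> J \<union> K - K"
        interpret prob_space "density (M i) (f i)" using f i by auto
        have "(\<integral>\<^sup>+y. h i y \<partial>M i) = (\<integral>\<^sup>+y. f i y * indicator (space (M i)) y \<partial>M i)"
          using i by (intro nn_integral_cong) (auto simp: h_def)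
        also have "\<dots> = emeasure (density (M i) (f i)) (space (M i))"
          using i f by (subst emeasure_density) auto
        also have "\<dots> = 1" using emeasure_space_1 by simp
        finally show "(\<integral>\<^sup>+y. h i y \<partial>M i) = 1" .
      qed
    qed (use J K in auto)
    also have "\<dots> = (\<Prod>i\<in>K. emeasure (?N i) (F i))"
    proof (rule prod.cong[OF refl])
      fix i assume i: "i \<in> K"
      show "(\<integral>\<^sup>+y. h i y \<partial>M i) = emeasure (?N i) (F i)"
      proof (cases "i \<in> J")
        case True
        then have "emeasure (?N i) (F i) = (\<integral>\<^sup>+y. f i y * indicator (F i) y \<partial>M i)"
          using f F'[OF i] by (simp add: emeasure_density)
        then show ?thesis using True i by (simp add: h_def)
      next
        case False
        then show ?thesis using i F'[OF i] by (simp add: h_def)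
      qed
    qed
    finally show "emeasure ?D (prod_emb I ?N K (Pi\<^sub>E K F)) = (\<Prod>i\<in>K. emeasure (?N i) (F i))" .
  qed
  then show ?thesis by simp
qed

text \<open>Joint injectivity of \<open>\<psi>\<close> makes different blocks read disjoint sets of
  coordinates, hence independent data. After renaming coordinates every block has the same law on
  \<open>F\<close>, so one profile can be analysed once for all blocks.\<close>

lemma PiM_block_expectation:
  fixes M :: "'i \<Rightarrow> 'a measure" and \<psi> :: "'u \<Rightarrow> 'l \<Rightarrow> 'i" and h :: "'u \<Rightarrow> ('l \<Rightarrow> 'a) \<Rightarrow> real"
  assumes M: "\<And>i. prob_space (M i)" and U: "finite U"
    and \<psi>: "\<And>u l. u \<in> U \<Longrightarrow> l \<in> F \<Longrightarrow> \<psi> u l \<in> I" "inj_on (\<lambda>(u, l). \<psi> u l) (U \<times> F)"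
    and N: "\<And>u l. u \<in> U \<Longrightarrow> l \<in> F \<Longrightarrow> M (\<psi> u l) = N"
    and h: "\<And>u. u \<in> U \<Longrightarrow> integrable (PiM F (\<lambda>_. N)) (h u)"
  shows "integrable (PiM I M) (\<lambda>x. \<Prod>u\<in>U. h u (\<lambda>l\<in>F. x (\<psi> u l)))"
    and "(\<integral>x. (\<Prod>u\<in>U. h u (\<lambda>l\<in>F. x (\<psi> u l))) \<partial>PiM I M) = (\<Prod>u\<in>U. \<integral>y. h u y \<partial>PiM F (\<lambda>_. N))"
proof -
  interpret M: product_prob_space M I by (intro product_prob_spaceI M)
  define X where "X u x = (\<lambda>l\<in>F. x (\<psi> u l))" for u and x :: "'i \<Rightarrow> 'a"
  have B: "PiM F (\<lambda>l. M (\<psi> u l)) = PiM F (\<lambda>_. N)" if "u \<in> U" for u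
    using N[OF that] by (intro PiM_cong) auto
  have distr: "distr (PiM I M) (PiM F (\<lambda>_. N)) (X u) = PiM F (\<lambda>_. N)" if u: "u \<in> U" for u
  proof -
    have "inj_on (\<psi> u) F"
    proof (rule inj_onI)
      fix l l' assume "l \<in> F" "l' \<in> F" "\<psi> u l = \<psi> u l'"
      then show "l = l'" using inj_onD[OF \<psi>(2), of "(u, l)" "(u, l')"] u by simp
    qed
    from distr_PiM_reindex[of I M "\<psi> u" F, OF M this] \<psi>(1)[OF u] show ?thesis
      unfolding X_def B[OF u] by auto
  qed
  have Xm: "X u \<in> measurable (PiM (\<psi> u ` F) M) (PiM F (\<lambda>_. N))" if u: "u \<in> U" for u
    unfolding X_def
  proof (rule measurable_restrict)
    fix l assume l: "l \<in> F"
    show "(\<lambda>x. x (\<psi> u l)) \<in> measurable (PiM (\<psi> u ` F) M) N"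
      using measurable_component_singleton[of "\<psi> u l" "\<psi> u ` F" M] N[OF u l] l by simp
  qed
  have XmI: "X u \<in> measurable (PiM I M) (PiM F (\<lambda>_. N))" if u: "u \<in> U" for u
    unfolding X_def
  proof (rule measurable_restrict)
    fix l assume l: "l \<in> F"
    show "(\<lambda>x. x (\<psi> u l)) \<in> measurable (PiM I M) N"
      using measurable_component_singleton[of "\<psi> u l" I M] N[OF u l] \<psi>(1)[OF u l] by simp
  qed
  have "M.P.indep_vars (\<lambda>u. PiM (\<psi> u ` F) M) (\<lambda>u \<omega>. restrict (\<lambda>i. \<omega> i) (\<psi> u ` F)) U"
  proof (rule M.P.indep_vars_restrict[OF M.indep_vars_components])
    show "\<psi> u ` F \<subseteq> I" if "u \<in> U" for u using \<psi>(1)[OF that] by auto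
    show "disjoint_family_on (\<lambda>u. \<psi> u ` F) U"
      unfolding disjoint_family_on_def
    proof (intro ballI impI)
      fix u v assume uv: "u \<in> U" "v \<in> U" "u \<noteq> v"
      show "\<psi> u ` F \<inter> \<psi> v ` F = {}"
      proof (rule ccontr)
        assume "\<psi> u ` F \<inter> \<psi> v ` F \<noteq> {}"
        then obtain l l' where "l \<in> F" "l' \<in> F" "\<psi> u l = \<psi> v l'" by auto
        then show False using inj_onD[OF \<psi>(2), of "(u, l)" "(v, l')"] uv by simp
      qed
    qed
  qed
  then have "M.P.indep_vars (\<lambda>_. PiM F (\<lambda>_. N)) (\<lambda>u \<omega>. X u (restrict (\<lambda>i. \<omega> i) (\<psi> u ` F))) U"
    by (rule M.P.indep_vars_compose2) (rule Xm)
  moreover have "X u (restrict (\<lambda>i. \<omega> i) (\<psi> u ` F)) = X u \<omega>" for u \<omega>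
    by (auto simp: X_def fun_eq_iff restrict_def)
  ultimately have "M.P.indep_vars (\<lambda>_. PiM F (\<lambda>_. N)) X U" by simp
  then have ind: "M.P.indep_vars (\<lambda>_. borel) (\<lambda>u x. h u (X u x)) U"
    by (rule M.P.indep_vars_compose2) (use h in auto)
  have int: "integrable (PiM I M) (\<lambda>x. h u (X u x))" if u: "u \<in> U" for u
    using h[OF u] by (subst (asm) distr[OF u, symmetric], subst (asm) integrable_distr_eq) (use XmI[OF u] h[OF u] in auto)
  have val: "(\<integral>x. h u (X u x) \<partial>PiM I M) = (\<integral>y. h u y \<partial>PiM F (\<lambda>_. N))" if u: "u \<in> U" for u
    using integral_distr[OF XmI[OF u], of "h u"] h[OF u] by (simp add: distr[OF u])
  show "integrable (PiM I M) (\<lambda>x. \<Prod>u\<in>U. h u (\<lambda>l\<in>F. x (\<psi> u l)))"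
    using M.P.indep_vars_integrable[OF U ind int] by (simp add: X_def)
  show "(\<integral>x. (\<Prod>u\<in>U. h u (\<lambda>l\<in>F. x (\<psi> u l))) \<partial>PiM I M) = (\<Prod>u\<in>U. \<integral>y. h u y \<partial>PiM F (\<lambda>_. N))"
    using M.P.indep_vars_lebesgue_integral[OF U ind int] by (simp add: X_def[symmetric] val)
qed

text \<open>If \<open>S0\<close> is in the error event, swapping the two witnesses yields a different subset of at least
  the same weight; this is where the factor 2 is lost, and it makes ties harmless.\<close>

lemma wrong_subset_weight:
  fixes w :: "'u \<Rightarrow> real" and t :: real
  assumes U: "finite U" and w: "\<And>u. u \<in> U \<Longrightarrow> w u \<ge> 0"
  shows "(\<Sum>S | S \<subseteq> U \<and> card S = p. (\<Prod>u\<in>S. w u) * of_bool ((\<exists>v\<in>U - S. t \<le> w v) \<and> (\<exists>u\<in>S. w u \<le> t))) / 2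
    \<le> (\<Sum>S | S \<subseteq> U \<and> card S = p. (\<Prod>u\<in>S. w u) * of_bool (S0 \<noteq> S))"
proof -
  define \<S> where "\<S> = {S. S \<subseteq> U \<and> card S = p}"
  have fin: "finite \<S>" using U by (auto simp: \<S>_def)
  define q where "q S = (\<Prod>u\<in>S. w u)" for S
  have q: "q S \<ge> 0" if "S \<in> \<S>" for S using that w by (auto simp: q_def \<S>_def intro!: prod_nonneg)
  define E where "E S \<longleftrightarrow> (\<exists>v\<in>U - S. t \<le> w v) \<and> (\<exists>u\<in>S. w u \<le> t)" for S
  have le: "(\<Sum>S\<in>T. q S * of_bool (E S)) \<le> sum q T" if "T \<subseteq> \<S>" for T
    using that q by (intro sum_mono) auto
  have "(\<Sum>S\<in>\<S>. q S * of_bool (E S)) / 2 \<le> (\<Sum>S\<in>\<S>. q S * of_bool (S0 \<noteq> S))"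
  proof (cases "S0 \<in> \<S>")
    case False
    then have "(\<Sum>S\<in>\<S>. q S * of_bool (S0 \<noteq> S)) = sum q \<S>" by (intro sum.cong) auto
    moreover have "sum q \<S> \<ge> 0" using q by (simp add: sum_nonneg)
    ultimately show ?thesis using le[of \<S>] by simp
  next
    case True
    define R where "R = sum q (\<S> - {S0})"
    have "(\<Sum>S\<in>\<S>. q S * of_bool (S0 \<noteq> S)) = q S0 * of_bool (S0 \<noteq> S0) + (\<Sum>S\<in>\<S> - {S0}. q S * of_bool (S0 \<noteq> S))"
      by (rule sum.remove[OF fin True])
    also have "(\<Sum>S\<in>\<S> - {S0}. q S * of_bool (S0 \<noteq> S)) = R" unfolding R_def by (intro sum.cong) auto
    finally have 1: "(\<Sum>S\<in>\<S>. q S * of_bool (S0 \<noteq> S)) = R" by simp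
    have R0: "R \<ge> 0" unfolding R_def using q by (intro sum_nonneg) auto
    \<comment> \<open>Only the term of \<open>S0\<close> is missing on the right of the claim. It is
      shown to be at most the remaining weight \<open>R\<close>, so the event weighs at most
      \<open>2 * R\<close>.\<close>
    have "(\<Sum>S\<in>\<S>. q S * of_bool (E S)) = q S0 * of_bool (E S0) + (\<Sum>S\<in>\<S> - {S0}. q S * of_bool (E S))"
      by (rule sum.remove[OF fin True])
    also have "\<dots> \<le> q S0 * of_bool (E S0) + R" using le[of "\<S> - {S0}"] by (auto simp: R_def)
    also have "q S0 * of_bool (E S0) \<le> R"
    proof (cases "E S0")
      case E: True
      then obtain u v where uv: "v \<in> U - S0" "t \<le> w v" "u \<in> S0" "w u \<le> t" by (auto simp: E_def)
      define S1 where "S1 = insert v (S0 - {u})"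
      have S0: "S0 \<subseteq> U" "card S0 = p" "finite S0" using True U finite_subset by (auto simp: \<S>_def)
      have p: "p > 0" using S0 uv by (auto simp: card_gt_0_iff)
      have "S1 \<in> \<S>" using S0 uv p by (auto simp: \<S>_def S1_def card_insert_if)
      moreover have "S1 \<noteq> S0" using uv by (auto simp: S1_def)
      ultimately have "q S1 \<le> R" unfolding R_def using fin q by (intro member_le_sum) auto
      moreover have "q S0 \<le> q S1"
      proof -
        have "q S0 = w u * q (S0 - {u})" unfolding q_def by (rule prod.remove) (use S0 uv in auto)
        also have "\<dots> \<le> w v * q (S0 - {u})" unfolding q_def using S0 uv w
          by (intro mult_right_mono prod_nonneg) auto
        also have "\<dots> = q S1" unfolding q_def S1_def using S0 uv by (subst prod.insert) auto
        finally show ?thesis .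
      qed
      ultimately show ?thesis using E by simp
    qed (use R0 in simp)
    finally show ?thesis using 1 by simp
  qed
  then show ?thesis unfolding \<S>_def q_def E_def .
qed

section \<open>Copying one block profile to all index sets of a level\<close>

lemma supp_idx_Zset: "l \<in> Zset u \<Longrightarrow> supp_idx l = u"
  by (auto simp: Zset_def supp_idx_def)

lemma Ukd_finite: "finite (Ukd k d)" "u \<in> Ukd k d \<Longrightarrow> finite u"
  by (auto simp: Ukd_def intro: finite_subset)

lemma card_Ukd: "card (Ukd k d) = d choose k"
  unfolding Ukd_def using n_subsets[of "{1..d}" k] by simp

text \<open>Transports a multi-index supported on an initial segment to the block \<open>u\<close>
  along an arbitrary enumeration of \<open>u\<close>. Any enumeration will do because
  \<open>csq\<close> is symmetric in the coordinates.\<close>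

definition relabel :: "nat set \<Rightarrow> (nat \<Rightarrow> int) \<Rightarrow> nat \<Rightarrow> int" where
  "relabel u l = (\<lambda>j. if j \<in> u then l (inv_into {1..card u} (SOME h. bij_betw h {1..card u} u) j) else 0)"

lemma relabel_bij:
  assumes "finite u"
  obtains g where "bij_betw g u {1..card u}" "\<And>l. relabel u l = (\<lambda>j. if j \<in> u then l (g j) else 0)"
proof -
  have "bij_betw (SOME h. bij_betw h {1..card u} u) {1..card u} u"
    using ex_bij_betw_nat_finite_1[OF assms] by (rule someI_ex)
  from bij_betw_inv_into[OF this] show ?thesis by (rule that) (simp add: relabel_def)
qed

lemma relabel_Zset:
  assumes "finite u" "l \<in> Zset {1..card u}"
  shows "relabel u l \<in> Zset u"
proof -
  obtain g where g: "bij_betw g u {1..card u}" "\<And>l. relabel u l = (\<lambda>j. if j \<in> u then l (g j) else 0)"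
    using relabel_bij[OF assms(1)] by blast
  show ?thesis using assms(2) bij_betwE[OF g(1)] unfolding g(2) Zset_def by simp
qed

lemma inj_on_relabel:
  assumes "finite u"
  shows "inj_on (relabel u) (Zset {1..card u})"
proof -
  obtain g where g: "bij_betw g u {1..card u}" "\<And>l. relabel u l = (\<lambda>j. if j \<in> u then l (g j) else 0)"
    using relabel_bij[OF assms(1)] by blast
  show ?thesis
  proof (rule inj_onI)
    fix l l' assume l: "l \<in> Zset {1..card u}" "l' \<in> Zset {1..card u}" "relabel u l = relabel u l'"
    show "l = l'"
    proof
      fix i
      show "l i = l' i"
      proof (cases "i \<in> {1..card u}")
        case True
        then obtain j where "j \<in> u" "i = g j" using g(1) by (metis bij_betw_imp_surj_on imageE)
        then show ?thesis using fun_cong[OF l(3), of j] unfolding g(2) by simp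
      next
        case False
        then have "l i = 0" "l' i = 0" using l(1,2) unfolding Zset_def by blast+
        then show ?thesis by simp
      qed
    qed
  qed
qed

text \<open>The frequency depends on the nonzero coordinates only up to permutation, so a profile
  admissible on \<open>{1..k}\<close> stays admissible on every block of its level.\<close>

lemma csq_relabel:
  assumes "u \<in> Ukd k d" "k \<le> d" "l \<in> Zset {1..k}"
  shows "csq \<sigma> d (relabel u l) = csq \<sigma> d l"
proof -
  have u: "u \<subseteq> {1..d}" "card u = k" "finite u" using assms(1) by (auto simp: Ukd_def intro: finite_subset)
  obtain g where g: "bij_betw g u {1..k}" "\<And>l. relabel u l = (\<lambda>j. if j \<in> u then l (g j) else 0)"
    using relabel_bij[OF u(3)] u(2) by blast
  have "(\<Sum>j\<in>{1..d}. (2 * pi * real_of_int (relabel u l j))\<^sup>2) = (\<Sum>j\<in>u. (2 * pi * real_of_int (l (g j)))\<^sup>2)"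
    using u unfolding g(2) by (intro sum.mono_neutral_cong_right) auto
  also have "\<dots> = (\<Sum>j\<in>{1..k}. (2 * pi * real_of_int (l j))\<^sup>2)"
    by (rule sum.reindex_bij_betw[OF g(1)])
  also have "\<dots> = (\<Sum>j\<in>{1..d}. (2 * pi * real_of_int (l j))\<^sup>2)"
    using assms by (intro sum.mono_neutral_left) (auto simp: Zset_def)
  finally show ?thesis by (simp add: csq_def)
qed

lemma Theta_block_finite:
  assumes J: "finite J" "J \<subseteq> Zset u" "\<And>l. l \<in> Zset u - J \<Longrightarrow> \<theta> l = 0"
    and "(\<Sum>l\<in>J. (\<theta> l)\<^sup>2 * csq \<sigma> d l) \<le> 1" "(\<Sum>l\<in>J. (\<theta> l)\<^sup>2) \<ge> r\<^sup>2"
  shows "\<theta> \<in> Theta_block \<sigma> d u r"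
proof -
  have "((\<lambda>l. (\<theta> l)\<^sup>2 * csq \<sigma> d l) has_sum (\<Sum>l\<in>J. (\<theta> l)\<^sup>2 * csq \<sigma> d l)) (Zset u)"
    "((\<lambda>l. (\<theta> l)\<^sup>2) has_sum (\<Sum>l\<in>J. (\<theta> l)\<^sup>2)) (Zset u)"
    using J by (auto intro!: has_sum_finite_neutralI)
  then show ?thesis unfolding Theta_block_def
    using assms(4,5) by (auto simp: infsumI intro: has_sum_imp_summable)
qed

lemma Theta_block_cong:
  assumes "\<And>l. l \<in> Zset u \<Longrightarrow> \<theta> l = \<theta>' l"
  shows "\<theta> \<in> Theta_block \<sigma> d u r \<longleftrightarrow> \<theta>' \<in> Theta_block \<sigma> d u r"
proof -
  have "(\<lambda>l. (\<theta> l)\<^sup>2 * csq \<sigma> d l) summable_on Zset u \<longleftrightarrow> (\<lambda>l. (\<theta>' l)\<^sup>2 * csq \<sigma> d l) summable_on Zset u"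
    "(\<lambda>l. (\<theta> l)\<^sup>2) summable_on Zset u \<longleftrightarrow> (\<lambda>l. (\<theta>' l)\<^sup>2) summable_on Zset u"
    "(\<Sum>\<^sub>\<infinity>l\<in>Zset u. (\<theta> l)\<^sup>2 * csq \<sigma> d l) = (\<Sum>\<^sub>\<infinity>l\<in>Zset u. (\<theta>' l)\<^sup>2 * csq \<sigma> d l)"
    "(\<Sum>\<^sub>\<infinity>l\<in>Zset u. (\<theta> l)\<^sup>2) = (\<Sum>\<^sub>\<infinity>l\<in>Zset u. (\<theta>' l)\<^sup>2)"
    by (intro summable_on_cong infsum_cong; simp add: assms)+
  then show ?thesis by (simp add: Theta_block_def)
qed

text \<open>The sum over sign vectors of a product factorises into sums over single signs, each a
  \<open>cosh\<close>. Signs outside \<open>K\<close> contribute a factor 2 each; averaging over all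
  of \<open>J\<close> lets the same sign vectors serve every active set.\<close>

lemma sign_average:
  fixes m x :: "'l \<Rightarrow> real"
  assumes J: "finite J" "K \<subseteq> J"
  shows "(\<Sum>s\<in>PiE J (\<lambda>_. {-1, 1}). \<Prod>l\<in>K. exp (s l * m l * x l / e\<^sup>2 - (m l)\<^sup>2 / (2 * e\<^sup>2)))
    = 2 ^ card J * (\<Prod>l\<in>K. lr1 e (m l) (x l))"
proof -
  define f where "f l y = (if l \<in> K then exp (y * m l * x l / e\<^sup>2 - (m l)\<^sup>2 / (2 * e\<^sup>2)) else 1)" for l and y :: real
  have "(\<Sum>s\<in>PiE J (\<lambda>_. {-1, 1}). \<Prod>l\<in>J. f l (s l)) = (\<Prod>l\<in>J. \<Sum>y\<in>{-1, 1}. f l y)"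
    using J by (intro prod_sum_PiE[symmetric]) auto
  also have "\<dots> = (\<Prod>l\<in>J. 2 * (if l \<in> K then lr1 e (m l) (x l) else 1))"
    by (intro prod.cong) (auto simp: f_def lr1_def cosh_field_def exp_diff exp_minus field_simps)
  also have "\<dots> = 2 ^ card J * (\<Prod>l\<in>K. lr1 e (m l) (x l))"
    using J by (simp add: prod.distrib prod.If_cases Int_absorb1)
  also have "(\<lambda>s. \<Prod>l\<in>J. f l (s l)) = (\<lambda>s. \<Prod>l\<in>K. exp (s l * m l * x l / e\<^sup>2 - (m l)\<^sup>2 / (2 * e\<^sup>2)))"
    using J by (simp add: f_def prod.If_cases Int_absorb1)
  finally show ?thesis .
qed

lemma normal_shift_density:
  assumes "e > 0"
  shows "density lborel (normal_density \<mu> e) 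
    = density (density lborel (normal_density 0 e)) (\<lambda>x. ennreal (exp (\<mu> * x / e\<^sup>2 - \<mu>\<^sup>2 / (2 * e\<^sup>2))))"
proof -
  have "normal_density \<mu> e x = normal_density 0 e x * exp (\<mu> * x / e\<^sup>2 - \<mu>\<^sup>2 / (2 * e\<^sup>2))" for x
  proof -
    have "- (x - \<mu>)\<^sup>2 / (2 * e\<^sup>2) = - x\<^sup>2 / (2 * e\<^sup>2) + (\<mu> * x / e\<^sup>2 - \<mu>\<^sup>2 / (2 * e\<^sup>2))"
      using assms by (simp add: field_simps power2_eq_square)
    then have "exp (- (x - \<mu>)\<^sup>2 / (2 * e\<^sup>2)) = exp (- x\<^sup>2 / (2 * e\<^sup>2)) * exp (\<mu> * x / e\<^sup>2 - \<mu>\<^sup>2 / (2 * e\<^sup>2))"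
      by (simp only: exp_add)
    then show ?thesis by (simp add: normal_density_def)
  qed
  then show ?thesis by (subst density_density_eq) (auto simp: ennreal_mult)
qed

text \<open>Weighting by the ratios of the blocks in \<open>S\<close> makes those blocks follow the
  alternative law with density \<open>Y\<close> and leaves the others under the null law, all
  independent. The two existential events concern disjoint groups of blocks, so their probabilities
  multiply, and each complement is a product over its blocks.\<close>

lemma selection_mass:
  fixes M :: "'i \<Rightarrow> 'a measure" and \<psi> :: "'u \<Rightarrow> 'l \<Rightarrow> 'i" and Y :: "('l \<Rightarrow> 'a) \<Rightarrow> real"
  assumes M: "\<And>i. prob_space (M i)" and U: "finite U" and S: "S \<subseteq> U" "card S = p"
    and \<psi>: "\<And>u l. u \<in> U \<Longrightarrow> l \<in> F \<Longrightarrow> \<psi> u l \<in> I" "inj_on (\<lambda>(u, l). \<psi> u l) (U \<times> F)"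
    and N: "\<And>u l. u \<in> U \<Longrightarrow> l \<in> F \<Longrightarrow> M (\<psi> u l) = N" "prob_space N"
    and Y: "integrable (PiM F (\<lambda>_. N)) Y" "integral\<^sup>L (PiM F (\<lambda>_. N)) Y = 1"
  defines "W \<equiv> \<lambda>u x. Y (\<lambda>l\<in>F. x (\<psi> u l))"
  shows "integrable (PiM I M) (\<lambda>x. \<Prod>u\<in>S. W u x)"
    "integrable (PiM I M) (\<lambda>x. (\<Prod>u\<in>S. W u x) * of_bool ((\<exists>v\<in>U - S. t \<le> W v x) \<and> (\<exists>u\<in>S. W u x \<le> t)))"
    "(\<integral>x. (\<Prod>u\<in>S. W u x) * of_bool ((\<exists>v\<in>U - S. t \<le> W v x) \<and> (\<exists>u\<in>S. W u x \<le> t)) \<partial>PiM I M)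
      = (1 - (1 - measure (PiM F (\<lambda>_. N)) {y\<in>space (PiM F (\<lambda>_. N)). t \<le> Y y}) ^ (card U - p))
      * (1 - (1 - (\<integral>y. Y y * indicator {..t} (Y y) \<partial>PiM F (\<lambda>_. N))) ^ p)"
proof -
  define B where "B = PiM F (\<lambda>_. N)"
  interpret B: prob_space B unfolding B_def by (intro prob_space_PiM N)
  have [measurable]: "Y \<in> borel_measurable B" using Y(1) by (simp add: B_def borel_measurable_integrable)
  define P0 where "P0 = measure B {y\<in>space B. t \<le> Y y}"
  define P1 where "P1 = (\<integral>y. Y y * indicator {..t} (Y y) \<partial>B)"
  have iA: "integrable B (\<lambda>y. indicator {..<t} (Y y) :: real)"
    by (rule B.integrable_const_bound[of _ 1]) (auto simp: indicator_def)
  have vA: "(\<integral>y. indicator {..<t} (Y y) \<partial>B) = 1 - P0"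
  proof -
    have "(\<integral>y. indicator {..<t} (Y y) \<partial>B) = (\<integral>y. indicator {y\<in>space B. Y y < t} y \<partial>B)"
      by (intro Bochner_Integration.integral_cong) (auto simp: indicator_def)
    also have "\<dots> = measure B (space B - {y\<in>space B. t \<le> Y y})"
    proof -
      have "space B - {y\<in>space B. t \<le> Y y} = {y\<in>space B. Y y < t}" by auto
      moreover have "{y\<in>space B. Y y < t} \<inter> space B = {y\<in>space B. Y y < t}" by auto
      ultimately show ?thesis by simp
    qed
    finally show ?thesis by (simp add: B.prob_compl P0_def)
  qed
  have iind: "integrable B (\<lambda>y. Y y * indicator A (Y y))" if "A \<in> sets borel" for A
    using integrable_real_mult_indicator[OF _ Y(1)[folded B_def], of "{y\<in>space B. Y y \<in> A}"] that
    by (auto simp: indicator_def mult.commute cong: Bochner_Integration.integrable_cong)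
  have vB: "(\<integral>y. Y y * indicator {t<..} (Y y) \<partial>B) = 1 - P1"
  proof -
    have "(\<integral>y. Y y * indicator {t<..} (Y y) \<partial>B) = (\<integral>y. Y y - Y y * indicator {..t} (Y y) \<partial>B)"
      by (intro Bochner_Integration.integral_cong) (auto simp: indicator_def)
    also have "\<dots> = 1 - P1" unfolding P1_def using Y iind[of "{..t}"]
      by (subst Bochner_Integration.integral_diff) (auto simp: B_def)
    finally show ?thesis .
  qed
  \<comment> \<open>The flags switch on the complementary events: \<open>a\<close> says that no
    inactive block reaches \<open>t\<close>, \<open>b\<close> that every active block exceeds
    \<open>t\<close>. The four products give the required event by inclusion and exclusion.\<close>
  define h where "h a b u y = (if u \<in> S then (if b then Y y * indicator {t<..} (Y y) else Y y)
      else (if a then indicator {..<t} (Y y) else 1))" for a b u y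
  have ih: "integrable B (h a b u)" for a b u
    using Y(1)[folded B_def] iA iind unfolding h_def by (cases "u \<in> S"; cases a; cases b) simp_all
  define R where "R u x = (\<lambda>l\<in>F. x (\<psi> u l))" for u and x :: "'i \<Rightarrow> 'a"
  define G where "G a b x = (\<Prod>u\<in>U. h a b u (R u x))" for a b x
  have G: "integrable (PiM I M) (G a b)" 
    "integral\<^sup>L (PiM I M) (G a b) = (if a then 1 - P0 else 1) ^ (card U - p) * (if b then 1 - P1 else 1) ^ p" for a b
  proof -
    have ih': "integrable (PiM F (\<lambda>_. N)) (h a b u)" if "u \<in> U" for u using ih by (simp add: B_def)
    note * = PiM_block_expectation[where M=M and \<psi>=\<psi> and h="h a b", OF M U \<psi> N(1) ih']
    show "integrable (PiM I M) (G a b)" unfolding G_def R_def by (rule *(1))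
    have "integral\<^sup>L (PiM I M) (G a b) = (\<Prod>u\<in>U. integral\<^sup>L B (h a b u))"
      unfolding G_def R_def B_def by (rule *(2))
    also have "\<dots> = (\<Prod>u\<in>U. if u \<in> S then (if b then 1 - P1 else 1) else (if a then 1 - P0 else 1))"
      using Y(2) vA vB by (intro prod.cong) (auto simp: h_def[abs_def] B_def[symmetric] B.prob_space)
    also have "\<dots> = (if a then 1 - P0 else 1) ^ (card U - p) * (if b then 1 - P1 else 1) ^ p"
    proof -
      have "U \<inter> - {x. x \<in> S} = U - S" "card (U - S) = card U - p"
        using S U by (auto simp: card_Diff_subset finite_subset)
      then show ?thesis using U S by (simp add: prod.If_cases Int_absorb1)
    qed
    finally show "integral\<^sup>L (PiM I M) (G a b) = (if a then 1 - P0 else 1) ^ (card U - p) * (if b then 1 - P1 else 1) ^ p" .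
  qed
  have Gx: "G a b x = (\<Prod>u\<in>S. W u x) * (if a then of_bool (\<forall>v\<in>U - S. W v x < t) else 1)
      * (if b then of_bool (\<forall>u\<in>S. W u x > t) else 1)" for a b x
  proof -
    have fS: "finite S" "finite (U - S)" using S U finite_subset by auto
    have ind: "(\<Prod>u\<in>A. indicator C (W u x) :: real) = of_bool (\<forall>u\<in>A. W u x \<in> C)" if "finite A" for A C
      using that by (induction A rule: finite_induct) (auto simp: indicator_def)
    have "G a b x = (\<Prod>u\<in>S. h a b u (R u x)) * (\<Prod>u\<in>U - S. h a b u (R u x))"
      unfolding G_def using prod.subset_diff[OF S(1) U] by (simp add: mult.commute)
    also have "(\<Prod>u\<in>S. h a b u (R u x)) = (\<Prod>u\<in>S. W u x) * (if b then of_bool (\<forall>u\<in>S. W u x > t) else 1)"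
      using ind[OF fS(1), of "{t<..}"] by (simp add: h_def W_def R_def prod.distrib)
    also have "(\<Prod>u\<in>U - S. h a b u (R u x)) = (if a then of_bool (\<forall>v\<in>U - S. W v x < t) else 1)"
      using ind[OF fS(2), of "{..<t}"] by (simp add: h_def W_def R_def)
    finally show ?thesis by simp
  qed
  have eq: "(\<Prod>u\<in>S. W u x) * of_bool ((\<exists>v\<in>U - S. t \<le> W v x) \<and> (\<exists>u\<in>S. W u x \<le> t))
    = G False False x - G True False x - G False True x + G True True x" for x
  proof -
    have "(\<exists>v\<in>U - S. t \<le> W v x) \<longleftrightarrow> \<not> (\<forall>v\<in>U - S. W v x < t)" "(\<exists>u\<in>S. W u x \<le> t) \<longleftrightarrow> \<not> (\<forall>u\<in>S. W u x > t)"
      by (auto simp: not_less)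
    then show ?thesis unfolding Gx
      by (cases "\<forall>v\<in>U - S. W v x < t"; cases "\<forall>u\<in>S. W u x > t") (simp_all only: of_bool_def if_True if_False simp_thms, simp_all)
  qed
  show "integrable (PiM I M) (\<lambda>x. \<Prod>u\<in>S. W u x)" using G(1)[of False False] unfolding Gx by simp
  show "integrable (PiM I M) (\<lambda>x. (\<Prod>u\<in>S. W u x) * of_bool ((\<exists>v\<in>U - S. t \<le> W v x) \<and> (\<exists>u\<in>S. W u x \<le> t)))"
    unfolding eq using G(1) by simp
  have "(\<integral>x. (\<Prod>u\<in>S. W u x) * of_bool ((\<exists>v\<in>U - S. t \<le> W v x) \<and> (\<exists>u\<in>S. W u x \<le> t)) \<partial>PiM I M)
    = 1 - (1 - P0) ^ (card U - p) - (1 - P1) ^ p + (1 - P0) ^ (card U - p) * (1 - P1) ^ p"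
    unfolding eq using G by simp
  also have "\<dots> = (1 - (1 - P0) ^ (card U - p)) * (1 - (1 - P1) ^ p)" by (simp add: algebra_simps)
  finally show "(\<integral>x. (\<Prod>u\<in>S. W u x) * of_bool ((\<exists>v\<in>U - S. t \<le> W v x) \<and> (\<exists>u\<in>S. W u x \<le> t)) \<partial>PiM I M)
      = (1 - (1 - measure (PiM F (\<lambda>_. N)) {y\<in>space (PiM F (\<lambda>_. N)). t \<le> Y y}) ^ (card U - p))
      * (1 - (1 - (\<integral>y. Y y * indicator {..t} (Y y) \<partial>PiM F (\<lambda>_. N))) ^ p)"
    by (simp add: P0_def P1_def B_def)
qed

section \<open>The lower bound\<close>

lemma Uset_disjoint: "u \<in> Ukd j d \<Longrightarrow> u \<in> Ukd k d \<Longrightarrow> j = k"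
  by (auto simp: Ukd_def)

lemma Lset_cases:
  assumes "l \<in> Lset d s"
  obtains j where "j \<in> {1..s}" "supp_idx l \<in> Ukd j d" "l \<in> Zset (supp_idx l)"
  using assms supp_idx_Zset unfolding Lset_def Uset_def by blast

text \<open>A Bayes argument in contrapositive form: if every sign vector and active set had risk
  below \<open>c\<close>, so would their average. But averaging the signs gives the weights
  \<open>q S\<close>, whose error event has mass \<open>2 * c\<close> for each \<open>S\<close>, and
  \<open>wrong_subset_weight\<close> forces a loss of half of it whatever set is selected. Levels
  other than \<open>k\<close> are frozen.\<close>

lemma risk_lower_bound:
  fixes \<epsilon> \<sigma> t :: real and r :: "nat \<Rightarrow> real" and e :: "(nat \<Rightarrow> int) \<Rightarrow> real"
  assumes \<epsilon>: "\<epsilon> > 0" and sd: "s \<le> d" and k: "k \<in> {1..s}"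
    and p: "\<And>j. j \<in> {1..s} \<Longrightarrow> p j \<le> d choose j"
    and ne: "Theta_total \<sigma> d s r \<noteq> {}"
    and F: "finite F" "F \<subseteq> Zset {1..k}" and e: "\<And>l. e l \<ge> 0"
      "(\<Sum>l\<in>F. e l) \<ge> (r k)\<^sup>2" "(\<Sum>l\<in>F. csq \<sigma> d l * e l) \<le> 1"
    and sel: "sel \<in> selectors d s"
  defines "B \<equiv> PiM F (\<lambda>_. density lborel (normal_density 0 \<epsilon>))"
    and "Y \<equiv> \<lambda>y. \<Prod>l\<in>F. lr1 \<epsilon> (sqrt (e l)) (y l)"
  defines "c \<equiv> (1 - (1 - measure B {y\<in>space B. t \<le> Y y}) ^ ((d choose k) - p k)) *
      (1 - (1 - (\<integral>y. Y y * indicator {..t} (Y y) \<partial>B)) ^ p k) / 2"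
  shows "\<exists>\<eta>\<in>Hset d s p. \<exists>\<theta>\<in>Theta_total \<sigma> d s r. risk \<epsilon> d s sel \<theta> \<eta> \<ge> c"
proof (rule ccontr)
  assume "\<not> ?thesis"
  then have small: "risk \<epsilon> d s sel \<theta> \<eta> < c" if "\<eta> \<in> Hset d s p" "\<theta> \<in> Theta_total \<sigma> d s r" for \<eta> \<theta>
    using that by (auto simp: not_le)
  define U where "U = Ukd k d"
  have U: "finite U" "card U = d choose k" by (simp_all add: U_def Ukd_finite card_Ukd)
  define \<S> where "\<S> = {S. S \<subseteq> U \<and> card S = p k}"
  have kd: "k \<le> d" using k sd by simp
  have Uu: "finite u" "card u = k" "u \<subseteq> {1..d}" if "u \<in> U" for u
    using that by (auto simp: U_def Ukd_def intro: finite_subset)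
  have \<S>: "finite \<S>" "\<S> \<noteq> {}"
  proof -
    show "finite \<S>" using U by (auto simp: \<S>_def)
    obtain S where "S \<subseteq> U" "card S = p k" using p[OF k] U obtain_subset_with_card_n[of "p k" U] by metis
    then show "\<S> \<noteq> {}" by (auto simp: \<S>_def)
  qed
  obtain \<theta>0 where \<theta>0: "\<theta>0 \<in> Theta_total \<sigma> d s r" using ne by auto
  have "\<exists>D. D \<subseteq> Ukd j d \<and> card D = p j" if "j \<in> {1..s}" for j
    using p[OF that] card_Ukd[of j d] obtain_subset_with_card_n[of "p j" "Ukd j d"] by metis
  then obtain D where D: "D j \<subseteq> Ukd j d" "card (D j) = p j" if "j \<in> {1..s}" for j by metis
  define W where "W = (\<Union>j\<in>{1..s} - {k}. D j)"
  have W: "W \<inter> U = {}" "\<And>j. j \<in> {1..s} \<Longrightarrow> j \<noteq> k \<Longrightarrow> W \<inter> Ukd j d = D j"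
    using D Uset_disjoint unfolding W_def U_def by blast+
  define \<eta> where "\<eta> S u = (of_bool (u \<in> S \<or> u \<in> W) :: real)" for S and u :: "nat set"
  have \<eta>H: "\<eta> S \<in> Hset d s p" if "S \<in> \<S>" for S
  proof -
    have "card {u\<in>Ukd j d. \<eta> S u = 1} = p j" if j: "j \<in> {1..s}" for j
    proof (cases "j = k")
      case True
      then have "{u\<in>Ukd j d. \<eta> S u = 1} = S" using \<open>S \<in> \<S>\<close> W(1) by (auto simp: \<eta>_def \<S>_def U_def)
      then show ?thesis using \<open>S \<in> \<S>\<close> True by (simp add: \<S>_def)
    next
      case False
      then have "S \<inter> Ukd j d = {}" using \<open>S \<in> \<S>\<close> Uset_disjoint by (auto simp: \<S>_def U_def)
      then have "{u\<in>Ukd j d. \<eta> S u = 1} = W \<inter> Ukd j d" by (auto simp: \<eta>_def)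
      then show ?thesis using W(2)[OF j False] D(2)[OF j] by simp
    qed
    then show ?thesis by (auto simp: Hset_def \<eta>_def)
  qed
  define I where "I = Lset d s"
  have rlZ: "relabel u l \<in> Zset u" if "u \<in> U" "l \<in> F" for u l
    using relabel_Zset[of u l] Uu[OF that(1)] that(2) F(2) by auto
  have rlI: "relabel u l \<in> I" if "u \<in> U" "l \<in> F" for u l
    using rlZ[OF that] that(1) k unfolding I_def Lset_def Uset_def U_def by blast
  have supp: "supp_idx (relabel u l) = u" if "u \<in> U" "l \<in> F" for u l
    using rlZ[OF that] by (rule supp_idx_Zset)
  have inj1: "inj_on (relabel u) F" if "u \<in> U" for u
    using inj_on_subset[OF inj_on_relabel[of u]] Uu[OF that] F(2) by simp
  have inj: "inj_on (\<lambda>(u, l). relabel u l) (U \<times> F)"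
  proof (rule inj_onI)
    fix a b assume ab: "a \<in> U \<times> F" "b \<in> U \<times> F" "(case a of (u, l) \<Rightarrow> relabel u l) = (case b of (u, l) \<Rightarrow> relabel u l)"
    obtain u l v l' where [simp]: "a = (u, l)" "b = (v, l')" by (cases a, cases b)
    have eq: "relabel u l = relabel v l'" using ab(3) by simp
    then have "u = v" using supp[of u l] supp[of v l'] ab(1,2) by simp
    then show "a = b" using eq inj_onD[OF inj1[of u], of l l'] ab(1,2) by simp
  qed
  define Js where "Js S = (\<lambda>(u, l). relabel u l) ` (S \<times> F)" for S
  define J where "J = Js U"
  have J: "finite J" "\<And>S. S \<subseteq> U \<Longrightarrow> Js S \<subseteq> J" "J \<subseteq> I"
    using U F rlI by (auto simp: J_def Js_def)
  \<comment> \<open>The support of \<open>l\<close> identifies its block, so the copying map can be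
    inverted block by block to recover the modulus; off the copied positions it is 0.\<close>
  define \<mu> where "\<mu> l = (if l \<in> J then sqrt (e (inv_into F (relabel (supp_idx l)) l)) else 0)" for l
  have \<mu>: "\<mu> (relabel u l) = sqrt (e l)" if "u \<in> U" "l \<in> F" for u l
  proof -
    have "relabel u l \<in> J" using that by (auto simp: J_def Js_def)
    then show ?thesis using inj1[OF that(1)] that by (simp add: \<mu>_def supp)
  qed
  define \<theta> where "\<theta> \<omega> l = (if supp_idx l \<in> U then (if l \<in> J then \<omega> l * \<mu> l else 0) else \<theta>0 l)"
    for \<omega> :: "(nat \<Rightarrow> int) \<Rightarrow> real" and l
  define \<Omega> where "\<Omega> = PiE J (\<lambda>_. {- 1, 1 :: real})"
  have \<Omega>: "finite \<Omega>" "card \<Omega> = 2 ^ card J" "\<Omega> \<noteq> {}"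
    using J(1) by (auto simp: \<Omega>_def card_PiE numeral_2_eq_2 PiE_eq_empty_iff intro: finite_PiE)
  have \<omega>2: "(\<omega> l)\<^sup>2 = 1" if "\<omega> \<in> \<Omega>" "l \<in> J" for \<omega> l
    using PiE_mem[OF that[unfolded \<Omega>_def]] by auto
  have \<theta>T: "\<theta> \<omega> \<in> Theta_total \<sigma> d s r" if \<omega>: "\<omega> \<in> \<Omega>" for \<omega>
    unfolding Theta_total_def
  proof (intro CollectI ballI)
    fix j u assume j: "j \<in> {1..s}" and u: "u \<in> Ukd j d"
    show "\<theta> \<omega> \<in> Theta_block \<sigma> d u (r j)"
    proof (cases "j = k")
      case False
      then have "u \<notin> U" using u Uset_disjoint by (auto simp: U_def)
      then have "\<theta> \<omega> l = \<theta>0 l" if "l \<in> Zset u" for l using that by (simp add: \<theta>_def supp_idx_Zset)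
      then show ?thesis using \<theta>0 j u Theta_block_cong[of u "\<theta> \<omega>" \<theta>0] by (simp add: Theta_total_def)
    next
      case True
      then have uU: "u \<in> U" using u by (simp add: U_def)
      have sq: "(\<theta> \<omega> (relabel u l))\<^sup>2 = e l" if "l \<in> F" for l
      proof -
        have "relabel u l \<in> J" using that uU by (auto simp: J_def Js_def)
        then show ?thesis using \<omega>2[OF \<omega>] \<mu>[OF uU that] e(1)[of l]
          by (simp add: \<theta>_def supp[OF uU that] uU power_mult_distrib)
      qed
      show ?thesis
      proof (rule Theta_block_finite)
        show "finite (relabel u ` F)" using F by simp
        show "relabel u ` F \<subseteq> Zset u" using rlZ[OF uU] by auto
        show "\<theta> \<omega> l = 0" if "l \<in> Zset u - relabel u ` F" for l
        proof -
          have sl: "supp_idx l = u" using that by (simp add: supp_idx_Zset)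
          have "l \<notin> J"
          proof
            assume "l \<in> J"
            then obtain v l' where "v \<in> U" "l' \<in> F" "l = relabel v l'" by (auto simp: J_def Js_def)
            then show False using supp[of v l'] sl that by auto
          qed
          then show ?thesis by (simp add: \<theta>_def sl uU)
        qed
        have "(\<Sum>l\<in>relabel u ` F. (\<theta> \<omega> l)\<^sup>2 * csq \<sigma> d l) = (\<Sum>l\<in>F. (\<theta> \<omega> (relabel u l))\<^sup>2 * csq \<sigma> d (relabel u l))"
          by (simp add: sum.reindex[OF inj1[OF uU]])
        also have "\<dots> = (\<Sum>l\<in>F. csq \<sigma> d l * e l)"
          using F(2) uU kd by (intro sum.cong refl) (simp add: sq csq_relabel U_def subset_iff)
        finally show "(\<Sum>l\<in>relabel u ` F. (\<theta> \<omega> l)\<^sup>2 * csq \<sigma> d l) \<le> 1" using e(3) by simp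
        have "(\<Sum>l\<in>relabel u ` F. (\<theta> \<omega> l)\<^sup>2) = (\<Sum>l\<in>F. e l)"
          by (simp add: sum.reindex[OF inj1[OF uU]] sq)
        then show "(r j)\<^sup>2 \<le> (\<Sum>l\<in>relabel u ` F. (\<theta> \<omega> l)\<^sup>2)" using e(2) True by simp
      qed
    qed
  qed
  define N where "N = density lborel (normal_density 0 \<epsilon>)"
  define M where "M l = density lborel (normal_density (of_bool (supp_idx l \<in> W) * \<theta>0 l) \<epsilon>)" for l
  have Mp: "prob_space (M l)" for l unfolding M_def using \<epsilon> by (rule prob_space_normal_density)
  have Np: "prob_space N" unfolding N_def using \<epsilon> by (rule prob_space_normal_density)
  interpret MM: product_prob_space M I by (intro product_prob_spaceI Mp)
  have MN: "M (relabel u l) = N" if "u \<in> U" "l \<in> F" for u l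
    using W(1) that by (auto simp: M_def N_def supp[OF that])
  define Q where "Q = PiM I M"
  interpret Q: prob_space Q unfolding Q_def by (rule prob_space_PiM) (rule Mp)
  have setsQ: "sets Q = sets (PiM I (\<lambda>_. borel))"
    unfolding Q_def by (intro sets_PiM_cong) (simp_all add: M_def)
  have fac: "density N (\<lambda>x. ennreal (exp (m * x / \<epsilon>\<^sup>2 - m\<^sup>2 / (2 * \<epsilon>\<^sup>2)))) = density lborel (normal_density m \<epsilon>)" for m
    unfolding N_def by (rule normal_shift_density[OF \<epsilon>, symmetric])
  \<comment> \<open>Density of the observations with respect to \<open>Q\<close>. The quadratic term
    is free of signs because they square to 1, so averaging acts on the linear exponent only and
    produces \<open>lr1\<close>.\<close>
  define g where "g \<omega> S x = (\<Prod>l\<in>Js S. exp (\<omega> l * \<mu> l * x l / \<epsilon>\<^sup>2 - (\<mu> l)\<^sup>2 / (2 * \<epsilon>\<^sup>2)))" for \<omega> S and x :: "(nat \<Rightarrow> int) \<Rightarrow> real"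
  have JsU: "finite (Js S)" "Js S \<subseteq> I" if "S \<subseteq> U" for S using J that finite_subset by blast+
  have g_meas: "g \<omega> S \<in> borel_measurable Q" if "S \<subseteq> U" for \<omega> S
  proof -
    have "(\<lambda>x. x l) \<in> borel_measurable Q" if "l \<in> Js S" for l
      unfolding measurable_cong_sets[OF setsQ refl]
      using JsU(2)[OF \<open>S \<subseteq> U\<close>] that by (intro measurable_component_singleton) auto
    then show ?thesis unfolding g_def by (intro borel_measurable_prod) (auto intro!: borel_measurable_exp[THEN measurable_compose] borel_measurable_diff borel_measurable_divide borel_measurable_times)
  qed
  have g_pos: "g \<omega> S x \<ge> 0" for \<omega> S x unfolding g_def by (intro prod_nonneg) auto
  have obs: "obs_measure \<epsilon> d s (\<theta> \<omega>) (\<eta> S) = density Q (\<lambda>x. ennreal (g \<omega> S x))" if S: "S \<in> \<S>" and \<omega>: "\<omega> \<in> \<Omega>" for S \<omega>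
  proof -
    have SU: "S \<subseteq> U" using S by (simp add: \<S>_def)
    define f where "f l x = ennreal (exp (\<omega> l * \<mu> l * x / \<epsilon>\<^sup>2 - (\<mu> l)\<^sup>2 / (2 * \<epsilon>\<^sup>2)))" for l x
    have dens: "density (M l) (f l) = density lborel (normal_density (\<omega> l * \<mu> l) \<epsilon>)" if l: "l \<in> Js S" for l
    proof -
      have MlN: "M l = N" using l SU MN by (auto simp: Js_def)
      have "l \<in> J" using l J(2)[OF SU] by auto
      then have "(\<omega> l * \<mu> l)\<^sup>2 = (\<mu> l)\<^sup>2" using \<omega>2[OF \<omega>] by (simp add: power_mult_distrib)
      then show "density (M l) (f l) = density lborel (normal_density (\<omega> l * \<mu> l) \<epsilon>)"
        unfolding MlN fac[symmetric] f_def by simp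
    qed
    have "obs_measure \<epsilon> d s (\<theta> \<omega>) (\<eta> S) = PiM I (\<lambda>l. if l \<in> Js S then density (M l) (f l) else M l)"
      unfolding obs_measure_def I_def[symmetric]
    proof (rule PiM_cong[OF refl])
      fix l assume l: "l \<in> I"
      then obtain j where j: "j \<in> {1..s}" "supp_idx l \<in> Ukd j d" "l \<in> Zset (supp_idx l)"
        unfolding I_def by (rule Lset_cases)
      show "density lborel (normal_density (\<eta> S (supp_idx l) * \<theta> \<omega> l) \<epsilon>) = (if l \<in> Js S then density (M l) (f l) else M l)"
      proof (cases "l \<in> Js S")
        case True
        then obtain u l' where u: "u \<in> S" "l' \<in> F" "l = relabel u l'" by (auto simp: Js_def)
        then have "supp_idx l = u" "u \<in> U" using supp SU by auto
        moreover have "l \<in> J" using True J(2)[OF SU] by auto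
        ultimately have "\<eta> S (supp_idx l) * \<theta> \<omega> l = \<omega> l * \<mu> l" using u(1) by (simp add: \<eta>_def \<theta>_def)
        then show ?thesis using True dens[OF True] by simp
      next
        case False
        have "\<eta> S (supp_idx l) * \<theta> \<omega> l = of_bool (supp_idx l \<in> W) * \<theta>0 l"
        proof (cases "supp_idx l \<in> U")
          case uU: True
          then have w: "supp_idx l \<notin> W" using W(1) by auto
          show ?thesis
          proof (cases "supp_idx l \<in> S \<and> l \<in> J")
            case True
            then obtain v l' where "v \<in> U" "l' \<in> F" "l = relabel v l'" by (auto simp: J_def Js_def)
            then have "l \<in> Js S" using True supp[of v l'] by (auto simp: Js_def)
            then show ?thesis using False by simp
          qed (use w uU in \<open>auto simp: \<eta>_def \<theta>_def\<close>)
        next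
          case nU: False
          then show ?thesis using SU by (auto simp: \<eta>_def \<theta>_def)
        qed
        then show ?thesis using False by (simp add: M_def)
      qed
    qed
    also have "\<dots> = density Q (\<lambda>x. \<Prod>l\<in>Js S. f l (x l))"
      unfolding Q_def
    proof (rule PiM_density_finite[OF Mp JsU[OF SU]])
      fix l assume l: "l \<in> Js S"
      show "f l \<in> borel_measurable (M l)" unfolding f_def M_def by measurable
      show "prob_space (density (M l) (f l))" unfolding dens[OF l] using \<epsilon> by (rule prob_space_normal_density)
    qed
    also have "(\<lambda>x. \<Prod>l\<in>Js S. f l (x l)) = (\<lambda>x. ennreal (g \<omega> S x))"
      unfolding f_def g_def by (simp add: prod_ennreal)
    finally show ?thesis .
  qed
  define V where "V u x = Y (\<lambda>l\<in>F. x (relabel u l))" for u and x :: "(nat \<Rightarrow> int) \<Rightarrow> real"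
  have Vx: "V u x = (\<Prod>l\<in>F. lr1 \<epsilon> (\<mu> (relabel u l)) (x (relabel u l)))" if "u \<in> U" for u x
    unfolding V_def Y_def using \<mu>[OF that] by (intro prod.cong) auto
  have V0: "V u x \<ge> 0" for u x unfolding V_def Y_def by (intro prod_nonneg) (simp add: less_imp_le)
  have g_sum: "(\<Sum>\<omega>\<in>\<Omega>. g \<omega> S x) = 2 ^ card J * (\<Prod>u\<in>S. V u x)" if SU: "S \<subseteq> U" for S x
  proof -
    have "(\<Sum>\<omega>\<in>\<Omega>. g \<omega> S x) = 2 ^ card J * (\<Prod>l\<in>Js S. lr1 \<epsilon> (\<mu> l) (x l))"
      unfolding g_def \<Omega>_def by (rule sign_average[OF J(1) J(2)[OF SU]])
    also have "(\<Prod>l\<in>Js S. lr1 \<epsilon> (\<mu> l) (x l)) = (\<Prod>(u, l)\<in>S \<times> F. lr1 \<epsilon> (\<mu> (relabel u l)) (x (relabel u l)))"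
      unfolding Js_def using inj_on_subset[OF inj, of "S \<times> F"] SU
      by (subst prod.reindex) (auto simp: case_prod_unfold)
    also have "\<dots> = (\<Prod>u\<in>S. \<Prod>l\<in>F. lr1 \<epsilon> (\<mu> (relabel u l)) (x (relabel u l)))"
      by (rule prod.cartesian_product[symmetric])
    also have "\<dots> = (\<Prod>u\<in>S. V u x)" using SU Vx by (intro prod.cong) auto
    finally show ?thesis .
  qed
  \<comment> \<open>Only the selected subset of level \<open>k\<close> matters: the Hamming loss is
    at least 1 whenever it differs from \<open>S\<close>.\<close>
  define X where "X x = {u\<in>U. sel u x = 1}" for x
  have selm: "sel u \<in> borel_measurable Q" "\<And>x. sel u x \<in> {0, 1}" if "j \<in> {1..s}" "u \<in> Ukd j d" for u j
  proof -
    have "u \<in> Uset d s" using that by (auto simp: Uset_def)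
    then show "sel u \<in> borel_measurable Q" "\<And>x. sel u x \<in> {0, 1}"
      using sel unfolding selectors_def I_def[symmetric] measurable_cong_sets[OF setsQ refl] by auto
  qed
  have selmU [measurable]: "sel u \<in> borel_measurable Q" if "u \<in> U" for u using selm(1) k that unfolding U_def by blast
  have Xm: "{x\<in>space Q. X x \<noteq> S} \<in> sets Q" if "S \<subseteq> U" for S
  proof -
    have "{x\<in>space Q. X x \<noteq> S} = (\<Union>u\<in>U. {x\<in>space Q. (sel u x = 1) \<noteq> (u \<in> S)})"
      using that by (auto simp: X_def)
    also have "\<dots> \<in> sets Q" using U(1)
    proof (intro sets.finite_UN)
      fix u assume "u \<in> U"
      then have "sel u \<in> borel_measurable Q" by (rule selmU)
      then show "{x\<in>space Q. (sel u x = 1) \<noteq> (u \<in> S)} \<in> sets Q" by measurable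
    qed
    finally show ?thesis .
  qed
  define L where "L S x = (\<Sum>j\<in>{1..s}. \<Sum>u\<in>Ukd j d. \<bar>sel u x - \<eta> S u\<bar>)" for S x
  have Lm: "L S \<in> borel_measurable Q" for S
    unfolding L_def by (intro borel_measurable_sum borel_measurable_abs borel_measurable_diff selm(1)) auto
  have L_ge: "of_bool (X x \<noteq> S) \<le> L S x" if S: "S \<in> \<S>" for S x
  proof (cases "X x = S")
    case True
    then show ?thesis by (simp add: L_def sum_nonneg)
  next
    case False
    have SU: "S \<subseteq> U" using S by (simp add: \<S>_def)
    obtain u where u: "u \<in> U" "(sel u x = 1) \<noteq> (u \<in> S)" using False SU by (auto simp: X_def)
    have w: "u \<notin> W" using u W by auto
    have "1 = \<bar>sel u x - \<eta> S u\<bar>" using u w selm(2)[of k u x] k by (auto simp: \<eta>_def U_def)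
    also have "\<bar>sel u x - \<eta> S u\<bar> \<le> (\<Sum>u\<in>Ukd k d. \<bar>sel u x - \<eta> S u\<bar>)"
      using u by (intro member_le_sum) (auto simp: U_def Ukd_finite)
    also have "\<dots> \<le> L S x" unfolding L_def using k by (intro member_le_sum) (auto intro: sum_nonneg)
    finally show ?thesis using False by simp
  qed
  have L_bd: "\<bar>L S x\<bar> \<le> (\<Sum>j\<in>{1..s}. \<Sum>u\<in>Ukd j d. 1)" for S x
  proof -
    have "0 \<le> L S x" by (simp add: L_def sum_nonneg)
    moreover have "L S x \<le> (\<Sum>j\<in>{1..s}. \<Sum>u\<in>Ukd j d. 1)"
      unfolding L_def
    proof (intro sum_mono)
      fix j u assume "j \<in> {1..s}" "u \<in> Ukd j d"
      from selm(2)[OF this, of x] show "\<bar>sel u x - \<eta> S u\<bar> \<le> 1" by (auto simp: \<eta>_def)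
    qed
    ultimately show ?thesis by simp
  qed
  have risk: "integrable Q (\<lambda>x. g \<omega> S x * of_bool (X x \<noteq> S)) \<and>
      (\<integral>x. g \<omega> S x * of_bool (X x \<noteq> S) \<partial>Q) \<le> risk \<epsilon> d s sel (\<theta> \<omega>) (\<eta> S)" if S: "S \<in> \<S>" and \<omega>: "\<omega> \<in> \<Omega>" for S \<omega>
  proof -
    have SU: "S \<subseteq> U" using S by (simp add: \<S>_def)
    define O' where "O' = density Q (\<lambda>x. ennreal (g \<omega> S x))"
    have "prob_space (obs_measure \<epsilon> d s (\<theta> \<omega>) (\<eta> S))"
      unfolding obs_measure_def using \<epsilon> by (intro prob_space_PiM prob_space_normal_density)
    then interpret O': prob_space O' unfolding O'_def obs[OF S \<omega>] .
    have i1: "integrable O' (L S)"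
      using Lm[of S] L_bd[of S] by (intro O'.integrable_const_bound[of _ "\<Sum>j\<in>{1..s}. \<Sum>u\<in>Ukd j d. 1"]) (auto simp: O'_def)
    have bm: "(\<lambda>x. of_bool (X x \<noteq> S) :: real) \<in> borel_measurable Q"
    proof -
      have "(\<lambda>x. indicator {x\<in>space Q. X x \<noteq> S} x :: real) \<in> borel_measurable Q"
        using Xm[OF SU] by simp
      then show ?thesis by (rule measurable_cong[THEN iffD1, rotated]) (auto simp: indicator_def)
    qed
    have i2: "integrable O' (\<lambda>x. of_bool (X x \<noteq> S) :: real)"
      using bm by (intro O'.integrable_const_bound[of _ 1]) (auto simp: O'_def)
    have "(\<integral>x. of_bool (X x \<noteq> S) \<partial>O') \<le> (\<integral>x. L S x \<partial>O')"
      by (rule integral_mono[OF i2 i1]) (rule L_ge[OF S])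
    also have "\<dots> = risk \<epsilon> d s sel (\<theta> \<omega>) (\<eta> S)" unfolding risk_def obs[OF S \<omega>] O'_def L_def by simp
    also have "(\<integral>x. of_bool (X x \<noteq> S) \<partial>O') = (\<integral>x. g \<omega> S x * of_bool (X x \<noteq> S) \<partial>Q)"
      unfolding O'_def using bm g_meas[OF SU] g_pos by (subst integral_density) auto
    moreover have "integrable Q (\<lambda>x. g \<omega> S x * of_bool (X x \<noteq> S))"
      using i2 bm g_meas[OF SU] g_pos unfolding O'_def by (subst (asm) integrable_density) auto
    ultimately show ?thesis by simp
  qed
  define q where "q S x = (\<Prod>u\<in>S. V u x)" for S x
  have avg: "integrable Q (\<lambda>x. q S x * of_bool (X x \<noteq> S)) \<and> (\<integral>x. q S x * of_bool (X x \<noteq> S) \<partial>Q) < c" if S: "S \<in> \<S>" for S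
  proof -
    have SU: "S \<subseteq> U" using S by (simp add: \<S>_def)
    define n where "n = (2::real) ^ card J"
    have n: "n > 0" by (simp add: n_def)
    have eq: "q S x * of_bool (X x \<noteq> S) = (\<Sum>\<omega>\<in>\<Omega>. g \<omega> S x * of_bool (X x \<noteq> S)) / n" for x
      using g_sum[OF SU, of x] n by (simp add: q_def n_def sum_distrib_right[symmetric])
    have "(\<integral>x. (\<Sum>\<omega>\<in>\<Omega>. g \<omega> S x * of_bool (X x \<noteq> S)) / n \<partial>Q) = (\<Sum>\<omega>\<in>\<Omega>. \<integral>x. g \<omega> S x * of_bool (X x \<noteq> S) \<partial>Q) / n"
      using risk[OF S] by (subst integral_divide_zero, subst Bochner_Integration.integral_sum) auto
    also have "\<dots> < (\<Sum>\<omega>\<in>\<Omega>. c) / n"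
    proof (intro divide_strict_right_mono sum_strict_mono \<Omega> n)
      fix \<omega> assume \<omega>: "\<omega> \<in> \<Omega>"
      show "(\<integral>x. g \<omega> S x * of_bool (X x \<noteq> S) \<partial>Q) < c"
        using risk[OF S \<omega>] small[OF \<eta>H[OF S] \<theta>T[OF \<omega>]] by linarith
    qed
    also have "\<dots> = c" using \<Omega>(2) n by (simp add: n_def)
    finally have "(\<integral>x. q S x * of_bool (X x \<noteq> S) \<partial>Q) < c" unfolding eq .
    moreover have "integrable Q (\<lambda>x. q S x * of_bool (X x \<noteq> S))"
      unfolding eq using risk[OF S] by (intro integrable_divide_zero Bochner_Integration.integrable_sum) auto
    ultimately show ?thesis by simp
  qed
  have iY: "integrable (PiM F (\<lambda>_. N)) Y" "integral\<^sup>L (PiM F (\<lambda>_. N)) Y = 1"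
    using lr_product_density(2,3)[OF \<epsilon> F(1), of "\<lambda>l. sqrt (e l)"] unfolding Y_def N_def by simp_all
  define E where "E S x \<longleftrightarrow> (\<exists>v\<in>U - S. t \<le> V v x) \<and> (\<exists>u\<in>S. V u x \<le> t)" for S x
  have mass: "integrable Q (\<lambda>x. q S x * of_bool (E S x)) \<and> (\<integral>x. q S x * of_bool (E S x) \<partial>Q) = 2 * c" if S: "S \<in> \<S>" for S
  proof -
    have SU: "S \<subseteq> U" "card S = p k" using S by (simp_all add: \<S>_def)
    note * = selection_mass(2,3)[where M=M and I=I and \<psi>=relabel and t=t, OF Mp U(1) SU rlI inj MN Np iY, folded V_def, folded E_def q_def, folded Q_def]
    show ?thesis using *(1) *(2) unfolding c_def U(2) B_def N_def by simp
  qed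
  \<comment> \<open>The posterior comparison is pointwise in \<open>x\<close>, with
    \<open>X x\<close> as the selected set. Integrated and summed over \<open>S\<close>, it gives a
    bound that contradicts the strict inequality \<open>avg\<close>.\<close>
  have "(\<Sum>S\<in>\<S>. 2 * c) / 2 = (\<integral>x. (\<Sum>S\<in>\<S>. q S x * of_bool (E S x)) / 2 \<partial>Q)"
    using mass by (subst integral_divide_zero, subst Bochner_Integration.integral_sum) auto
  also have "\<dots> \<le> (\<integral>x. (\<Sum>S\<in>\<S>. q S x * of_bool (X x \<noteq> S)) \<partial>Q)"
  proof (rule integral_mono)
    show "integrable Q (\<lambda>x. (\<Sum>S\<in>\<S>. q S x * of_bool (E S x)) / 2)"
      using mass by (intro integrable_divide_zero Bochner_Integration.integrable_sum) auto
    show "integrable Q (\<lambda>x. \<Sum>S\<in>\<S>. q S x * of_bool (X x \<noteq> S))"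
      using avg by (intro Bochner_Integration.integrable_sum) auto
    show "(\<Sum>S\<in>\<S>. q S x * of_bool (E S x)) / 2 \<le> (\<Sum>S\<in>\<S>. q S x * of_bool (X x \<noteq> S))" for x
      unfolding q_def E_def \<S>_def by (rule wrong_subset_weight[OF U(1) V0])
  qed
  also have "\<dots> = (\<Sum>S\<in>\<S>. \<integral>x. q S x * of_bool (X x \<noteq> S) \<partial>Q)"
    using avg by (subst Bochner_Integration.integral_sum) auto
  also have "\<dots> < (\<Sum>S\<in>\<S>. c)" using avg by (intro sum_strict_mono \<S>) auto
  finally show False by simp
qed

section \<open>From tail exponents to an asymptotic risk bound\<close>

lemma one_minus_power_le_exp:
  fixes x :: real
  assumes "0 \<le> x" "x \<le> 1" "real n * x \<ge> 1"
  shows "(1 - x) ^ n \<le> exp (- 1)"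
proof -
  have "(1 - x) ^ n \<le> exp (- x) ^ n" using assms exp_ge_add_one_self[of "- x"] by (intro power_mono) auto
  also have "\<dots> = exp (- (real n * x))" by (simp add: exp_of_nat_mult[symmetric])
  also have "\<dots> \<le> exp (- 1)" using assms by simp
  finally show ?thesis .
qed

lemma binomial_at_top:
  assumes "filterlim d at_top F" "1 \<le> k"
  shows "filterlim (\<lambda>x. real (d x choose k)) at_top F"
  unfolding filterlim_at_top
proof
  fix Z :: real
  define n where "n = max k (nat \<lceil>Z * real k\<rceil>)"
  have "eventually (\<lambda>x. n \<le> d x) F" using assms(1) by (simp add: filterlim_at_top)
  then show "eventually (\<lambda>x. Z \<le> real (d x choose k)) F"
  proof eventually_elim
    case (elim x)
    then have kd: "k \<le> d x" "Z * real k \<le> real (d x)" unfolding n_def by linarith+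
    have 1: "1 \<le> real (d x) / real k" using kd assms by simp
    have "Z \<le> real (d x) / real k" using kd assms by (simp add: field_simps)
    also have "\<dots> \<le> (real (d x) / real k) ^ k" using 1 assms by (intro self_le_power) auto
    also have "\<dots> \<le> real (d x choose k)" using binomial_ge_n_over_k_pow_k[of k "d x"] kd by simp
    finally show ?case .
  qed
qed

text \<open>The level attaining the minimum may change with \<open>\<epsilon>\<close>. The
  comparison with \<open>\<rho>\<close> is therefore a premise inside the \<open>eventually\<close>,
  for each fixed \<open>k\<close>, and the finitely many levels can be combined afterwards.\<close>

lemma minimax_risk_lower_bound:
  fixes \<beta> \<sigma> \<rho> :: real and d :: "real \<Rightarrow> nat" and r :: "real \<Rightarrow> nat \<Rightarrow> real" and p :: "real \<Rightarrow> nat \<Rightarrow> nat"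
  assumes k: "k \<in> {1..s}"
    and beta: "0 < \<beta>" "\<beta> < 1"
    and sigma: "0 < \<sigma>"
    and \<rho>: "0 < \<rho>" "\<rho> < sqrt 2 * (1 + sqrt (1 - \<beta>))"
    and d_infty: "filterlim d at_top (at_right 0)"
    and log_binom: "(\<lambda>\<epsilon>. ln (real (d \<epsilon> choose s))) \<in> o[at_right 0](\<lambda>\<epsilon>. ln (1 / \<epsilon>))"
    and p_asymp: "\<And>k. k \<in> {1..s} \<Longrightarrow>
        ((\<lambda>\<epsilon>. real (p \<epsilon> k) / real (d \<epsilon> choose k) powr (1 - \<beta>)) \<longlongrightarrow> 1) (at_right 0)"
    and Theta_nonempty: "eventually (\<lambda>\<epsilon>. Theta_total \<sigma> (d \<epsilon>) s (r \<epsilon>) \<noteq> {}) (at_right 0)"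
  shows "eventually (\<lambda>\<epsilon>. a_eps \<epsilon> \<sigma> (d \<epsilon>) {1..k} (r \<epsilon> k) / sqrt (ln (real (d \<epsilon> choose k))) < \<rho> \<longrightarrow>
    ereal ((1 - exp (- 1))\<^sup>2 / 2) \<le> minimax_risk \<epsilon> \<sigma> (d \<epsilon>) s (p \<epsilon>) (r \<epsilon>)) (at_right 0)"
proof -
  define b where "b = sqrt (1 - \<beta>)"
  have b: "0 < b" "b < 1" "b\<^sup>2 = 1 - \<beta>" using beta by (auto simp: b_def)
  \<comment> \<open>this tilt exhausts the budgets \<open>ln N\<close> and \<open>(1 - \<beta>) * ln N\<close> simultaneously at the threshold\<close>
  define a where "a = 1 / (1 + b)"
  have a: "0 < a" "a < 1" using b by (auto simp: a_def)
  have \<rho>2: "\<rho>\<^sup>2 < 2 * (1 + b)\<^sup>2"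
  proof -
    have "\<rho>\<^sup>2 < (sqrt 2 * (1 + b))\<^sup>2" using \<rho> by (intro power_strict_mono) (auto simp: b_def)
    then show ?thesis by (simp add: power_mult_distrib)
  qed
  have a1: "a\<^sup>2 * \<rho>\<^sup>2 / 2 < 1" using \<rho>2 b by (simp add: a_def power_divide field_simps)
  have "1 - a = b / (1 + b)" using b by (simp add: a_def field_simps)
  then have "(1 - a)\<^sup>2 * \<rho>\<^sup>2 / 2 = b\<^sup>2 * (\<rho>\<^sup>2 / (2 * (1 + b)\<^sup>2))" by (simp add: power_divide)
  also have "\<dots> < b\<^sup>2 * 1" using \<rho>2 b(1) by (intro mult_strict_left_mono) (simp_all add: divide_less_eq_1)
  finally have a2: "(1 - a)\<^sup>2 * \<rho>\<^sup>2 / 2 < 1 - \<beta>" using b by simp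
  \<comment> \<open>The ratio \<open>A / T\<close> after the losses of
    \<open>flat_block_element\<close>. The added \<open>3 * \<delta>\<close> below is
    \<open>2 * \<delta>\<close> from the tail estimate and one \<open>\<delta>\<close> to outweigh
    numerical constants.\<close>
  define R where "R \<delta> = (1 + \<delta>) * (\<rho>\<^sup>2 + \<delta>) + \<delta>" for \<delta> :: real
  have "((\<lambda>\<delta>. a\<^sup>2 * R \<delta> / 2 + 3 * \<delta>) \<longlongrightarrow> a\<^sup>2 * R 0 / 2 + 3 * 0) (at_right 0)"
    "((\<lambda>\<delta>. (1 - a)\<^sup>2 * R \<delta> / 2 + 3 * \<delta>) \<longlongrightarrow> (1 - a)\<^sup>2 * R 0 / 2 + 3 * 0) (at_right 0)"
    unfolding R_def by (intro tendsto_intros; simp)+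
  then have "eventually (\<lambda>\<delta>. a\<^sup>2 * R \<delta> / 2 + 3 * \<delta> < 1 \<and> (1 - a)\<^sup>2 * R \<delta> / 2 + 3 * \<delta> < 1 - \<beta> \<and> \<delta> > 0) (at_right 0)"
    using a1 a2 by (intro eventually_conj) (auto simp: R_def eventually_at_right_less elim!: order_tendstoD(2))
  then obtain \<delta> where \<delta>: "\<delta> > 0" "a\<^sup>2 * R \<delta> / 2 + 3 * \<delta> < 1" "(1 - a)\<^sup>2 * R \<delta> / 2 + 3 * \<delta> < 1 - \<beta>"
    using eventually_happens'[of "at_right (0::real)"] by (auto simp: trivial_limit_at_right_real)
  have R: "R \<delta> > 0" using \<delta>(1) by (simp add: R_def add_nonneg_pos)
  obtain v0 T0 where v0: "v0 > 0" and tails: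
    "\<And>e F (m :: (nat \<Rightarrow> int) \<Rightarrow> real) A T. e > 0 \<Longrightarrow> finite F \<Longrightarrow> (\<And>l. l \<in> F \<Longrightarrow> (m l)\<^sup>2 / e\<^sup>2 \<le> v0) \<Longrightarrow>
      A = (\<Sum>l\<in>F. ((m l)\<^sup>2 / e\<^sup>2)\<^sup>2) / 2 \<Longrightarrow> A \<le> R \<delta> * T \<Longrightarrow> T \<ge> T0 \<Longrightarrow>
      \<exists>t. measure (PiM F (\<lambda>_. density lborel (normal_density 0 e)))
            {x\<in>space (PiM F (\<lambda>_. density lborel (normal_density 0 e))). t \<le> (\<Prod>l\<in>F. lr1 e (m l) (x l))}
          \<ge> exp (- (a\<^sup>2 * A / 2) - 2 * \<delta> * T) / 4 \<and>
        (\<integral>x. (\<Prod>l\<in>F. lr1 e (m l) (x l)) * indicator {..t} (\<Prod>l\<in>F. lr1 e (m l) (x l)) 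
            \<partial>PiM F (\<lambda>_. density lborel (normal_density 0 e)))
          \<ge> exp (- ((1 - a)\<^sup>2 * A / 2) - 2 * \<delta> * T) / 4"
    using lr_product_tails[OF a R \<delta>(1)] by blast
  have k1: "1 \<le> k" "k \<le> s" using k by auto
  have "\<rho>\<^sup>2 > 0" "v0 / 2 > 0" using \<rho> v0 by auto
  from flat_block_element[OF k1(1) sigma this \<delta>(1)] obtain \<epsilon>0 where \<epsilon>0: "\<epsilon>0 > 0" and flat:
    "\<And>\<epsilon> T d r. 0 < \<epsilon> \<Longrightarrow> \<epsilon> < \<epsilon>0 \<Longrightarrow> 1 \<le> T \<Longrightarrow> T \<le> ln (1 / \<epsilon>) \<Longrightarrow> k \<le> d \<Longrightarrow>
      Theta_block \<sigma> d {1..k} r \<noteq> {} \<Longrightarrow> (a_eps \<epsilon> \<sigma> d {1..k} r)\<^sup>2 \<le> \<rho>\<^sup>2 * T \<Longrightarrow>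
      \<exists>F e. finite F \<and> F \<subseteq> Zset {1..k} \<and> (\<forall>l. e l \<ge> 0) \<and> (\<forall>l. l \<notin> F \<longrightarrow> e l = 0) \<and>
        (\<Sum>l\<in>F. e l) \<ge> r\<^sup>2 \<and> (\<Sum>l\<in>F. csq \<sigma> d l * e l) \<le> 1 \<and> (\<forall>l. e l / \<epsilon>\<^sup>2 \<le> 2 * (v0 / 2)) \<and>
        (\<Sum>l\<in>F. (e l / \<epsilon>\<^sup>2)\<^sup>2) / 2 \<le> (1 + \<delta>) * ((a_eps \<epsilon> \<sigma> d {1..k} r)\<^sup>2 + \<delta> * T) + \<delta> * T"
    by blast
  \<comment> \<open>\<open>1\<close> and \<open>T0\<close> are demanded by the auxiliary results,
    \<open>ln 8 / \<delta>\<close> gives \<open>exp (\<delta> * T) \<ge> 8\<close>, and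
    \<open>ln 4 / \<beta>\<close> gives \<open>N powr \<beta> \<ge> 4\<close>, so that at most half
    of the blocks are active.\<close>
  define Tmin where "Tmin = Max {1, T0, ln 8 / \<delta>, ln 4 / \<beta>}"
  have Tmin: "1 \<le> Tmin" "T0 \<le> Tmin" "ln 8 / \<delta> \<le> Tmin" "ln 4 / \<beta> \<le> Tmin" by (auto simp: Tmin_def)
  have ev_binom: "eventually (\<lambda>\<epsilon>. exp Tmin \<le> real (d \<epsilon> choose j)) (at_right 0)" if "j \<in> {1..s}" for j
    using binomial_at_top[OF d_infty, of j] that by (simp add: filterlim_at_top)
  have ev_p: "eventually (\<lambda>\<epsilon>. 1 / 2 < real (p \<epsilon> j) / real (d \<epsilon> choose j) powr (1 - \<beta>) \<and>
      real (p \<epsilon> j) / real (d \<epsilon> choose j) powr (1 - \<beta>) < 2) (at_right 0)" if "j \<in> {1..s}" for j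
    by (intro eventually_conj order_tendstoD[OF p_asymp[OF that]]) simp_all
  have ev_log: "eventually (\<lambda>\<epsilon>. norm (ln (real (d \<epsilon> choose s))) \<le> 1 * norm (ln (1 / \<epsilon>))) (at_right 0)"
    using landau_o.smallD[OF log_binom, of 1] by simp
  \<comment> \<open>Below half of \<open>d\<close> the binomial coefficients increase in the lower
    index, so the logarithmic hypothesis at \<open>s\<close> transfers to every level
    \<open>k \<le> s\<close>.\<close>
  have ev_d: "eventually (\<lambda>\<epsilon>. 2 * s \<le> d \<epsilon>) (at_right 0)" using d_infty by (simp add: filterlim_at_top)
  have ev_small: "eventually (\<lambda>\<epsilon>. 0 < \<epsilon> \<and> \<epsilon> < min \<epsilon>0 1) (at_right (0::real))"
    using \<epsilon>0 by (intro eventually_at_right_field[THEN iffD2] exI[of _ "min \<epsilon>0 1"]) auto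
  have "eventually (\<lambda>\<epsilon>. \<forall>j\<in>{1..s}. exp Tmin \<le> real (d \<epsilon> choose j)) (at_right 0)"
    "eventually (\<lambda>\<epsilon>. \<forall>j\<in>{1..s}. 1 / 2 < real (p \<epsilon> j) / real (d \<epsilon> choose j) powr (1 - \<beta>) \<and>
      real (p \<epsilon> j) / real (d \<epsilon> choose j) powr (1 - \<beta>) < 2) (at_right 0)"
    using ev_binom ev_p by (intro eventually_ball_finite; simp)+
  then show ?thesis using ev_log ev_d ev_small Theta_nonempty
  proof eventually_elim
    case (elim \<epsilon>)
    have \<epsilon>: "0 < \<epsilon>" "\<epsilon> < \<epsilon>0" "\<epsilon> < 1" using elim(5) by auto
    define D where "D = d \<epsilon>"
    define T where "T = ln (real (D choose k))"
    define n where "n = real (D choose k)"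
    have bin: "exp Tmin \<le> real (D choose j)" if "j \<in> {1..s}" for j using elim(1) that by (simp add: D_def)
    have n: "exp Tmin \<le> n" "n > 0" using bin[OF k] less_le_trans[OF exp_gt_zero bin[OF k]] by (simp_all add: n_def)
    have nT: "n = exp T" using n(2) by (simp add: n_def T_def)
    have T: "Tmin \<le> T" using n(1) nT by simp
    then have "ln 8 / \<delta> \<le> T" using Tmin(3) by linarith
    then have T': "1 \<le> T" "T0 \<le> T" "ln 8 \<le> \<delta> * T" "0 < T"
      using T Tmin(1,2) \<delta>(1) by (simp_all add: pos_divide_le_eq mult.commute)
    have half: "real (p \<epsilon> j) \<le> real (D choose j) / 2" if j: "j \<in> {1..s}" for j
    proof -
      define N where "N = real (D choose j)"
      have N: "N > 0" "exp Tmin \<le> N" using bin[OF j] less_le_trans[OF exp_gt_zero bin[OF j]] by (simp_all add: N_def)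
      have "exp (ln 4 / \<beta>) \<le> N" using Tmin(4) N(2) by (meson exp_le_cancel_iff order_trans)
      then have "exp (ln 4 / \<beta>) powr \<beta> \<le> N powr \<beta>" using beta by (intro powr_mono2) auto
      then have 4: "4 \<le> N powr \<beta>" using beta by (simp add: powr_def)
      have "real (p \<epsilon> j) \<le> 2 * N powr (1 - \<beta>)"
        using elim(2) j N by (auto simp: N_def D_def divide_less_eq intro: less_imp_le)
      also have "N powr (1 - \<beta>) = N / N powr \<beta>" using N by (simp add: powr_diff)
      also have "2 * (N / N powr \<beta>) \<le> 2 * (N / 4)" using 4 N by (intro mult_left_mono divide_left_mono) auto
      finally show ?thesis by (simp add: N_def)
    qed
    have pj: "p \<epsilon> j \<le> D choose j" if "j \<in> {1..s}" for j using half[OF that] by linarith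
    have pk: "real (p \<epsilon> k) \<ge> exp ((1 - \<beta>) * T) / 2"
    proof -
      have "real (d \<epsilon> choose k) powr (1 - \<beta>) = exp ((1 - \<beta>) * T)"
        using n(2) by (simp add: powr_def T_def n_def D_def)
      then have "1 / 2 < real (p \<epsilon> k) / exp ((1 - \<beta>) * T)" using bspec[OF elim(2) k] by (simp only:)
      then have "1 / 2 * exp ((1 - \<beta>) * T) < real (p \<epsilon> k)" by (simp only: pos_less_divide_eq exp_gt_zero)
      then show ?thesis by simp
    qed
    have Tln: "T \<le> ln (1 / \<epsilon>)"
    proof -
      have s: "s \<in> {1..s}" using k by auto
      have "D choose k \<le> D choose s" using elim(4) k by (intro binomial_mono) (auto simp: D_def)
      then have "n \<le> real (D choose s)" by (simp add: n_def)
      then have "T \<le> ln (real (D choose s))"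
        unfolding T_def n_def[symmetric] using n(2) by (intro ln_le_cancel_iff[THEN iffD2]) linarith+
      also have "\<dots> \<le> ln (1 / \<epsilon>)" using elim(3) \<epsilon> by (simp add: D_def ln_div)
      finally show ?thesis .
    qed
    have sD: "s \<le> D" "k \<le> D" using elim(4) k by (auto simp: D_def)
    have ne: "Theta_total \<sigma> D s (r \<epsilon>) \<noteq> {}" using elim(6) by (simp add: D_def)
    have "{1..k} \<in> Ukd k D" using sD by (auto simp: Ukd_def)
    then have neb: "Theta_block \<sigma> D {1..k} (r \<epsilon> k) \<noteq> {}" using ne k unfolding Theta_total_def by blast
    show ?case
    proof
      assume lt: "a_eps \<epsilon> \<sigma> (d \<epsilon>) {1..k} (r \<epsilon> k) / sqrt (ln (real (d \<epsilon> choose k))) < \<rho>"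
      define \<alpha> where "\<alpha> = a_eps \<epsilon> \<sigma> D {1..k} (r \<epsilon> k)"
      have "\<alpha> \<ge> 0"
      proof -
        have "Inf {(\<Sum>\<^sub>\<infinity>l\<in>Zset {1..k}. (\<theta> l) ^ 4) | \<theta>. \<theta> \<in> Theta_block \<sigma> D {1..k} (r \<epsilon> k)} \<ge> 0"
          using neb by (intro cInf_greatest) (auto intro!: infsum_nonneg)
        then show ?thesis by (simp add: \<alpha>_def a_eps_def)
      qed
      moreover have "\<alpha> < \<rho> * sqrt T" using lt T'(4) by (simp add: \<alpha>_def D_def T_def divide_less_eq)
      ultimately have "\<alpha>\<^sup>2 \<le> (\<rho> * sqrt T)\<^sup>2" by (intro power_mono) auto
      then have \<alpha>2: "\<alpha>\<^sup>2 \<le> \<rho>\<^sup>2 * T" using T' by (simp add: power_mult_distrib)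
      obtain F e where F: "finite F" "F \<subseteq> Zset {1..k}" and e: "\<And>l. e l \<ge> 0"
        "(\<Sum>l\<in>F. e l) \<ge> (r \<epsilon> k)\<^sup>2" "(\<Sum>l\<in>F. csq \<sigma> D l * e l) \<le> 1" "\<And>l. e l / \<epsilon>\<^sup>2 \<le> v0"
        "(\<Sum>l\<in>F. (e l / \<epsilon>\<^sup>2)\<^sup>2) / 2 \<le> (1 + \<delta>) * (\<alpha>\<^sup>2 + \<delta> * T) + \<delta> * T"
        using flat[OF \<epsilon>(1,2) T'(1) Tln sD(2) neb \<alpha>2[unfolded \<alpha>_def]] unfolding \<alpha>_def by auto
      define A where "A = (\<Sum>l\<in>F. ((sqrt (e l))\<^sup>2 / \<epsilon>\<^sup>2)\<^sup>2) / 2"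
      have AR: "A \<le> R \<delta> * T"
      proof -
        have "A \<le> (1 + \<delta>) * (\<alpha>\<^sup>2 + \<delta> * T) + \<delta> * T" using e(5) e(1) by (simp add: A_def)
        also have "\<dots> \<le> (1 + \<delta>) * (\<rho>\<^sup>2 * T + \<delta> * T) + \<delta> * T" using \<alpha>2 \<delta>(1) by (intro add_mono mult_left_mono) auto
        also have "\<dots> = R \<delta> * T" by (simp add: R_def algebra_simps)
        finally show ?thesis .
      qed
      define B where "B = PiM F (\<lambda>_. density lborel (normal_density 0 \<epsilon>))"
      define Y where "Y y = (\<Prod>l\<in>F. lr1 \<epsilon> (sqrt (e l)) (y l))" for y
      obtain t where t: "measure B {x\<in>space B. t \<le> Y x} \<ge> exp (- (a\<^sup>2 * A / 2) - 2 * \<delta> * T) / 4"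
        "(\<integral>x. Y x * indicator {..t} (Y x) \<partial>B) \<ge> exp (- ((1 - a)\<^sup>2 * A / 2) - 2 * \<delta> * T) / 4"
        using tails[OF \<epsilon>(1) F(1), of "\<lambda>l. sqrt (e l)" A T] e(1,4) AR T'(2) unfolding A_def B_def Y_def by auto
      define P0 where "P0 = measure B {x\<in>space B. t \<le> Y x}"
      define P1 where "P1 = (\<integral>x. Y x * indicator {..t} (Y x) \<partial>B)"
      interpret B: prob_space B unfolding B_def by (rule lr_product_density[OF \<epsilon>(1) F(1)])
      have Y: "integrable B Y" "integral\<^sup>L B Y = 1"
        using lr_product_density(2,3)[OF \<epsilon>(1) F(1), of "\<lambda>l. sqrt (e l)"] by (simp_all add: B_def Y_def[abs_def])
      have Y0: "Y x \<ge> 0" for x unfolding Y_def by (intro prod_nonneg) (simp add: less_imp_le)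
      have P0: "0 \<le> P0" "P0 \<le> 1" by (simp_all add: P0_def)
      have P1: "0 \<le> P1" "P1 \<le> 1"
      proof -
        show "0 \<le> P1" unfolding P1_def using Y0 by (intro Bochner_Integration.integral_nonneg) simp
        have [measurable]: "Y \<in> borel_measurable B" using Y(1) by (rule borel_measurable_integrable)
        have "P1 \<le> integral\<^sup>L B Y" unfolding P1_def
        proof (rule integral_mono[OF _ Y(1)])
          show "integrable B (\<lambda>x. Y x * indicator {..t} (Y x))"
            by (rule Bochner_Integration.integrable_bound[OF Y(1)]) (auto simp: indicator_def)
          show "Y x * indicator {..t} (Y x) \<le> Y x" for x using Y0[of x] by (simp add: indicator_def)
        qed
        then show "P1 \<le> 1" using Y(2) by simp
      qed
      have e8: "8 \<le> exp (\<delta> * T)" using T'(3) by (metis exp_le_cancel_iff exp_ln zero_less_numeral)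
      have q0: "exp (- ((1 - \<delta>) * T)) / 4 \<le> P0"
      proof -
        have "a\<^sup>2 * A / 2 \<le> a\<^sup>2 * (R \<delta> * T) / 2" using AR by (intro divide_right_mono mult_left_mono) auto
        moreover have "(a\<^sup>2 * R \<delta> / 2 + 3 * \<delta>) * T \<le> 1 * T" using \<delta>(2) T' by (intro mult_right_mono) auto
        ultimately have "- ((1 - \<delta>) * T) \<le> - (a\<^sup>2 * A / 2) - 2 * \<delta> * T" by (simp add: algebra_simps)
        then have "exp (- ((1 - \<delta>) * T)) \<le> exp (- (a\<^sup>2 * A / 2) - 2 * \<delta> * T)" by simp
        then show ?thesis using t(1) unfolding P0_def by linarith
      qed
      have q1: "exp (- ((1 - \<beta> - \<delta>) * T)) / 4 \<le> P1"
      proof -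
        have "(1 - a)\<^sup>2 * A / 2 \<le> (1 - a)\<^sup>2 * (R \<delta> * T) / 2" using AR by (intro divide_right_mono mult_left_mono) auto
        moreover have "((1 - a)\<^sup>2 * R \<delta> / 2 + 3 * \<delta>) * T \<le> (1 - \<beta>) * T" using \<delta>(3) T' by (intro mult_right_mono) auto
        ultimately have "- ((1 - \<beta> - \<delta>) * T) \<le> - ((1 - a)\<^sup>2 * A / 2) - 2 * \<delta> * T" by (simp add: algebra_simps)
        then have "exp (- ((1 - \<beta> - \<delta>) * T)) \<le> exp (- ((1 - a)\<^sup>2 * A / 2) - 2 * \<delta> * T)" by simp
        then show ?thesis using t(2) unfolding P1_def by linarith
      qed
      \<comment> \<open>At least \<open>exp T / 2\<close> blocks are inactive; the surplus
        \<open>exp (\<delta> * T) \<ge> 8\<close> pays for this 2 and the 4 in \<open>q0\<close>.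
        The active blocks are treated alike with \<open>exp ((1 - \<beta>) * T) / 2\<close>.\<close>
      have m0: "real ((D choose k) - p \<epsilon> k) * P0 \<ge> 1"
      proof -
        have "1 \<le> exp (\<delta> * T) / 8" using e8 by simp
        also have "\<dots> = (exp T / 2) * (exp (- ((1 - \<delta>) * T)) / 4)"
          by (simp add: exp_add[symmetric] algebra_simps)
        also have "\<dots> \<le> real ((D choose k) - p \<epsilon> k) * P0"
        proof (rule mult_mono)
          show "exp T / 2 \<le> real ((D choose k) - p \<epsilon> k)" using half[OF k] pj[OF k] nT by (simp add: n_def of_nat_diff)
        qed (use q0 in auto)
        finally show ?thesis .
      qed
      have m1: "real (p \<epsilon> k) * P1 \<ge> 1"
      proof -
        have "1 \<le> exp (\<delta> * T) / 8" using e8 by simp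
        also have "\<dots> = (exp ((1 - \<beta>) * T) / 2) * (exp (- ((1 - \<beta> - \<delta>) * T)) / 4)"
          by (simp add: exp_add[symmetric] algebra_simps)
        also have "\<dots> \<le> real (p \<epsilon> k) * P1" using pk q1 by (intro mult_mono) auto
        finally show ?thesis .
      qed
      define c where "c = (1 - (1 - P0) ^ ((D choose k) - p \<epsilon> k)) * (1 - (1 - P1) ^ p \<epsilon> k) / 2"
      have "(1 - exp (- 1)) * (1 - exp (- 1)) \<le> (1 - (1 - P0) ^ ((D choose k) - p \<epsilon> k)) * (1 - (1 - P1) ^ p \<epsilon> k)"
        using one_minus_power_le_exp[OF P0 m0] one_minus_power_le_exp[OF P1 m1] P0
        by (intro mult_mono) (auto simp: power_le_one)
      then have c: "(1 - exp (- 1))\<^sup>2 / 2 \<le> c" by (simp add: c_def power2_eq_square)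
      have "ereal ((1 - exp (- 1))\<^sup>2 / 2) \<le> (SUP \<eta>\<in>Hset D s (p \<epsilon>). SUP \<theta>\<in>Theta_total \<sigma> D s (r \<epsilon>). ereal (risk \<epsilon> D s sel \<theta> \<eta>))"
        if sel: "sel \<in> selectors D s" for sel
      proof -
        obtain \<eta> \<theta> where *: "\<eta> \<in> Hset D s (p \<epsilon>)" "\<theta> \<in> Theta_total \<sigma> D s (r \<epsilon>)" "c \<le> risk \<epsilon> D s sel \<theta> \<eta>"
          using risk_lower_bound[where p="p \<epsilon>" and r="r \<epsilon>" and t=t, OF \<epsilon>(1) sD(1) k pj ne F e(1,2,3) sel,
            folded B_def, folded Y_def, folded P0_def P1_def, folded c_def] by blast
        have "ereal ((1 - exp (- 1))\<^sup>2 / 2) \<le> ereal (risk \<epsilon> D s sel \<theta> \<eta>)" using c *(3) by simp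
        then show ?thesis by (intro SUP_upper2[OF *(1)] SUP_upper2[OF *(2)])
      qed
      then show "ereal ((1 - exp (- 1))\<^sup>2 / 2) \<le> minimax_risk \<epsilon> \<sigma> (d \<epsilon>) s (p \<epsilon>) (r \<epsilon>)"
        unfolding minimax_risk_def D_def[symmetric] by (rule INF_greatest)
    qed
  qed
qed

text \<open>Strict positivity comes from an explicit constant: eventually the minimax risk is at
  least \<open>(1 - exp (- 1))^2 / 2\<close>, one factor \<open>1 - exp (- 1)\<close> for each kind
  of misleading block and 1/2 for the posterior comparison.\<close>

theorem theorem3:
  fixes s :: nat and \<beta> \<sigma> :: real
    and d :: "real \<Rightarrow> nat"
    and r :: "real \<Rightarrow> nat \<Rightarrow> real"
    and p :: "real \<Rightarrow> nat \<Rightarrow> nat"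
  assumes s_pos: "1 \<le> s"
    and beta: "0 < \<beta>" "\<beta> < 1"
    and sigma: "0 < \<sigma>"
    and d_infty: "filterlim d at_top (at_right 0)"
    and log_binom: "(\<lambda>\<epsilon>. ln (real (d \<epsilon> choose s))) \<in> o[at_right 0](\<lambda>\<epsilon>. ln (1 / \<epsilon>))"
    and r_pos: "\<And>\<epsilon> k. 0 < \<epsilon> \<Longrightarrow> k \<in> {1..s} \<Longrightarrow> 0 < r \<epsilon> k"
    and p_asymp: "\<And>k. k \<in> {1..s} \<Longrightarrow>
        ((\<lambda>\<epsilon>. real (p \<epsilon> k) / real (d \<epsilon> choose k) powr (1 - \<beta>)) \<longlongrightarrow> 1) (at_right 0)"
    and Theta_nonempty: "eventually (\<lambda>\<epsilon>. Theta_total \<sigma> (d \<epsilon>) s (r \<epsilon>) \<noteq> {}) (at_right 0)"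
    and below: "Limsup (at_right 0) (\<lambda>\<epsilon>. ereal (Min ((\<lambda>k. a_eps \<epsilon> \<sigma> (d \<epsilon>) {1..k} (r \<epsilon> k)
                   / sqrt (ln (real (d \<epsilon> choose k)))) ` {1..s})))
               < ereal (sqrt 2 * (1 + sqrt (1 - \<beta>)))"
  shows "Liminf (at_right 0) (\<lambda>\<epsilon>. minimax_risk \<epsilon> \<sigma> (d \<epsilon>) s (p \<epsilon>) (r \<epsilon>)) > 0"
proof -
  define G where "G \<epsilon> k = a_eps \<epsilon> \<sigma> (d \<epsilon>) {1..k} (r \<epsilon> k) / sqrt (ln (real (d \<epsilon> choose k)))" for \<epsilon> k
  define \<rho>0 where "\<rho>0 = sqrt 2 * (1 + sqrt (1 - \<beta>))"
  have "\<rho>0 > 0" using beta by (simp add: \<rho>0_def add_pos_nonneg)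
  obtain \<rho>' where \<rho>': "Limsup (at_right 0) (\<lambda>\<epsilon>. ereal (Min (G \<epsilon> ` {1..s}))) < ereal \<rho>'" "\<rho>' < \<rho>0"
    using ereal_dense2[OF below] unfolding G_def \<rho>0_def by auto
  \<comment> \<open>The number between the upper limit and the threshold need not be positive; the
    maximum makes it so, as the bound for a fixed level requires.\<close>
  define \<rho> where "\<rho> = max \<rho>' (\<rho>0 / 2)"
  have \<rho>: "0 < \<rho>" "\<rho> < \<rho>0" using \<open>\<rho>0 > 0\<close> \<rho>' by (auto simp: \<rho>_def)
  have "eventually (\<lambda>\<epsilon>. ereal (Min (G \<epsilon> ` {1..s})) < ereal \<rho>') (at_right 0)"
    by (rule Limsup_lessD[OF \<rho>'(1)])
  moreover have "eventually (\<lambda>\<epsilon>. \<forall>k\<in>{1..s}. G \<epsilon> k < \<rho> \<longrightarrow>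
      ereal ((1 - exp (- 1))\<^sup>2 / 2) \<le> minimax_risk \<epsilon> \<sigma> (d \<epsilon>) s (p \<epsilon>) (r \<epsilon>)) (at_right 0)"
  proof (rule eventually_ball_finite; (intro ballI)?)
    fix k assume k: "k \<in> {1..s}"
    show "eventually (\<lambda>\<epsilon>. G \<epsilon> k < \<rho> \<longrightarrow>
      ereal ((1 - exp (- 1))\<^sup>2 / 2) \<le> minimax_risk \<epsilon> \<sigma> (d \<epsilon>) s (p \<epsilon>) (r \<epsilon>)) (at_right 0)"
      unfolding G_def
      by (rule minimax_risk_lower_bound[OF k beta sigma \<rho>[unfolded \<rho>0_def] d_infty log_binom p_asymp Theta_nonempty])
  qed simp
  ultimately have "eventually (\<lambda>\<epsilon>. ereal ((1 - exp (- 1))\<^sup>2 / 2) \<le> minimax_risk \<epsilon> \<sigma> (d \<epsilon>) s (p \<epsilon>) (r \<epsilon>)) (at_right 0)"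
  proof eventually_elim
    case (elim \<epsilon>)
    have "Min (G \<epsilon> ` {1..s}) \<in> G \<epsilon> ` {1..s}" using s_pos by (intro Min_in) auto
    then obtain k where k: "k \<in> {1..s}" "Min (G \<epsilon> ` {1..s}) = G \<epsilon> k" by blast
    then have "G \<epsilon> k < \<rho>" using elim(1) by (simp add: \<rho>_def less_max_iff_disj)
    then show ?case using elim(2) k(1) by blast
  qed
  then have "ereal ((1 - exp (- 1))\<^sup>2 / 2) \<le> Liminf (at_right 0) (\<lambda>\<epsilon>. minimax_risk \<epsilon> \<sigma> (d \<epsilon>) s (p \<epsilon>) (r \<epsilon>))"
    by (rule Liminf_bounded)
  moreover have "0 < ereal ((1 - exp (- 1))\<^sup>2 / 2)" by simp
  ultimately show ?thesis by (rule less_le_trans[rotated])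
qed

end
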